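(* Let $N$ be a positive integer, let $a_1,\dots,a_N\in\mathbb{C}$, and let $f(s)=\sum_{n=1}^N a_n n^{-s}$. Then $$\left(\sum_{n=1}^N \frac{|a_n|^2}{\Phi_{2/q}(n)}\right)^{1/2}\le \|f\|_q \qquad\text{for every real } 0<q\le 2,$$ and $$\|f\|_q\le\left(\sum_{n=1}^N |a_n|^2\,\Phi_{q/2}(n)\right)^{1/2}\qquad\text{for every real } q\ge 2 .$$
   Context: For a Dirichlet polynomial $f(s)=\sum_{n=1}^N a_n n^{-s}$ and $0<q<\infty$, $$\|f\|_q:=\left(\lim_{T\to\infty}\frac1T\int_0^T|f(it)|^q\,dt\right)^{1/q}$$ (the limit exists). $\Omega(n)$ denotes the number of prime factors of $n$ counted with multiplicity. For a positive integer $k$, $d_k(n)$ is the number of ways of writing $n$ as an ordered product of $k$ positive integers, i.e. $d_k(n)=\sum_{n_1\cdots n_k=n}1$. For real $\alpha\ge1$, $$\Phi_\alpha(n):=d_{\lfloor\alpha\rfloor}(n)\left(\frac{\alpha}{\lfloor\alpha\rfloor}\right)^{\Omega(n)} .$$ *)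

theory Defs
  imports "HOL-Analysis.Analysis" "HOL-Computational_Algebra.Primes"
begin

definition dirichlet_poly :: "nat \<Rightarrow> (nat \<Rightarrow> complex) \<Rightarrow> complex \<Rightarrow> complex" where
  "dirichlet_poly N a s = (\<Sum>n=1..N. a n * of_nat n powr (- s))"

text \<open>
  The limit exists whenever \<open>f\<close> is a Dirichlet polynomial and \<open>q > 0\<close>; for other functions the
  value may be meaningless.
\<close>
definition besicovitch_norm :: "real \<Rightarrow> (complex \<Rightarrow> complex) \<Rightarrow> real" where
  "besicovitch_norm q f =
     (Lim at_top (\<lambda>T::real. 1 / T * integral {0..T} (\<lambda>t. norm (f (\<i> * of_real t)) powr q)))
       powr (1 / q)"

definition big_omega :: "nat \<Rightarrow> nat" where
  "big_omega n = size (prime_factorization n)"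

definition divisor_fun :: "nat \<Rightarrow> nat \<Rightarrow> nat" where
  "divisor_fun k n = card {xs :: nat list. length xs = k \<and> (\<forall>x\<in>set xs. x > 0) \<and> prod_list xs = n}"

definition Phi :: "real \<Rightarrow> nat \<Rightarrow> real" where
  "Phi \<alpha> n = real (divisor_fun (nat \<lfloor>\<alpha>\<rfloor>) n) * (\<alpha> / of_int \<lfloor>\<alpha>\<rfloor>) ^ big_omega n"

end

theory Submission
  imports Defs "HOL-Complex_Analysis.Conformal_Mappings"
begin

text \<open>
  By Bohr's correspondence the primes act as independent variables on the unit circle, and
  Minkowski's inequality reduces the claim to one variable, where it combines two facts with
  \<open>k = \<lfloor>\<alpha>\<rfloor>\<close>. The first is the case of an integer parameter \<open>k\<close>, which is Carleman's inequality below
  the exponent 2 and the Cauchy-Schwarz inequality for the coefficients of \<open>f ^ k\<close> above it. The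
  second is Weissler's theorem: the dilation by \<open>r\<close> is a contraction from exponent \<open>p\<close> to exponent
  \<open>p * s\<close> on analytic polynomials when \<open>r\<^sup>2 * s = 1\<close>. Weissler's theorem is dual, through Gibbs'
  variational principle, to the fact that the Poisson semigroup contracts entropy by the factor \<open>r\<^sup>2\<close>,
  and the latter holds since \<open>\<bar>b'\<bar>\<^sup>2 / Re b\<close> is subharmonic. Zeros of \<open>f\<close> play no role: \<open>\<bar>f\<bar>\<close> is
  majorized by the modulus of a zero-free function with nearly the same norm, found by trigonometric
  approximation on the circle and the maximum principle.
\<close>

section \<open>Averages over the unit circle\<close>

text \<open>No torus is built. One prime \<open>p\<close> is split off at a time: its powers become
  the variable on the circle, while the other primes stay inside functions of the real variable
  \<open>t\<close>, and averaging over them remains a mean over \<open>t\<close>.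

  Powers of moduli of analytic functions do not behave linearly under the Poisson semigroup. Duality
  trades them for a density, and a density \<open>Re b\<close> is harmonic, so the semigroup acts on
  it by plain dilation.

  For Weissler's theorem any majorant of \<open>norm f\<close> on the disc will do. For Carleman's
  inequality this is not clear, because single coefficients are not monotone in the modulus. The
  weighted sum of their squares is monotone: it is an average of mean squares over circles of radius
  at most 1.

  The two facts fit together because, with s = \<alpha> / k, the dilation multiplies the squared
  coefficient of index j by the j-th power of 1 / s. This is precisely the factor of the weight that
  involves the number of prime factors.\<close>

abbreviation circle :: "complex set" where
  "circle \<equiv> sphere 0 1"

definition cavg :: "(complex \<Rightarrow> 'a::banach) \<Rightarrow> 'a" where
  "cavg F = (1 / (2 * pi)) *\<^sub>R integral {0..2 * pi} (\<lambda>x. F (cis x))"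

lemma circle_parametrized:
  assumes "continuous_on circle F"
  shows "continuous_on S (\<lambda>x. F (cis x))"
  by (rule continuous_on_compose2[OF assms]) (auto intro!: continuous_intros)

lemma cavg_integrable:
  fixes F :: "complex \<Rightarrow> 'a::banach"
  assumes "continuous_on circle F"
  shows "(\<lambda>x. F (cis x)) integrable_on {0..2 * pi}"
  by (intro integrable_continuous_real circle_parametrized assms)

lemma cavg_cong:
  assumes "\<And>z. z \<in> circle \<Longrightarrow> F z = G z"
  shows "cavg F = cavg G"
  unfolding cavg_def by (intro arg_cong[where f="scaleR _"] integral_cong) (simp add: assms)

lemma cavg_const [simp]: "cavg (\<lambda>z. c) = (c :: 'a::banach)"
  by (simp add: cavg_def)

lemma cavg_add:
  assumes "continuous_on circle F" "continuous_on circle G"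
  shows "cavg (\<lambda>z. F z + G z) = cavg F + cavg G"
  unfolding cavg_def
  by (simp add: integral_add cavg_integrable assms scaleR_add_right)

lemma cavg_diff:
  assumes "continuous_on circle F" "continuous_on circle G"
  shows "cavg (\<lambda>z. F z - G z) = cavg F - cavg G"
  unfolding cavg_def
  by (simp add: integral_diff cavg_integrable assms scaleR_diff_right)

lemma cavg_cmult:
  fixes c :: "'a::{real_normed_field,banach}"
  shows "cavg (\<lambda>z. c * F z) = c * cavg F"
  unfolding cavg_def by simp

lemma cavg_sum:
  assumes "finite A" "\<And>i. i \<in> A \<Longrightarrow> continuous_on circle (F i)"
  shows "cavg (\<lambda>z. \<Sum>i\<in>A. F i z) = (\<Sum>i\<in>A. cavg (F i))"
  unfolding cavg_def
  by (simp add: integral_sum cavg_integrable assms scaleR_sum_right)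

lemma cavg_bounded_linear:
  assumes "bounded_linear h" "continuous_on circle F"
  shows "cavg (\<lambda>z. h (F z)) = h (cavg F)"
proof -
  interpret bounded_linear h by fact
  show ?thesis
    unfolding cavg_def using integral_linear[OF cavg_integrable[OF assms(2)] assms(1)]
    by (simp add: o_def scaleR)
qed

lemmas cavg_Re = cavg_bounded_linear[OF bounded_linear_Re]
  and cavg_of_real = cavg_bounded_linear[OF bounded_linear_of_real]

lemma cavg_mono:
  fixes F G :: "complex \<Rightarrow> real"
  assumes "continuous_on circle F" "continuous_on circle G" "\<And>z. z \<in> circle \<Longrightarrow> F z \<le> G z"
  shows "cavg F \<le> cavg G"
  unfolding cavg_def
  by (simp, intro divide_right_mono integral_le cavg_integrable assms) auto

lemma cavg_nonneg:
  fixes F :: "complex \<Rightarrow> real"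
  assumes "continuous_on circle F" "\<And>z. z \<in> circle \<Longrightarrow> 0 \<le> F z"
  shows "0 \<le> cavg F"
  using cavg_mono[of "\<lambda>_. 0" F] assms by simp

lemma cavg_pos:
  fixes F :: "complex \<Rightarrow> real"
  assumes "continuous_on circle F" "\<And>z. z \<in> circle \<Longrightarrow> 0 < F z"
  shows "0 < cavg F"
proof -
  have "\<exists>x\<in>circle. \<forall>y\<in>circle. F x \<le> F y"
    by (rule continuous_attains_inf) (use assms(1) in auto)
  then obtain x where "x \<in> circle" "\<And>y. y \<in> circle \<Longrightarrow> F x \<le> F y"
    by blast
  then show ?thesis
    using cavg_mono[of "\<lambda>_. F x" F] assms by fastforce
qed

lemma norm_cavg_le:
  fixes F :: "complex \<Rightarrow> 'a::euclidean_space"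
  assumes "continuous_on circle F" "\<And>z. z \<in> circle \<Longrightarrow> norm (F z) \<le> B"
  shows "norm (cavg F) \<le> B"
proof -
  have "norm (integral {0..2 * pi} (\<lambda>x. F (cis x))) \<le> integral {0..2 * pi} (\<lambda>x. B)"
    using assms by (intro integral_norm_bound_integral cavg_integrable) auto
  also have "\<dots> = 2 * pi * B"
    by simp
  finally show ?thesis
    by (simp add: cavg_def divide_simps mult.commute)
qed

lemma integral_cis_multiple:
  assumes "k \<noteq> 0"
  shows "integral {0..2 * pi} (\<lambda>x. cis (of_int k * x)) = 0"
proof -
  have "((\<lambda>x. cis (of_int k * x)) has_integral
      cis (of_int k * (2 * pi)) / (\<i> * of_int k) - cis (of_int k * 0) / (\<i> * of_int k)) {0..2 * pi}"
  proof (rule fundamental_theorem_of_calculus)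
    fix x :: real assume "x \<in> {0..2 * pi}"
    have "((\<lambda>x. exp (\<i> * (of_int k * x)) / (\<i> * of_int k)) has_vector_derivative
        exp (\<i> * (of_int k * of_real x)) * (\<i> * of_int k) / (\<i> * of_int k)) (at x within {0..2 * pi})"
      using assms
      by (auto intro!: derivative_eq_intros has_vector_derivative_real_field simp: field_simps)
    then show "((\<lambda>x. cis (of_int k * x) / (\<i> * of_int k)) has_vector_derivative cis (of_int k * x))
        (at x within {0..2 * pi})"
      using assms by (simp add: cis_conv_exp)
  qed simp
  moreover have "cis (of_int k * (2 * pi)) = 1"
    using cis_multiple_2pi[of "of_int k"] by (simp add: mult.commute mult.left_commute)
  ultimately show ?thesis
    by (simp add: integral_unique)
qed

lemma cavg_monomials:
  "cavg (\<lambda>z. z ^ m * cnj z ^ n) = (if m = n then 1 else 0)"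
proof -
  have *: "cis x ^ m * cnj (cis x) ^ n = cis (of_int (int m - int n) * x)" for x
  proof -
    have "cis x ^ m * cnj (cis x) ^ n = cis (real m * x) * cis (real n * (- x))"
      by (simp add: Complex.DeMoivre cis_cnj)
    then show ?thesis
      by (simp add: cis_mult algebra_simps)
  qed
  show ?thesis
  proof (cases "m = n")
    case True
    then have "cis x ^ m * cnj (cis x) ^ n = 1" for x
      unfolding * by simp
    with True show ?thesis
      by (simp add: cavg_def)
  next
    case False
    then show ?thesis
      using integral_cis_multiple[of "int m - int n"] by (simp add: cavg_def * )
  qed
qed

lemma poly_extend:
  assumes "degree (p :: 'a::comm_semiring_1 poly) \<le> N"
  shows "poly p z = (\<Sum>i\<le>N. coeff p i * z ^ i)"
  unfolding poly_altdef
  by (rule sum.mono_neutral_left) (use assms in \<open>auto simp: coeff_eq_0\<close>)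

text \<open>Orthogonality of the monomials leaves the diagonal. A bound on the degree of
  \<open>p\<close> alone suffices, since every later diagonal term contains a vanishing coefficient
  of \<open>p\<close>.\<close>

lemma cavg_poly_times_cnj_poly:
  fixes r :: real
  assumes "degree p \<le> N"
  shows "cavg (\<lambda>z. poly p (of_real r * z) * cnj (poly q z)) =
    (\<Sum>i\<le>N. of_real r ^ i * coeff p i * cnj (coeff q i))"
proof -
  define M where "M = max N (degree q)"
  have p: "degree p \<le> M" and q: "degree q \<le> M"
    using assms by (auto simp: M_def)
  have "cavg (\<lambda>z. poly p (of_real r * z) * cnj (poly q z)) =
     cavg (\<lambda>z. \<Sum>i\<le>M. \<Sum>j\<le>M. (of_real r ^ i * coeff p i * cnj (coeff q j)) * (z ^ i * cnj z ^ j))"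
    unfolding poly_extend[OF p] poly_extend[OF q] cnj_sum sum_product
    by (intro cavg_cong sum.cong refl) (simp add: power_mult_distrib)
  also have "\<dots> = (\<Sum>i\<le>M. \<Sum>j\<le>M. (of_real r ^ i * coeff p i * cnj (coeff q j)) * (if i = j then 1 else 0))"
    by (simp add: cavg_sum cavg_cmult cavg_monomials continuous_intros)
  also have "\<dots> = (\<Sum>i\<le>M. of_real r ^ i * coeff p i * cnj (coeff q i))"
    by (intro sum.cong refl) (simp add: if_distrib sum.delta cong: if_cong)
  also have "\<dots> = (\<Sum>i\<le>N. of_real r ^ i * coeff p i * cnj (coeff q i))"
    by (rule sum.mono_neutral_right) (use assms in \<open>auto simp: M_def coeff_eq_0\<close>)
  finally show ?thesis .
qed

lemma cavg_norm_poly_squared: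
  fixes r :: real
  assumes "degree p \<le> N"
  shows "cavg (\<lambda>z. (norm (poly p (of_real r * z)))\<^sup>2) = (\<Sum>i\<le>N. r ^ (2 * i) * (norm (coeff p i))\<^sup>2)"
proof -
  define q where "q = pcompose p [:0, of_real r:]"
  have q: "poly q z = poly p (of_real r * z)" for z
    by (simp add: q_def poly_pcompose mult.commute)
  have cq: "coeff q i = of_real r ^ i * coeff p i" for i
    by (simp add: q_def coeff_pcompose_linear)
  have dq: "degree q \<le> N"
    using assms by (auto simp: q_def degree_pcompose)
  have "of_real (cavg (\<lambda>z. (norm (poly q z))\<^sup>2)) = cavg (\<lambda>z. poly q (of_real 1 * z) * cnj (poly q z))"
    by (subst cavg_of_real[symmetric]) (auto intro!: continuous_intros cavg_cong simp flip: complex_norm_square)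
  also have "\<dots> = (\<Sum>i\<le>N. of_real 1 ^ i * coeff q i * cnj (coeff q i))"
    by (rule cavg_poly_times_cnj_poly[OF dq])
  also have "\<dots> = of_real (\<Sum>i\<le>N. r ^ (2 * i) * (norm (coeff p i))\<^sup>2)"
    unfolding of_real_sum of_real_mult complex_norm_square
    by (intro sum.cong refl) (simp add: cq power_mult power2_eq_square mult_ac)
  finally show ?thesis
    by (simp only: of_real_eq_iff q)
qed

lemma cavg_poly: "cavg (\<lambda>z. poly p (of_real r * z)) = poly p 0"
  using cavg_poly_times_cnj_poly[of p "degree p" r 1]
  by (simp add: of_bool_def if_distrib sum.delta poly_0_coeff_0 cong: if_cong)

lemma cavg_Re_poly: "cavg (\<lambda>z. Re (poly p (of_real r * z))) = Re (poly p 0)"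
  by (subst cavg_Re) (auto intro!: continuous_intros simp: cavg_poly)

text \<open>On harmonic functions dilation is a Fourier multiplier with a real symmetric symbol.
  Concretely, in \<open>Re a * Re b\<close> the part from \<open>a * b\<close> is analytic and its
  average is blind to dilation; the part from \<open>a * cnj b\<close> gives a diagonal sum in which
  \<open>r ^ i\<close> may be attached to either factor.\<close>

lemma cavg_Re_poly_self_adjoint:
  "cavg (\<lambda>z. Re (poly p (of_real r * z)) * Re (poly q z)) =
   cavg (\<lambda>z. Re (poly p z) * Re (poly q (of_real r * z)))"
proof -
  have ReRe: "Re a * Re b = (Re (a * b) + Re (a * cnj b)) / 2" for a b :: complex
    by simp
  have split: "cavg (\<lambda>z. Re (poly p (of_real r * z)) * Re (poly q (of_real s * z))) =
    (Re (poly p 0 * poly q 0) + Re (cavg (\<lambda>z. poly p (of_real r * z) * cnj (poly q (of_real s * z))))) / 2"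
    for p q r s
  proof -
    define R where "R = pcompose p [:0, of_real r:] * pcompose q [:0, of_real s:]"
    have R: "poly R z = poly p (of_real r * z) * poly q (of_real s * z)" for z
      by (simp add: R_def poly_pcompose mult.commute)
    have "cavg (\<lambda>z. Re (poly p (of_real r * z)) * Re (poly q (of_real s * z))) =
      cavg (\<lambda>z. (1/2) * (Re (poly R (of_real 1 * z)) + Re (poly p (of_real r * z) * cnj (poly q (of_real s * z)))))"
      by (intro cavg_cong) (simp only: R ReRe, simp)
    also have "\<dots> = (1/2) * (Re (poly R 0) + Re (cavg (\<lambda>z. poly p (of_real r * z) * cnj (poly q (of_real s * z)))))"
      unfolding cavg_cmult
      by (subst cavg_add, (auto intro!: continuous_intros)[2], subst cavg_Re_poly, subst cavg_Re)
         (auto intro!: continuous_intros)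
    finally show ?thesis
      using R[of 0] by (simp del: times_complex.sel)
  qed
  have "Re (cavg (\<lambda>z. poly p (of_real r * z) * cnj (poly q z))) =
        Re (cavg (\<lambda>z. poly p z * cnj (poly q (of_real r * z))))"
  proof -
    define N where "N = max (degree p) (degree q)"
    have d: "degree p \<le> N" "degree q \<le> N"
      by (auto simp: N_def)
    have "Re (cavg (\<lambda>z. poly p z * cnj (poly q (of_real r * z)))) =
          Re (cnj (cavg (\<lambda>z. poly q (of_real r * z) * cnj (poly p z))))"
      by (subst cavg_bounded_linear[OF bounded_linear_cnj, symmetric])
         (auto intro!: continuous_intros simp: mult.commute)
    also have "\<dots> = (\<Sum>i\<le>N. Re (of_real r ^ i * coeff q i * cnj (coeff p i)))"
      unfolding cavg_poly_times_cnj_poly[OF d(2)] by (simp only: cnj.sel Re_sum)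
    also have "\<dots> = (\<Sum>i\<le>N. Re (of_real r ^ i * coeff p i * cnj (coeff q i)))"
      by (intro sum.cong refl) (simp add: algebra_simps flip: of_real_power)
    also have "\<dots> = Re (cavg (\<lambda>z. poly p (of_real r * z) * cnj (poly q z)))"
      unfolding cavg_poly_times_cnj_poly[OF d(1)] by (simp only: Re_sum)
    finally show ?thesis ..
  qed
  with split[of p r q 1] split[of p 1 q r] show ?thesis
    by simp
qed

section \<open>Harmonic polynomials on the unit disc\<close>

text \<open>On the circle these are exactly the real trigonometric polynomials, as negative
  frequencies are conjugates of positive ones. In this form each comes with its harmonic extension
  \<open>Re (poly p z)\<close> to the disc.\<close>

definition circle_trig_poly :: "(complex \<Rightarrow> real) \<Rightarrow> bool" where
  "circle_trig_poly F \<longleftrightarrow> (\<exists>p. \<forall>z\<in>circle. F z = Re (poly p z))"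

lemma circle_trig_poly_const: "circle_trig_poly (\<lambda>z. c)"
  unfolding circle_trig_poly_def by (rule exI[of _ "[:of_real c:]"]) simp

lemma circle_trig_poly_add:
  assumes "circle_trig_poly F" "circle_trig_poly G"
  shows "circle_trig_poly (\<lambda>z. F z + G z)"
proof -
  obtain p q where "\<forall>z\<in>circle. F z = Re (poly p z)" "\<forall>z\<in>circle. G z = Re (poly q z)"
    using assms unfolding circle_trig_poly_def by blast
  then show ?thesis
    unfolding circle_trig_poly_def by (intro exI[of _ "p + q"]) simp
qed

lemma circle_trig_poly_sum:
  assumes "\<And>i. i \<in> A \<Longrightarrow> circle_trig_poly (F i)"
  shows "circle_trig_poly (\<lambda>z. \<Sum>i\<in>A. F i z)"
  using assms
proof (induction A rule: infinite_finite_induct)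
  case (insert i A)
  then have "circle_trig_poly (\<lambda>z. F i z + (\<Sum>i\<in>A. F i z))"
    by (intro circle_trig_poly_add) auto
  then show ?case
    using insert.hyps by simp
qed (simp_all add: circle_trig_poly_const)

text \<open>On the circle \<open>z * cnj z = 1\<close> cancels one of the two powers. A surplus of
  \<open>cnj z\<close> is conjugated away inside the real part, which conjugates
  \<open>c\<close>.\<close>

lemma circle_trig_poly_monomial: "circle_trig_poly (\<lambda>z. Re (c * (z ^ m * cnj z ^ n)))"
proof (cases "n \<le> m")
  case True
  have "z ^ m * cnj z ^ n = z ^ (m - n)" if "z \<in> circle" for z
  proof -
    have "z ^ m * cnj z ^ n = z ^ (m - n) * (z * cnj z) ^ n"
      unfolding power_mult_distrib mult.assoc[symmetric] power_add[symmetric] using True by simp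
    then show ?thesis
      using that by (simp flip: complex_norm_square)
  qed
  then show ?thesis
    unfolding circle_trig_poly_def by (intro exI[of _ "monom c (m - n)"]) (simp add: poly_monom)
next
  case False
  have "z ^ m * cnj z ^ n = cnj (z ^ (n - m))" if "z \<in> circle" for z
  proof -
    have "z ^ m * cnj z ^ n = (z * cnj z) ^ m * cnj z ^ (n - m)"
      unfolding power_mult_distrib mult.assoc power_add[symmetric] using False by simp
    then show ?thesis
      using that by (simp flip: complex_norm_square)
  qed
  moreover have "Re (c * cnj w) = Re (cnj c * w)" for w
    by simp
  ultimately have "Re (c * (z ^ m * cnj z ^ n)) = Re (poly (monom (cnj c) (n - m)) z)" if "z \<in> circle" for z
    using that by (simp only: poly_monom)
  then show ?thesis
    unfolding circle_trig_poly_def by blast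
qed

lemma circle_trig_poly_mult:
  assumes "circle_trig_poly F" "circle_trig_poly G"
  shows "circle_trig_poly (\<lambda>z. F z * G z)"
proof -
  obtain p q where pq: "\<forall>z\<in>circle. F z = Re (poly p z)" "\<forall>z\<in>circle. G z = Re (poly q z)"
    using assms unfolding circle_trig_poly_def by blast
  have eq: "Re (poly p z) * Re (poly q z) =
      Re (poly (smult (1/2) (p * q)) z) +
      (\<Sum>i\<le>degree p. \<Sum>j\<le>degree q. Re ((coeff p i * cnj (coeff q j) / 2) * (z ^ i * cnj z ^ j)))" for z
  proof -
    have "(\<Sum>i\<le>degree p. \<Sum>j\<le>degree q. Re ((coeff p i * cnj (coeff q j) / 2) * (z ^ i * cnj z ^ j))) =
        Re (\<Sum>i\<le>degree p. \<Sum>j\<le>degree q. (coeff p i * z ^ i) * cnj (coeff q j * z ^ j) / 2)"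
      by (simp only: Re_sum) (intro sum.cong refl arg_cong[where f=Re], simp)
    also have "\<dots> = Re (poly p z * cnj (poly q z) / 2)"
      unfolding poly_altdef cnj_sum sum_product sum_divide_distrib ..
    finally have *: "(\<Sum>i\<le>degree p. \<Sum>j\<le>degree q. Re ((coeff p i * cnj (coeff q j) / 2) * (z ^ i * cnj z ^ j))) =
        Re (poly p z * cnj (poly q z) / 2)" .
    show ?thesis
      unfolding * by (simp add: field_simps)
  qed
  have "circle_trig_poly (\<lambda>z. Re (poly p z) * Re (poly q z))"
    unfolding eq
    by (rule circle_trig_poly_add, unfold circle_trig_poly_def, blast, fold circle_trig_poly_def)
       (rule circle_trig_poly_sum, rule circle_trig_poly_sum, rule circle_trig_poly_monomial)
  then show ?thesis
    using pq unfolding circle_trig_poly_def by auto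
qed

lemma circle_trig_poly_real_polynomial_function:
  assumes "real_polynomial_function (F :: complex \<Rightarrow> real)"
  shows "circle_trig_poly F"
  using assms
proof induction
  case (linear f)
  then interpret bounded_linear f .
  have lin: "f z = f 1 * Re z + f \<i> * Im z" for z
  proof -
    have "z = Re z *\<^sub>R 1 + Im z *\<^sub>R \<i>"
      by (simp add: complex_eq_iff)
    then have "f z = f (Re z *\<^sub>R 1 + Im z *\<^sub>R \<i>)"
      by (rule arg_cong)
    also have "\<dots> = f 1 * Re z + f \<i> * Im z"
      by (simp only: add scaleR) simp
    finally show ?thesis .
  qed
  show ?case
    unfolding circle_trig_poly_def
    by (intro exI[of _ "[:0, Complex (f 1) (- f \<i>):]"] ballI) (subst lin, simp)
qed (simp_all add: circle_trig_poly_const circle_trig_poly_add circle_trig_poly_mult)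

lemma trig_approximation:
  fixes u :: "complex \<Rightarrow> real"
  assumes "continuous_on circle u" "e > 0"
  obtains p where "\<And>z. z \<in> circle \<Longrightarrow> \<bar>u z - Re (poly p z)\<bar> < e"
proof -
  obtain g where g: "real_polynomial_function g" "\<And>z. z \<in> circle \<Longrightarrow> \<bar>u z - g z\<bar> < e"
    using Stone_Weierstrass_real_polynomial_function[of circle u e] assms by auto
  obtain p where "\<forall>z\<in>circle. g z = Re (poly p z)"
    using circle_trig_poly_real_polynomial_function[OF g(1)] unfolding circle_trig_poly_def by blast
  with g(2) show ?thesis
    by (intro that[of p]) auto
qed

lemma trig_approximation_above:
  fixes u :: "complex \<Rightarrow> real"
  assumes "continuous_on circle u" "e > 0"
  obtains p where "\<And>z. z \<in> circle \<Longrightarrow> u z < Re (poly p z)" "\<And>z. z \<in> circle \<Longrightarrow> Re (poly p z) < u z + e"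
proof -
  obtain p where p: "\<And>z. z \<in> circle \<Longrightarrow> \<bar>(u z + e / 2) - Re (poly p z)\<bar> < e / 2"
    by (rule trig_approximation[of "\<lambda>z. u z + e / 2" "e / 2"])
       (use assms in \<open>auto intro!: continuous_intros\<close>)
  have "u z < Re (poly p z) \<and> Re (poly p z) < u z + e" if "z \<in> circle" for z
    using p[OF that] by (auto simp: abs_if split: if_splits)
  then show ?thesis
    by (intro that) auto
qed

text \<open>The maximum principle for the entire function \<open>f * exp (- p)\<close>. Zeros of
  \<open>f\<close> are harmless because only the exponential is inverted.\<close>

lemma norm_le_exp_Re_poly:
  assumes f: "f holomorphic_on UNIV"
    and le: "\<And>z. z \<in> circle \<Longrightarrow> norm (f z) \<le> exp (Re (poly p z))"
    and z: "z \<in> cball 0 1"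
  shows "norm (f z) \<le> exp (Re (poly p z))"
proof -
  have hol: "(\<lambda>z. f z * exp (- poly p z)) holomorphic_on UNIV"
    by (intro holomorphic_intros f)
  have "norm (f z * exp (- poly p z)) \<le> 1"
  proof (rule maximum_modulus_frontier[of "\<lambda>z. f z * exp (- poly p z)" "cball 0 1"])
    show "continuous_on (closure (cball 0 1)) (\<lambda>z. f z * exp (- poly p z))"
      by (rule continuous_on_subset[OF holomorphic_on_imp_continuous_on[OF hol]]) auto
    show "norm (f w * exp (- poly p w)) \<le> 1" if "w \<in> frontier (cball 0 1)" for w
      using le[of w] that by (simp add: norm_mult norm_divide norm_exp_eq_Re exp_minus divide_simps)
  qed (use hol z in \<open>auto intro: holomorphic_on_subset\<close>)
  then show ?thesis
    by (simp add: norm_mult norm_divide norm_exp_eq_Re exp_minus divide_simps)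
qed

lemma Re_poly_le:
  assumes "\<And>z. z \<in> circle \<Longrightarrow> Re (poly q z) \<le> Re (poly p z)" and "z \<in> cball 0 1"
  shows "Re (poly q z) \<le> Re (poly p z)"
proof -
  have "(\<lambda>z. exp (poly q z)) holomorphic_on UNIV"
    by (intro holomorphic_intros)
  from norm_le_exp_Re_poly[OF this, of p z] assms show ?thesis
    by (simp add: norm_exp_eq_Re)
qed

lemma Re_poly_pos:
  assumes "\<And>z. z \<in> circle \<Longrightarrow> 0 < Re (poly p z)" and "z \<in> cball 0 1"
  shows "0 < Re (poly p z)"
proof -
  have "\<exists>x\<in>circle. \<forall>y\<in>circle. Re (poly p x) \<le> Re (poly p y)"
    by (rule continuous_attains_inf) (auto intro!: continuous_intros)
  then obtain x where x: "x \<in> circle" "\<And>y. y \<in> circle \<Longrightarrow> Re (poly p x) \<le> Re (poly p y)"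
    by blast
  have "Re (poly [:of_real (Re (poly p x)):] z) \<le> Re (poly p z)"
    by (rule Re_poly_le) (use x assms in auto)
  then show ?thesis
    using assms(1)[OF x(1)] by simp
qed

text \<open>
  \<open>\<bar>a\<bar>\<^sup>2 / Re b\<close> is the maximum over all constants \<open>c\<close> of \<open>Re (2 * cnj c * a - \<bar>c\<bar>\<^sup>2 * b)\<close>, hence
  subharmonic as a function of \<open>z\<close> when \<open>a\<close> and \<open>b\<close> are polynomials.
\<close>
lemma cavg_quotient_mono:
  assumes b: "\<And>z. z \<in> cball 0 1 \<Longrightarrow> 0 < Re (poly b z)" and x: "0 \<le> x" "x \<le> 1"
  shows "cavg (\<lambda>z. (norm (poly a (of_real x * z)))\<^sup>2 / Re (poly b (of_real x * z)))
    \<le> cavg (\<lambda>z. (norm (poly a z))\<^sup>2 / Re (poly b z))"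
proof (rule field_le_epsilon)
  fix e :: real assume e: "e > 0"
  define \<psi> where "\<psi> = (\<lambda>z. (norm (poly a z))\<^sup>2 / Re (poly b z))"
  have "continuous_on (cball 0 1) \<psi>"
    unfolding \<psi>_def by (intro continuous_intros) (use b in force)
  then have cont: "continuous_on circle \<psi>" "continuous_on circle (\<lambda>z. \<psi> (of_real x * z))"
    by (rule continuous_on_subset, force)
       (rule continuous_on_compose2[of "cball 0 1" \<psi>], fact, use x in \<open>auto intro!: continuous_intros simp: norm_mult\<close>)
  \<comment> \<open>\<open>Re p\<close> is harmonic, so its average at radius \<open>x\<close>
    equals that at radius 1. It remains to see that it dominates \<open>\<psi>\<close> inside the
    disc too.\<close>
  obtain p where p: "\<And>z. z \<in> circle \<Longrightarrow> \<psi> z < Re (poly p z)" "\<And>z. z \<in> circle \<Longrightarrow> Re (poly p z) < \<psi> z + e"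
    using trig_approximation_above[OF cont(1) e] by blast
  have le: "\<psi> w \<le> Re (poly p w)" if w: "w \<in> cball 0 1" for w
  proof -
    \<comment> \<open>The maximizing constant for the point \<open>w\<close>: the harmonic function
      \<open>Re q\<close> lies below \<open>\<psi>\<close> on the circle and equals it at
      \<open>w\<close>.\<close>
    define c where "c = poly a w / of_real (Re (poly b w))"
    define q where "q = smult (2 * cnj c) a - smult (of_real ((norm c)\<^sup>2)) b"
    have q: "Re (poly q z) = 2 * Re (cnj c * poly a z) - (norm c)\<^sup>2 * Re (poly b z)" for z
      by (simp add: q_def algebra_simps)
    have "Re (poly q z) \<le> Re (poly p z)" if "z \<in> circle" for z
    proof -
      have B: "Re (poly b z) > 0"
        using b that by simp
      have "Re (cnj c * poly a z) \<le> norm c * norm (poly a z)"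
        using complex_Re_le_cmod[of "cnj c * poly a z"] by (simp add: norm_mult)
      moreover have "2 * (norm c * norm (poly a z)) - (norm c)\<^sup>2 * Re (poly b z) \<le> \<psi> z"
      proof -
        have "0 \<le> (norm (poly a z) - norm c * Re (poly b z))\<^sup>2 / Re (poly b z)"
          using B by simp
        also have "\<dots> = \<psi> z - (2 * (norm c * norm (poly a z)) - (norm c)\<^sup>2 * Re (poly b z))"
          using B by (simp add: \<psi>_def power2_eq_square field_simps)
        finally show ?thesis by simp
      qed
      ultimately show ?thesis
        using p(1)[OF that] unfolding q by linarith
    qed
    then have "Re (poly q w) \<le> Re (poly p w)"
      by (rule Re_poly_le[OF _ w])
    moreover have "Re (poly q w) = \<psi> w"
    proof -
      have B: "Re (poly b w) > 0"
        using b w by simp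
      have "cnj c * poly a w = of_real ((norm (poly a w))\<^sup>2 / Re (poly b w))"
        unfolding of_real_divide complex_norm_square by (simp add: c_def mult.commute)
      moreover have "(norm c)\<^sup>2 = (norm (poly a w))\<^sup>2 / (Re (poly b w))\<^sup>2"
        using B by (simp add: c_def norm_divide power_divide)
      ultimately show ?thesis
        using B unfolding q \<psi>_def by (simp add: power2_eq_square)
    qed
    ultimately show ?thesis by simp
  qed
  have "cavg (\<lambda>z. \<psi> (of_real x * z)) \<le> cavg (\<lambda>z. Re (poly p (of_real x * z)))"
    by (rule cavg_mono) (use cont x in \<open>auto intro!: continuous_intros le simp: norm_mult\<close>)
  also have "\<dots> = cavg (\<lambda>z. Re (poly p z))"
    using cavg_Re_poly[of p 1] by (simp add: cavg_Re_poly)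
  also have "\<dots> \<le> cavg (\<lambda>z. \<psi> z + e)"
    by (rule cavg_mono) (use cont p(2) in \<open>auto intro!: continuous_intros less_imp_le\<close>)
  also have "\<dots> = cavg \<psi> + e"
    using cont by (simp add: cavg_add)
  finally show "cavg (\<lambda>z. (norm (poly a (of_real x * z)))\<^sup>2 / Re (poly b (of_real x * z)))
      \<le> cavg (\<lambda>z. (norm (poly a z))\<^sup>2 / Re (poly b z)) + e"
    by (simp add: \<psi>_def)
qed

section \<open>Entropy contraction and Weissler's inequality\<close>

lemma cavg_has_real_derivative:
  fixes F F' :: "real \<Rightarrow> complex \<Rightarrow> real"
  assumes "\<And>x z. x \<in> U \<Longrightarrow> z \<in> circle \<Longrightarrow> ((\<lambda>x. F x z) has_real_derivative F' x z) (at x within U)"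
    and "\<And>x. x \<in> U \<Longrightarrow> continuous_on circle (F x)"
    and "continuous_on (U \<times> circle) (\<lambda>(x, z). F' x z)"
    and "x \<in> U" "convex U"
  shows "((\<lambda>x. cavg (F x)) has_real_derivative cavg (F' x)) (at x within U)"
proof -
  have "((\<lambda>x. integral (cbox 0 (2 * pi)) (\<lambda>t. F x (cis t))) has_field_derivative
        integral (cbox 0 (2 * pi)) (\<lambda>t. F' x (cis t))) (at x within U)"
  proof (rule leibniz_rule_field_derivative)
    show "continuous_on (U \<times> cbox 0 (2 * pi)) (\<lambda>(x, t). F' x (cis t))"
    proof -
      have "continuous_on (U \<times> cbox 0 (2 * pi)) (\<lambda>(x, t). (x, cis t))"
        unfolding split_beta by (intro continuous_intros)
      from continuous_on_compose2[OF assms(3) this] show ?thesis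
        by (force simp: split_beta)
    qed
    show "(\<lambda>t. F x (cis t)) integrable_on cbox 0 (2 * pi)" if "x \<in> U" for x
      using cavg_integrable[OF assms(2)[OF that]] by simp
  qed (use assms in auto)
  then show ?thesis
    unfolding cavg_def by (auto intro!: derivative_eq_intros)
qed

text \<open>The integrand is a derivative along a closed curve. This takes the place of integration
  by parts on the circle.\<close>

lemma cavg_tangential_derivative:
  fixes H H' :: "complex \<Rightarrow> real"
  assumes "\<And>t. ((\<lambda>t. H (cis t)) has_real_derivative H' (cis t)) (at t)"
  shows "cavg H' = 0"
proof -
  have "((\<lambda>t. H' (cis t)) has_integral H (cis (2 * pi)) - H (cis 0)) {0..2 * pi}"
    by (rule fundamental_theorem_of_calculus)
       (auto simp flip: has_real_derivative_iff_has_vector_derivative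
          intro: has_field_derivative_at_within assms)
  then show ?thesis
    by (simp add: cavg_def integral_unique)
qed

lemma poly_radial_derivative:
  fixes p :: "complex poly"
  shows "((\<lambda>x. poly p (of_real x * z)) has_vector_derivative z * poly (pderiv p) (of_real x * z)) (at x within U)"
proof -
  have "((\<lambda>w. poly p (w * z)) has_field_derivative poly (pderiv p) (of_real x * z) * z) (at (of_real x))"
    by (auto intro!: derivative_eq_intros DERIV_chain'[OF _ poly_DERIV])
  from has_vector_derivative_real_field[OF this] show ?thesis
    by (simp add: mult.commute)
qed

lemma poly_tangential_derivative:
  "((\<lambda>t. poly p (c * cis t)) has_vector_derivative \<i> * (c * cis t) * poly (pderiv p) (c * cis t)) (at t within U)"
proof -
  have "((\<lambda>w. poly p (c * exp (\<i> * w))) has_field_derivative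
      poly (pderiv p) (c * exp (\<i> * of_real t)) * (c * (exp (\<i> * of_real t) * \<i>))) (at (of_real t))"
    by (auto intro!: derivative_eq_intros DERIV_chain'[OF _ poly_DERIV])
  from has_vector_derivative_real_field[OF this] show ?thesis
    by (simp add: cis_conv_exp mult_ac)
qed

lemma has_real_derivative_Re:
  "(f has_vector_derivative f') (at x within U) \<Longrightarrow> ((\<lambda>x. Re (f x)) has_real_derivative Re f') (at x within U)"
  unfolding has_real_derivative_iff_has_vector_derivative
  by (rule bounded_linear.has_vector_derivative[OF bounded_linear_Re])

lemma has_real_derivative_Im:
  "(f has_vector_derivative f') (at x within U) \<Longrightarrow> ((\<lambda>x. Im (f x)) has_real_derivative Im f') (at x within U)"
  unfolding has_real_derivative_iff_has_vector_derivative
  by (rule bounded_linear.has_vector_derivative[OF bounded_linear_Im])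

text \<open>
  With \<open>S x\<close> the average of \<open>F * ln F\<close> over the circle of radius \<open>x\<close>, where \<open>F = Re b\<close>, one has
  \<open>(x S')' = x K\<close>, where \<open>K x\<close> is the average of \<open>\<bar>b'\<bar>\<^sup>2 / F\<close>, which is nondecreasing by
  \<open>cavg_quotient_mono\<close>. This makes \<open>S\<close> a convex function of \<open>x\<^sup>2\<close>.
\<close>
lemma entropy_contraction:
  assumes b: "\<And>z. z \<in> cball 0 1 \<Longrightarrow> 0 < Re (poly b z)" and r: "0 < r" "r \<le> 1"
  defines "\<phi> \<equiv> \<lambda>x::real. x * ln x"
  shows "cavg (\<lambda>z. \<phi> (Re (poly b (of_real r * z)))) - \<phi> (Re (poly b 0))
    \<le> r\<^sup>2 * (cavg (\<lambda>z. \<phi> (Re (poly b z))) - \<phi> (Re (poly b 0)))"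
proof -
  define F where "F = (\<lambda>x z. Re (poly b (of_real x * z)))"
  \<comment> \<open>\<open>P\<close> is \<open>z * b'\<close>, so that \<open>D x\<close> below is
    \<open>x\<close> times the derivative of \<open>S\<close> and vanishes at
    \<open>x = 0\<close>.\<close>
  define P where "P = pCons 0 (pderiv b)"
  have P: "poly P z = z * poly (pderiv b) z" for z
    by (simp add: P_def)
  define S where "S = (\<lambda>x. cavg (\<lambda>z. F x z * ln (F x z)))"
  define D where "D = (\<lambda>x. cavg (\<lambda>z. (ln (F x z) + 1) * Re (poly P (of_real x * z))))"
  define K where "K = (\<lambda>x. cavg (\<lambda>z. (norm (poly (pderiv b) (of_real x * z)))\<^sup>2 / F x z))"
  have pos: "F x z > 0" if "x \<in> {0..1}" "z \<in> circle" for x z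
    using that unfolding F_def by (intro b) (auto simp: norm_mult)
  have contF: "continuous_on T (\<lambda>y. F (f y) (g y))"
    if "continuous_on T f" "continuous_on T g" for T and f :: "'z::topological_space \<Rightarrow> real" and g
    unfolding F_def by (intro continuous_intros that)
  have contF': "continuous_on circle (F x)" for x
    unfolding F_def by (intro continuous_intros)
  have dF: "((\<lambda>x. F x z) has_real_derivative Re (z * poly (pderiv b) (of_real x * z))) (at x within U)" for x z U
    unfolding F_def by (intro has_real_derivative_Re poly_radial_derivative)
  have dP: "((\<lambda>x. Re (poly P (of_real x * z))) has_real_derivative
      Re (z * poly (pderiv P) (of_real x * z))) (at x within U)" for x z U
    by (intro has_real_derivative_Re poly_radial_derivative)
  have dS: "(S has_real_derivative
      cavg (\<lambda>z. (ln (F x z) + 1) * Re (z * poly (pderiv b) (of_real x * z)))) (at x within {0..1})"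
    if x: "x \<in> {0..1}" for x
    unfolding S_def
  proof (rule cavg_has_real_derivative)
    show "((\<lambda>x. F x z * ln (F x z)) has_real_derivative
        (ln (F x z) + 1) * Re (z * poly (pderiv b) (of_real x * z))) (at x within {0..1})"
      if "x \<in> {0..1}" "z \<in> circle" for x z
      using pos[OF that] by (auto intro!: derivative_eq_intros dF simp: field_simps)
    show "continuous_on ({0..1} \<times> circle)
        (\<lambda>(x, z). (ln (F x z) + 1) * Re (z * poly (pderiv b) (of_real x * z)))"
      unfolding split_beta by (intro continuous_intros contF) (use pos in fastforce)
    show "continuous_on circle (\<lambda>z. F x z * ln (F x z))" if "x \<in> {0..1}" for x
      by (intro continuous_intros contF') (use pos that in fastforce)
  qed (use x in auto)
  have S'D: "x * cavg (\<lambda>z. (ln (F x z) + 1) * Re (z * poly (pderiv b) (of_real x * z))) = D x" for x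
    unfolding D_def cavg_cmult[symmetric] P
    by (intro cavg_cong) (simp add: algebra_simps)
  have dD: "(D has_real_derivative x * K x) (at x within {0..1})" if x: "x \<in> {0<..1}" for x
  proof -
    define D' where "D' = (\<lambda>x z. Re (z * poly (pderiv b) (of_real x * z)) / F x z * Re (poly P (of_real x * z)) +
        (ln (F x z) + 1) * Re (z * poly (pderiv P) (of_real x * z)))"
    have contD': "continuous_on ({0..1} \<times> circle) (\<lambda>(x, z). D' x z)"
      unfolding split_beta D'_def by (intro continuous_intros contF) (use pos in fastforce)+
    have "(D has_real_derivative cavg (D' x)) (at x within {0..1})"
      unfolding D_def
    proof (rule cavg_has_real_derivative)
      show "((\<lambda>x. (ln (F x z) + 1) * Re (poly P (of_real x * z))) has_real_derivative D' x z)
          (at x within {0..1})" if "x \<in> {0..1}" "z \<in> circle" for x z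
        using pos[OF that] unfolding D'_def
        by (auto intro!: derivative_eq_intros dF[THEN DERIV_cong] dP[THEN DERIV_cong] simp del: times_complex.sel)
      show "continuous_on circle (\<lambda>z. (ln (F x z) + 1) * Re (poly P (of_real x * z)))" if "x \<in> {0..1}" for x
        by (intro continuous_intros contF') (use pos that in fastforce)
    qed (use x contD' in auto)
    moreover have "cavg (D' x) = x * K x"
    proof -
      \<comment> \<open>\<open>T\<close> is the tangential derivative of
        \<open>(ln F + 1) * Im P\<close>, hence has average 0. Subtracting it from
        \<open>x * D'\<close> removes the second derivatives of \<open>b\<close> and completes the
        square of \<open>Re P\<close> to that of the modulus of \<open>P\<close>.\<close>
      define T where "T = (\<lambda>z. (ln (F x z) + 1) * Re (of_real x * z * poly (pderiv P) (of_real x * z)) -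
          (Im (poly P (of_real x * z)))\<^sup>2 / F x z)"
      have pos': "F x z > 0" if "z \<in> circle" for z
        using pos[of x z] x that by auto
      have "cavg T = 0"
      proof (rule cavg_tangential_derivative)
        fix t :: real
        have "((\<lambda>t. F x (cis t)) has_real_derivative
            Re (\<i> * (of_real x * cis t) * poly (pderiv b) (of_real x * cis t))) (at t)"
          unfolding F_def by (intro has_real_derivative_Re poly_tangential_derivative)
        also have "Re (\<i> * (of_real x * cis t) * poly (pderiv b) (of_real x * cis t)) = - Im (poly P (of_real x * cis t))"
          unfolding P mult.assoc by simp
        finally have 1: "((\<lambda>t. F x (cis t)) has_real_derivative - Im (poly P (of_real x * cis t))) (at t)" .
        have "((\<lambda>t. Im (poly P (of_real x * cis t))) has_real_derivative
            Im (\<i> * (of_real x * cis t) * poly (pderiv P) (of_real x * cis t))) (at t)"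
          by (intro has_real_derivative_Im poly_tangential_derivative)
        also have "Im (\<i> * (of_real x * cis t) * poly (pderiv P) (of_real x * cis t)) =
            Re (of_real x * cis t * poly (pderiv P) (of_real x * cis t))"
          unfolding mult.assoc by simp
        finally have 2: "((\<lambda>t. Im (poly P (of_real x * cis t))) has_real_derivative
            Re (of_real x * cis t * poly (pderiv P) (of_real x * cis t))) (at t)" .
        show "((\<lambda>t. (ln (F x (cis t)) + 1) * Im (poly P (of_real x * cis t))) has_real_derivative T (cis t)) (at t)"
          unfolding T_def using pos'[of "cis t"]
          by (auto intro!: derivative_eq_intros 1[THEN DERIV_cong] 2[THEN DERIV_cong] simp: power2_eq_square simp del: times_complex.sel)
      qed
      moreover have "x * D' x z - T z = x * (x * ((norm (poly (pderiv b) (of_real x * z)))\<^sup>2 / F x z))"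
        if z: "z \<in> circle" for z
      proof -
        have "x * D' x z = (Re (poly P (of_real x * z)))\<^sup>2 / F x z +
            (ln (F x z) + 1) * Re (of_real x * z * poly (pderiv P) (of_real x * z))"
          unfolding D'_def P using pos'[OF z] by (simp add: field_simps power2_eq_square)
        moreover have "(Re (poly P (of_real x * z)))\<^sup>2 + (Im (poly P (of_real x * z)))\<^sup>2 =
            x * (x * (norm (poly (pderiv b) (of_real x * z)))\<^sup>2)"
          unfolding cmod_power2[symmetric] P using z x
          by (simp add: norm_mult power_mult_distrib power2_eq_square)
        ultimately show ?thesis
          unfolding T_def by (simp add: add_divide_distrib[symmetric])
      qed
      then have "cavg (\<lambda>z. x * D' x z - T z) = cavg (\<lambda>z. x * (x * ((norm (poly (pderiv b) (of_real x * z)))\<^sup>2 / F x z)))"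
        by (rule cavg_cong)
      moreover have "continuous_on circle (D' x)" "continuous_on circle T"
        subgoal unfolding D'_def by (intro continuous_intros contF') (use pos' in fastforce)+
        subgoal unfolding T_def by (intro continuous_intros contF') (use pos' in fastforce)+
        done
      ultimately have "x * cavg (D' x) = x * (x * K x)"
        unfolding K_def cavg_cmult by (simp add: cavg_diff cavg_cmult continuous_intros)
      then show ?thesis
        using x by simp
    qed
    ultimately show ?thesis by simp
  qed
  have interior: "at x within {0..1} = at x" if "0 < x" "x < 1" for x :: real
    using that by (simp add: at_within_Icc_at)
  \<comment> \<open>Replacing \<open>b\<close> by its dilate by \<open>y\<close> moves radius
    \<open>y\<close> to 1 and radius \<open>x\<close> to \<open>x / y\<close>.\<close>
  have K_mono: "K x \<le> K y" if "0 \<le> x" "x \<le> y" "0 < y" "y \<le> 1" for x y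
  proof -
    have "cavg (\<lambda>z. (norm (poly (pcompose (pderiv b) [:0, of_real y:]) (of_real (x / y) * z)))\<^sup>2 /
                Re (poly (pcompose b [:0, of_real y:]) (of_real (x / y) * z)))
      \<le> cavg (\<lambda>z. (norm (poly (pcompose (pderiv b) [:0, of_real y:]) z))\<^sup>2 /
                Re (poly (pcompose b [:0, of_real y:]) z))"
    proof (rule cavg_quotient_mono)
      show "0 < Re (poly (pcompose b [:0, of_real y:]) z)" if "z \<in> cball 0 1" for z
        using that \<open>0 < y\<close> \<open>y \<le> 1\<close> by (auto simp: poly_pcompose norm_mult mult_le_one intro!: b)
    qed (use that in auto)
    then show ?thesis
      using that by (simp add: K_def F_def poly_pcompose mult_ac)
  qed
  have contS: "continuous_on {0..1} S"
    by (rule DERIV_continuous_on) (rule dS)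
  have D0: "D 0 = 0"
    by (simp add: D_def P)
  have contD: "continuous_on {0..1} D"
  proof -
    have "continuous_on ({0..1} \<times> cbox 0 (2 * pi)) (\<lambda>(x, t). (ln (F x (cis t)) + 1) * Re (poly P (of_real x * cis t)))"
      unfolding split_beta by (intro continuous_intros contF) (auto intro!: less_imp_neq[THEN not_sym] pos)
    from integral_continuous_on_param[OF this] show ?thesis
      unfolding D_def cavg_def by (auto intro!: continuous_intros)
  qed
  \<comment> \<open>Integration of \<open>D' = y * K y \<le> y * K x\<close> from 0 to
    \<open>x\<close>. The bound \<open>B\<close> below is obtained in the same way one order lower:
    the derivative of \<open>D - 2 * (S - S 0)\<close> is nonnegative by \<open>DK\<close>.\<close>
  have DK: "2 * D x \<le> x\<^sup>2 * K x" if x: "0 < x" "x \<le> 1" for x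
  proof -
    have "0\<^sup>2 * K x / 2 - D 0 \<le> x\<^sup>2 * K x / 2 - D x"
    proof (rule DERIV_nonneg_imp_increasing_open[where f = "\<lambda>y. y\<^sup>2 * K x / 2 - D y"])
      show "continuous_on {0..x} (\<lambda>y. y\<^sup>2 * K x / 2 - D y)"
        using x by (intro continuous_intros continuous_on_subset[OF contD]) auto
      fix y assume y: "0 < y" "y < x"
      have "(D has_real_derivative y * K y) (at y)"
        using dD[of y] interior[of y] y x by simp
      then have "((\<lambda>y. y\<^sup>2 * K x / 2 - D y) has_real_derivative y * K x - y * K y) (at y)"
        by (auto intro!: derivative_eq_intros)
      moreover have "y * K y \<le> y * K x"
        using K_mono[of y x] y x by (intro mult_left_mono) auto
      ultimately show "\<exists>d. ((\<lambda>y. y\<^sup>2 * K x / 2 - D y) has_real_derivative d) (at y) \<and> d \<ge> 0"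
        by (intro exI conjI) auto
    qed (use x in auto)
    then show ?thesis
      by (simp add: D0)
  qed
  have dS': "(S has_real_derivative D y / y) (at y)" if "0 < y" "y < 1" for y
  proof -
    have "D y / y = cavg (\<lambda>z. (ln (F y z) + 1) * Re (z * poly (pderiv b) (of_real y * z)))"
      unfolding S'D[symmetric] using that by simp
    then show ?thesis
      using dS[of y] interior[of y] that by (simp del: times_complex.sel)
  qed
  have B: "2 * (S x - S 0) \<le> D x" if x: "0 < x" "x \<le> 1" for x
  proof -
    have "D 0 - 2 * (S 0 - S 0) \<le> D x - 2 * (S x - S 0)"
    proof (rule DERIV_nonneg_imp_increasing_open[where f = "\<lambda>y. D y - 2 * (S y - S 0)"])
      show "continuous_on {0..x} (\<lambda>y. D y - 2 * (S y - S 0))"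
        using x by (intro continuous_intros continuous_on_subset[OF contD] continuous_on_subset[OF contS]) auto
      fix y assume y: "0 < y" "y < x"
      have "(D has_real_derivative y * K y) (at y)"
        using dD[of y] interior[of y] y x by simp
      then have "((\<lambda>y. D y - 2 * (S y - S 0)) has_real_derivative y * K y - 2 * (D y / y)) (at y)"
        using y x by (auto intro!: derivative_eq_intros dS')
      moreover have "0 \<le> y * K y - 2 * (D y / y)"
        using DK[of y] y x by (simp add: field_simps power2_eq_square)
      ultimately show "\<exists>d. ((\<lambda>y. D y - 2 * (S y - S 0)) has_real_derivative d) (at y) \<and> d \<ge> 0"
        by blast
    qed (use x in auto)
    then show ?thesis
      by (simp add: D0)
  qed
  \<comment> \<open>The quotient is the slope of the chord from 0 when \<open>S\<close> is viewed as
    a function of the squared radius. Its derivative has the sign of the difference estimated in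
    \<open>B\<close>.\<close>
  have "(S r - S 0) / r\<^sup>2 \<le> (S 1 - S 0) / 1\<^sup>2"
  proof (rule DERIV_nonneg_imp_increasing_open[where f = "\<lambda>y. (S y - S 0) / y\<^sup>2"])
    show "continuous_on {r..1} (\<lambda>y. (S y - S 0) / y\<^sup>2)"
      using r by (intro continuous_intros continuous_on_subset[OF contS]) auto
    fix y assume y: "r < y" "y < 1"
    have "((\<lambda>y. (S y - S 0) / y\<^sup>2) has_real_derivative (D y - 2 * (S y - S 0)) / y ^ 3) (at y)"
      using y r by (auto intro!: derivative_eq_intros dS' simp: field_simps power2_eq_square power3_eq_cube)
    moreover have "0 \<le> (D y - 2 * (S y - S 0)) / y ^ 3"
      using B[of y] y r by simp
    ultimately show "\<exists>d. ((\<lambda>y. (S y - S 0) / y\<^sup>2) has_real_derivative d) (at y) \<and> d \<ge> 0"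
      by blast
  qed (use r in auto)
  then have "S r - S 0 \<le> r\<^sup>2 * (S 1 - S 0)"
    using r by (simp add: field_simps)
  then show ?thesis
    by (simp add: S_def F_def \<phi>_def)
qed

text \<open>Pointwise \<open>ln x \<le> x - 1\<close> at \<open>x = c * exp \<tau> / \<rho>\<close>.
  The density is not normalized, hence the terms with its mass; where the lemma is used, the mass is
  the value of a harmonic function at 0 and survives dilation.\<close>

lemma cavg_gibbs:
  fixes \<rho> \<tau> :: "complex \<Rightarrow> real"
  assumes cont: "continuous_on circle \<rho>" "continuous_on circle \<tau>"
    and pos: "\<And>z. z \<in> circle \<Longrightarrow> 0 < \<rho> z"
  shows "cavg (\<lambda>z. \<rho> z * \<tau> z) \<le>
    cavg (\<lambda>z. \<rho> z * ln (\<rho> z)) - cavg \<rho> * ln (cavg \<rho>) + cavg \<rho> * ln (cavg (\<lambda>z. exp (\<tau> z)))"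
proof -
  define m where "m = cavg \<rho>"
  define W where "W = cavg (\<lambda>z. exp (\<tau> z))"
  have m: "m > 0" and W: "W > 0"
    unfolding m_def W_def by (intro cavg_pos cont pos continuous_intros; simp)+
  \<comment> \<open>This constant gives \<open>c * exp \<tau>\<close> the same mass as
    \<open>\<rho>\<close>, so the difference of the two averages to zero.\<close>
  define c where "c = m / W"
  have c: "c > 0"
    using m W by (simp add: c_def)
  have cont': "continuous_on circle (\<lambda>z. \<rho> z * ln (\<rho> z))"
    by (intro continuous_intros cont) (use pos in fastforce)
  have "cavg (\<lambda>z. \<rho> z * \<tau> z - \<rho> z * ln (\<rho> z) + ln c * \<rho> z) \<le> cavg (\<lambda>z. c * exp (\<tau> z) - \<rho> z)"
  proof (rule cavg_mono)
    fix z assume "z \<in> circle"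
    then have \<rho>: "\<rho> z > 0" by (rule pos)
    have "ln (c * exp (\<tau> z) / \<rho> z) \<le> c * exp (\<tau> z) / \<rho> z - 1"
      using \<rho> c by (intro ln_le_minus_one) simp
    then have "\<rho> z * ln (c * exp (\<tau> z) / \<rho> z) \<le> \<rho> z * (c * exp (\<tau> z) / \<rho> z - 1)"
      using \<rho> by (intro mult_left_mono) auto
    moreover have "ln (c * exp (\<tau> z) / \<rho> z) = ln c + \<tau> z - ln (\<rho> z)"
      using \<rho> c by (simp add: ln_div ln_mult)
    ultimately show "\<rho> z * \<tau> z - \<rho> z * ln (\<rho> z) + ln c * \<rho> z \<le> c * exp (\<tau> z) - \<rho> z"
      using \<rho> by (simp add: algebra_simps)
  qed (intro continuous_intros cont cont')+
  also have "\<dots> = c * W - m"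
    unfolding W_def m_def by (simp add: cavg_diff cavg_cmult cont continuous_intros)
  also have "\<dots> = 0"
    using W by (simp add: c_def)
  finally have "cavg (\<lambda>z. \<rho> z * \<tau> z) - cavg (\<lambda>z. \<rho> z * ln (\<rho> z)) + ln c * m \<le> 0"
    unfolding m_def by (simp add: cavg_add cavg_diff cavg_cmult cont cont' continuous_intros)
  moreover have "ln c = ln m - ln W"
    using m W by (simp add: c_def ln_div)
  ultimately show ?thesis
    unfolding m_def[symmetric] W_def[symmetric] by (simp add: algebra_simps)
qed

text \<open>
  Put \<open>R z = exp (s Re q(r z))\<close>. Since dilation is self-adjoint, Gibbs' variational principle for
  the dilated density and the entropy contraction (\<open>r\<^sup>2 = 1 / s\<close>) bound \<open>ln (cavg R)\<close> by
  \<open>s ln (cavg (exp (Re q)))\<close>. The contraction applies to densities \<open>Re b\<close>, so \<open>R\<close> is approximated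
  by such a density from above.
\<close>
lemma cavg_exp_dilation_le:
  assumes s: "1 \<le> s" and r: "0 < r" "r\<^sup>2 * s = 1"
  shows "cavg (\<lambda>z. exp (s * Re (poly q (of_real r * z)))) \<le> cavg (\<lambda>z. exp (Re (poly q z))) powr s"
proof -
  define R where "R = (\<lambda>z. exp (s * Re (poly q (of_real r * z))))"
  define W where "W = cavg (\<lambda>z. exp (Re (poly q z)))"
  have contR: "continuous_on circle R"
    unfolding R_def by (intro continuous_intros)
  have R_pos: "R z > 0" for z
    by (simp add: R_def)
  have Z: "cavg R > 0" and W: "W > 0"
    unfolding W_def by (intro cavg_pos contR continuous_intros; simp add: R_pos)+
  have r1: "r \<le> 1"
  proof (rule ccontr)
    assume "\<not> r \<le> 1"
    then have "1 * 1 < r\<^sup>2 * s"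
      using s by (intro mult_less_le_imp_less) (auto simp: one_less_power)
    with r show False by simp
  qed
  have "\<exists>x\<in>circle. \<forall>y\<in>circle. R x \<le> R y"
    by (rule continuous_attains_inf) (use contR in auto)
  then obtain w where w: "w \<in> circle" "\<And>z. z \<in> circle \<Longrightarrow> R w \<le> R z"
    by blast
  have "ln (cavg R) \<le> s * ln W + e" if e: "e > 0" for e
  proof -
    \<comment> \<open>Chosen with \<open>ln (1 + \<eta>) = e\<close>. The tolerance
      \<open>\<eta> * R w\<close>, where \<open>R w\<close> is the minimum of \<open>R\<close>,
      turns uniform approximation into relative approximation.\<close>
    define \<eta> where "\<eta> = exp e - 1"
    have \<eta>: "\<eta> > 0" "ln (1 + \<eta>) = e"
      using e by (auto simp: \<eta>_def)
    obtain b where b: "\<And>z. z \<in> circle \<Longrightarrow> R z < Re (poly b z)"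
      "\<And>z. z \<in> circle \<Longrightarrow> Re (poly b z) < R z + \<eta> * R w"
      using trig_approximation_above[OF contR, of "\<eta> * R w"] \<eta>(1) R_pos[of w] by auto
    define \<rho> where "\<rho> = (\<lambda>z. Re (poly b z))"
    have cont\<rho>: "continuous_on T \<rho>" "continuous_on T (\<lambda>z. \<rho> (of_real r * z))" for T
      unfolding \<rho>_def by (intro continuous_intros)+
    have \<rho>: "R z \<le> \<rho> z" "\<rho> z \<le> (1 + \<eta>) * R z" if "z \<in> circle" for z
    proof -
      show "R z \<le> \<rho> z"
        using b(1)[OF that] by (simp add: \<rho>_def)
      have "\<eta> * R w \<le> \<eta> * R z"
        using w(2)[OF that] \<eta>(1) by simp
      then show "\<rho> z \<le> (1 + \<eta>) * R z"
        using b(2)[OF that] by (simp add: \<rho>_def algebra_simps)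
    qed
    have \<rho>_pos: "\<rho> z > 0" if "z \<in> cball 0 1" for z
      unfolding \<rho>_def by (rule Re_poly_pos[OF _ that]) (use b(1) R_pos in \<open>auto intro: less_trans\<close>)
    define m where "m = cavg \<rho>"
    have m: "m = Re (poly b 0)" "cavg (\<lambda>z. \<rho> (of_real r * z)) = m"
      using cavg_Re_poly[of b 1] cavg_Re_poly[of b r] by (simp_all add: m_def \<rho>_def)
    have m_pos: "m > 0"
      unfolding m_def by (intro cavg_pos cont\<rho> \<rho>_pos) auto
    have "cavg (\<lambda>z. \<rho> z * Re (poly q (of_real r * z))) = cavg (\<lambda>z. \<rho> (of_real r * z) * Re (poly q z))"
      unfolding \<rho>_def by (rule cavg_Re_poly_self_adjoint[symmetric])
    also have "\<dots> \<le> cavg (\<lambda>z. \<rho> (of_real r * z) * ln (\<rho> (of_real r * z))) - m * ln m + m * ln W"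
      using cavg_gibbs[of "\<lambda>z. \<rho> (of_real r * z)" "\<lambda>z. Re (poly q z)"] r r1 \<rho>_pos
      unfolding m(2) W_def by (force intro!: cont\<rho> continuous_intros simp: norm_mult)
    also have "cavg (\<lambda>z. \<rho> (of_real r * z) * ln (\<rho> (of_real r * z))) - m * ln m \<le>
        r\<^sup>2 * (cavg (\<lambda>z. \<rho> z * ln (\<rho> z)) - m * ln m)"
      using entropy_contraction[of b r] r r1 \<rho>_pos unfolding m(1) \<rho>_def by simp
    finally have "s * cavg (\<lambda>z. \<rho> z * Re (poly q (of_real r * z))) \<le>
        s * (r\<^sup>2 * (cavg (\<lambda>z. \<rho> z * ln (\<rho> z)) - m * ln m) + m * ln W)"
      using s by (intro mult_left_mono) auto
    also have "\<dots> = (r\<^sup>2 * s) * (cavg (\<lambda>z. \<rho> z * ln (\<rho> z)) - m * ln m) + s * m * ln W"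
      by (simp add: algebra_simps)
    finally have *: "s * cavg (\<lambda>z. \<rho> z * Re (poly q (of_real r * z))) \<le>
        cavg (\<lambda>z. \<rho> z * ln (\<rho> z)) - m * ln m + s * m * ln W"
      unfolding r(2) by simp
    have cont\<rho>ln: "continuous_on circle (\<lambda>z. \<rho> z * ln (\<rho> z))"
      by (intro continuous_intros cont\<rho>) (use \<rho>_pos in \<open>auto simp: less_imp_neq[symmetric]\<close>)
    \<comment> \<open>As \<open>ln \<rho> \<le> e + ln R\<close>, the average of
      \<open>\<rho> * ln \<rho>\<close> is at most \<open>s\<close> times the pairing of
      \<open>\<rho>\<close> with the dilate of \<open>Re q\<close>, plus \<open>e * m\<close>. The
      preceding bound on that pairing contains the same average, which therefore cancels.\<close>
    have "cavg (\<lambda>z. \<rho> z * ln (\<rho> z)) \<le> cavg (\<lambda>z. s * (\<rho> z * Re (poly q (of_real r * z))) + e * \<rho> z)"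
    proof (rule cavg_mono)
      fix z assume z: "z \<in> circle"
      have pos: "\<rho> z > 0"
        using \<rho>_pos z by simp
      have "ln (\<rho> z) \<le> ln ((1 + \<eta>) * R z)"
        using \<rho>(2)[OF z] pos by simp
      also have "\<dots> = e + s * Re (poly q (of_real r * z))"
        using \<eta> R_pos[of z] by (simp add: ln_mult R_def)
      finally have "\<rho> z * ln (\<rho> z) \<le> \<rho> z * (e + s * Re (poly q (of_real r * z)))"
        using pos by (intro mult_left_mono) auto
      then show "\<rho> z * ln (\<rho> z) \<le> s * (\<rho> z * Re (poly q (of_real r * z))) + e * \<rho> z"
        by (simp add: algebra_simps)
    qed (intro continuous_intros cont\<rho> cont\<rho>ln)+
    also have "\<dots> = s * cavg (\<lambda>z. \<rho> z * Re (poly q (of_real r * z))) + e * m"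
      unfolding m_def by (simp add: cavg_add cavg_cmult cont\<rho> continuous_intros)
    finally have "m * ln m \<le> m * (s * ln W + e)"
      using * by (simp add: algebra_simps)
    then have "ln m \<le> s * ln W + e"
      using m_pos by simp
    moreover have "cavg R \<le> m"
      unfolding m_def by (intro cavg_mono contR cont\<rho> \<rho>)
    then have "ln (cavg R) \<le> ln m"
      using Z by simp
    ultimately show ?thesis by simp
  qed
  then have "ln (cavg R) \<le> s * ln W"
    by (rule field_le_epsilon)
  then have "exp (ln (cavg R)) \<le> exp (s * ln W)"
    by simp
  then have "cavg R \<le> exp (s * ln W)"
    using Z by simp
  also have "\<dots> = W powr s"
    using W by (simp add: powr_def)
  finally show ?thesis
    by (simp add: R_def W_def)
qed

section \<open>Zero-free majorants and Weissler's inequality for all polynomials\<close>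

lemma continuous_on_norm_powr:
  fixes f :: "'a::topological_space \<Rightarrow> 'b::real_normed_vector"
  assumes "0 < (p::real)" "continuous_on T f"
  shows "continuous_on T (\<lambda>z. norm (f z) powr p)"
  by (intro continuous_on_powr' continuous_intros assms) (use assms in auto)

text \<open>On the circle \<open>ln (norm f powr p + e)\<close> is approximated from above by a
  harmonic polynomial; the summand \<open>e\<close> keeps the logarithm finite at zeros of
  \<open>f\<close>. The maximum principle carries the bound into the disc.\<close>

lemma poly_outer_majorant:
  fixes f :: "complex poly"
  assumes p: "0 < (p::real)" and e: "0 < e"
  obtains q where "\<And>z. z \<in> cball 0 1 \<Longrightarrow> norm (poly f z) powr p \<le> exp (Re (poly q z))"
    "cavg (\<lambda>z. exp (Re (poly q z))) \<le> (cavg (\<lambda>z. norm (poly f z) powr p) + e) * exp e"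
proof -
  define u where "u = (\<lambda>z. norm (poly f z) powr p + e)"
  have u: "u z > 0" for z
    unfolding u_def using e by (simp add: add_nonneg_pos)
  have contf: "continuous_on T (\<lambda>z. norm (poly f z) powr p)" for T
    by (intro continuous_on_norm_powr p continuous_intros)
  have contu: "continuous_on T u" for T
    unfolding u_def by (intro continuous_intros contf)
  have "continuous_on circle (\<lambda>z. ln (u z))"
    by (intro continuous_intros contu) (use u in \<open>auto simp: less_imp_neq[symmetric]\<close>)
  then obtain q where q: "\<And>z. z \<in> circle \<Longrightarrow> ln (u z) < Re (poly q z)"
      "\<And>z. z \<in> circle \<Longrightarrow> Re (poly q z) < ln (u z) + e"
    using trig_approximation_above[OF _ e] by blast
  have "norm (poly f z) powr p \<le> exp (Re (poly q z))" if z: "z \<in> cball 0 1" for z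
  proof -
    \<comment> \<open>The comparison is made for \<open>f\<close> itself, against
      \<open>exp (q / p)\<close>, because \<open>norm f powr p\<close> need not be the modulus of a
      holomorphic function.\<close>
    have "norm (poly f z) \<le> exp (Re (poly (smult (1 / of_real p) q) z))"
    proof (rule norm_le_exp_Re_poly[OF _ _ z])
      fix w :: complex assume w: "w \<in> circle"
      have "norm (poly f w) powr p \<le> u w"
        using e by (simp add: u_def)
      also have "u w \<le> exp (Re (poly q w))"
        using q(1)[OF w] u[of w] by (metis exp_le_cancel_iff exp_ln less_imp_le)
      finally have "(norm (poly f w) powr p) powr (1 / p) \<le> exp (Re (poly q w)) powr (1 / p)"
        using p by (intro powr_mono2) auto
      then show "norm (poly f w) \<le> exp (Re (poly (smult (1 / of_real p) q) w))"
        using p by (simp add: powr_powr powr_def[of "exp _"] flip: of_real_divide)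
    qed (intro holomorphic_intros)
    then have "norm (poly f z) powr p \<le> exp (Re (poly (smult (1 / of_real p) q) z)) powr p"
      using p by (intro powr_mono2) auto
    then show ?thesis
      using p by (simp add: powr_def[of "exp _"])
  qed
  moreover have "cavg (\<lambda>z. exp (Re (poly q z))) \<le> cavg (\<lambda>z. exp e * u z)"
  proof (rule cavg_mono)
    fix z assume z: "z \<in> circle"
    have "exp (Re (poly q z)) \<le> exp (ln (u z) + e)"
      using q(2)[OF z] by simp
    then show "exp (Re (poly q z)) \<le> exp e * u z"
      using u[of z] by (simp add: exp_add mult.commute)
  qed (intro continuous_intros contu)+
  then have "cavg (\<lambda>z. exp (Re (poly q z))) \<le> (cavg (\<lambda>z. norm (poly f z) powr p) + e) * exp e"
    unfolding u_def by (simp add: cavg_cmult cavg_add contf mult.commute)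
  ultimately show ?thesis
    by (rule that)
qed

text \<open>The error of the majorant is sent to 0 from the right. As \<open>Y\<close> may be 0,
  this needs continuity of the power at 0, which is where \<open>0 < s\<close> enters.\<close>

lemma outer_majorant_limit:
  assumes "\<And>e. 0 < e \<Longrightarrow> X \<le> ((Y + e) * exp e) powr s" and "0 \<le> Y" "0 < (s::real)"
  shows "X \<le> Y powr s"
proof (rule tendsto_lowerbound)
  have "((\<lambda>e. ((Y + e) * exp e) powr s) \<longlongrightarrow> ((Y + 0) * exp 0) powr s) (at_right 0)"
  proof (rule tendsto_powr')
    show "(Y + 0) * exp 0 \<noteq> 0 \<or> 0 < s \<and> (\<forall>\<^sub>F e in at_right 0. 0 \<le> (Y + e) * exp e)"
      using assms by (auto simp: eventually_at_right_less intro!: eventually_mono[OF eventually_at_right_less[of 0]])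
    show "((\<lambda>e. (Y + e) * exp e) \<longlongrightarrow> (Y + 0) * exp 0) (at_right 0)"
      by (intro tendsto_intros)
  qed (rule tendsto_const)
  then show "((\<lambda>e. ((Y + e) * exp e) powr s) \<longlongrightarrow> Y powr s) (at_right 0)"
    by simp
  show "\<forall>\<^sub>F e in at_right 0. X \<le> ((Y + e) * exp e) powr s"
    by (rule eventually_mono[OF eventually_at_right_less[of 0]]) (use assms in auto)
qed simp

text \<open>Exponentials of harmonic polynomials already satisfy the bound. A majorant on the closed
  disc transfers it: on the dilated circle it can only increase the left side, and on the unit
  circle it costs an error that tends to 0.\<close>

lemma cavg_powr_dilation_le:
  fixes f :: "complex poly"
  assumes p: "0 < p" and s: "1 \<le> s" and r: "0 < r" "r\<^sup>2 * s = 1"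
  shows "cavg (\<lambda>z. norm (poly f (of_real r * z)) powr (p * s)) \<le> cavg (\<lambda>z. norm (poly f z) powr p) powr s"
proof (rule outer_majorant_limit)
  fix e :: real assume e: "0 < e"
  obtain q where q: "\<And>z. z \<in> cball 0 1 \<Longrightarrow> norm (poly f z) powr p \<le> exp (Re (poly q z))"
    "cavg (\<lambda>z. exp (Re (poly q z))) \<le> (cavg (\<lambda>z. norm (poly f z) powr p) + e) * exp e"
    using poly_outer_majorant[OF p e] by blast
  have r1: "r \<le> 1"
  proof (rule ccontr)
    assume "\<not> r \<le> 1"
    then have "1 * 1 < r\<^sup>2 * s"
      using s by (intro mult_less_le_imp_less) (auto simp: one_less_power)
    with r show False by simp
  qed
  have "cavg (\<lambda>z. norm (poly f (of_real r * z)) powr (p * s)) \<le> cavg (\<lambda>z. exp (s * Re (poly q (of_real r * z))))"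
  proof (rule cavg_mono)
    fix z assume "z \<in> circle"
    then have "(norm (poly f (of_real r * z)) powr p) powr s \<le> exp (Re (poly q (of_real r * z))) powr s"
      using r r1 s by (intro powr_mono2 q) (auto simp: norm_mult)
    then show "norm (poly f (of_real r * z)) powr (p * s) \<le> exp (s * Re (poly q (of_real r * z)))"
      by (simp add: powr_powr powr_def[of "exp _"])
  qed (use p s in \<open>auto intro!: continuous_on_norm_powr continuous_intros\<close>)
  also have "\<dots> \<le> cavg (\<lambda>z. exp (Re (poly q z))) powr s"
    by (rule cavg_exp_dilation_le[OF s r])
  also have "\<dots> \<le> ((cavg (\<lambda>z. norm (poly f z) powr p) + e) * exp e) powr s"
    using q(2) s by (intro powr_mono2 cavg_nonneg continuous_intros) auto
  finally show "cavg (\<lambda>z. norm (poly f (of_real r * z)) powr (p * s)) \<le>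
      ((cavg (\<lambda>z. norm (poly f z) powr p) + e) * exp e) powr s" .
qed (use p s in \<open>auto intro!: cavg_nonneg continuous_on_norm_powr continuous_intros\<close>)

section \<open>Coefficient inequalities in one variable\<close>

text \<open>The coefficient of \<open>x ^ n\<close> in the series of \<open>1 / (1 - x) ^ k\<close>,
  which is also the value of the \<open>k\<close>-fold divisor function at the \<open>n\<close>-th
  power of a prime. Truncated subtraction acts only at \<open>k = n = 0\<close>, where it yields the
  correct value 1.\<close>

definition multichoose :: "nat \<Rightarrow> nat \<Rightarrow> nat" where
  "multichoose k n = (n + k - 1) choose n"

lemma multichoose_0_right [simp]: "multichoose k 0 = 1"
  by (simp add: multichoose_def)

lemma multichoose_0_left: "multichoose 0 n = of_bool (n = 0)"
  by (cases n) (auto simp: multichoose_def)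

lemma multichoose_pos: "k > 0 \<Longrightarrow> multichoose k n > 0"
  by (simp add: multichoose_def)

lemma multichoose_Suc_left: "multichoose (Suc k) n = (\<Sum>i\<le>n. multichoose k i)"
proof (cases k)
  case 0
  moreover have "multichoose (Suc 0) n = 1"
    by (simp add: multichoose_def)
  ultimately show ?thesis
    by (simp add: multichoose_0_left of_bool_def)
next
  case (Suc l)
  then show ?thesis
    using sum_choose_lower[of l n] by (simp add: multichoose_def add.commute)
qed

lemma multichoose_Suc_right: "Suc n * multichoose (Suc k) (Suc n) = (n + k + 1) * multichoose (Suc k) n"
  using Suc_times_binomial_eq[of "n + k" n] by (simp add: multichoose_def)

text \<open>The ratio of consecutive values is \<open>(n + k) / (n + 1)\<close>, nonincreasing in
  \<open>n\<close> because \<open>k \<ge> 1\<close>. So a step in \<open>n\<close> multiplies the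
  left side by at most as much as the right side.\<close>

lemma multichoose_add_le:
  assumes "k > 0"
  shows "multichoose k (m + n) \<le> multichoose k m * multichoose k n"
proof (induction n)
  case (Suc n)
  obtain l where k: "k = Suc l"
    using assms gr0_implies_Suc by blast
  have "(Suc n * Suc (m + n)) * multichoose k (m + Suc n) = Suc n * ((m + n + l + 1) * multichoose k (m + n))"
    using multichoose_Suc_right[of "m + n" l] by (simp add: k del: mult_Suc mult_Suc_right)
  also have "\<dots> \<le> Suc n * ((m + n + l + 1) * (multichoose k m * multichoose k n))"
    by (intro mult_left_mono Suc.IH) auto
  also have "\<dots> = (Suc n * (m + n + l + 1)) * (multichoose k m * multichoose k n)"
    by (simp only: mult.assoc)
  also have "\<dots> \<le> (Suc (m + n) * (n + l + 1)) * (multichoose k m * multichoose k n)"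
    by (intro mult_right_mono) (auto simp: algebra_simps)
  also have "\<dots> = Suc (m + n) * (multichoose k m * ((n + l + 1) * multichoose k n))"
    by (simp only: mult_ac)
  also have "(n + l + 1) * multichoose k n = Suc n * multichoose k (Suc n)"
    using multichoose_Suc_right[of n l] by (simp add: k)
  also have "Suc (m + n) * (multichoose k m * (Suc n * multichoose k (Suc n))) =
      (Suc n * Suc (m + n)) * (multichoose k m * multichoose k (Suc n))"
    by (simp only: mult_ac)
  finally show ?case
    by (metis mult_le_cancel1 nat_0_less_mult_iff zero_less_Suc)
qed simp

lemma coeff_power_nonneg:
  fixes h :: "'a::linordered_idom poly"
  assumes "\<And>i. 0 \<le> coeff h i"
  shows "0 \<le> coeff (h ^ k) n"
proof (induction k arbitrary: n)
  case (Suc k)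
  then show ?case
    by (auto simp: coeff_mult intro!: sum_nonneg mult_nonneg_nonneg assms)
qed auto

text \<open>A coefficient of \<open>g ^ k\<close> is a sum over the \<open>multichoose k n\<close>
  ordered ways to write \<open>n\<close> as a sum of \<open>k\<close> naturals, and
  \<open>h ^ k\<close> collects the squared moduli of the terms. The Cauchy-Schwarz inequality is
  carried out one factor at a time.\<close>

lemma norm_coeff_power_le:
  fixes g :: "complex poly" and h :: "real poly"
  assumes h: "\<And>i. coeff h i = (norm (coeff g i))\<^sup>2"
  shows "(norm (coeff (g ^ k) n))\<^sup>2 \<le> multichoose k n * coeff (h ^ k) n"
proof (induction k arbitrary: n)
  case 0
  then show ?case
    by (simp add: multichoose_0_left)
next
  case (Suc k)
  have h_nonneg: "0 \<le> coeff (h ^ k) i" for i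
    by (rule coeff_power_nonneg) (simp add: h)
  have "(norm (coeff (g ^ Suc k) n))\<^sup>2 \<le> (\<Sum>i\<le>n. norm (coeff g i) * norm (coeff (g ^ k) (n - i)))\<^sup>2"
    by (intro power_mono) (auto simp: coeff_mult norm_mult intro: order_trans[OF norm_sum])
  also have "\<dots> \<le> (\<Sum>i\<le>n. sqrt (multichoose k (n - i)) * (norm (coeff g i) * sqrt (coeff (h ^ k) (n - i))))\<^sup>2"
  proof (intro power_mono sum_mono sum_nonneg)
    fix i
    have "norm (coeff (g ^ k) (n - i)) \<le> sqrt (multichoose k (n - i) * coeff (h ^ k) (n - i))"
      by (rule real_le_rsqrt) (rule Suc.IH)
    then have "norm (coeff g i) * norm (coeff (g ^ k) (n - i)) \<le>
        norm (coeff g i) * sqrt (multichoose k (n - i) * coeff (h ^ k) (n - i))"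
      by (rule mult_left_mono) simp
    then show "norm (coeff g i) * norm (coeff (g ^ k) (n - i)) \<le>
        sqrt (multichoose k (n - i)) * (norm (coeff g i) * sqrt (coeff (h ^ k) (n - i)))"
      by (simp add: real_sqrt_mult mult_ac)
  qed auto
  also have "\<dots> \<le> (\<Sum>i\<le>n. (sqrt (multichoose k (n - i)))\<^sup>2) *
      (\<Sum>i\<le>n. (norm (coeff g i) * sqrt (coeff (h ^ k) (n - i)))\<^sup>2)"
    by (rule Cauchy_Schwarz_ineq_sum)
  also have "(\<Sum>i\<le>n. (sqrt (multichoose k (n - i)))\<^sup>2) = multichoose (Suc k) n"
    using sum.atLeastAtMost_rev[of "\<lambda>i. multichoose k i" 0 n]
    by (simp add: multichoose_Suc_left atMost_atLeast0 flip: of_nat_sum)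
  also have "(\<Sum>i\<le>n. (norm (coeff g i) * sqrt (coeff (h ^ k) (n - i)))\<^sup>2) = coeff (h ^ Suc k) n"
    by (simp add: coeff_mult power_mult_distrib h h_nonneg)
  finally show ?case .
qed

text \<open>Submultiplicativity spreads the weight of the total index over the factors of each term
  of the product.\<close>

lemma multichoose_times_coeff_power_le:
  fixes h \<gamma> :: "real poly"
  assumes k: "k > 0" and h: "\<And>i. 0 \<le> coeff h i" and \<gamma>: "\<And>i. coeff \<gamma> i = multichoose k i * coeff h i"
  shows "multichoose k n * coeff (h ^ j) n \<le> coeff (\<gamma> ^ j) n"
proof (induction j arbitrary: n)
  case (Suc j)
  have "multichoose k n * coeff (h ^ Suc j) n = (\<Sum>i\<le>n. multichoose k n * (coeff h i * coeff (h ^ j) (n - i)))"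
    by (simp add: coeff_mult sum_distrib_left)
  also have "\<dots> \<le> (\<Sum>i\<le>n. coeff \<gamma> i * coeff (\<gamma> ^ j) (n - i))"
  proof (rule sum_mono)
    fix i assume i: "i \<in> {..n}"
    have nonneg: "0 \<le> coeff h i * coeff (h ^ j) (n - i)" "0 \<le> coeff \<gamma> i"
      by (auto intro!: mult_nonneg_nonneg coeff_power_nonneg h simp: \<gamma>)
    have "multichoose k n \<le> multichoose k i * multichoose k (n - i)"
      using multichoose_add_le[OF k, of i "n - i"] i by simp
    then have "multichoose k n * (coeff h i * coeff (h ^ j) (n - i)) \<le>
        real (multichoose k i * multichoose k (n - i)) * (coeff h i * coeff (h ^ j) (n - i))"
      using nonneg(1) by (intro mult_right_mono of_nat_mono)
    also have "\<dots> = coeff \<gamma> i * (multichoose k (n - i) * coeff (h ^ j) (n - i))"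
      by (simp add: \<gamma> mult_ac)
    also have "\<dots> \<le> coeff \<gamma> i * coeff (\<gamma> ^ j) (n - i)"
      using nonneg(2) by (intro mult_left_mono Suc.IH)
    finally show "multichoose k n * (coeff h i * coeff (h ^ j) (n - i)) \<le> coeff \<gamma> i * coeff (\<gamma> ^ j) (n - i)" .
  qed
  also have "\<dots> = coeff (\<gamma> ^ Suc j) n"
    by (simp add: coeff_mult)
  finally show ?case .
qed simp

text \<open>Parseval for \<open>f ^ k\<close>, then the bound on its coefficients, then the weight
  spread over the factors. Summing coefficients is evaluation at 1, which turns a power of
  polynomials into a power of numbers.\<close>

lemma cavg_norm_poly_even_power_le:
  fixes f :: "complex poly"
  assumes k: "k > 0" and deg: "degree f \<le> N"
  shows "cavg (\<lambda>z. norm (poly f z) ^ (2 * k)) \<le> (\<Sum>i\<le>N. multichoose k i * (norm (coeff f i))\<^sup>2) ^ k"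
proof -
  define h where "h = map_poly (\<lambda>c. (norm c)\<^sup>2) f"
  have h: "coeff h i = (norm (coeff f i))\<^sup>2" for i
    by (simp add: h_def coeff_map_poly)
  define \<gamma> where "\<gamma> = (\<Sum>i\<le>N. monom (multichoose k i * (norm (coeff f i))\<^sup>2) i)"
  have \<gamma>: "coeff \<gamma> i = multichoose k i * coeff h i" for i
    using deg coeff_eq_0[of f i] by (auto simp: \<gamma>_def coeff_sum h sum.delta)
  define M where "M = max (degree (f ^ k)) (degree (\<gamma> ^ k))"
  have M: "degree (f ^ k) \<le> M" "degree (\<gamma> ^ k) \<le> M"
    by (auto simp: M_def)
  have "cavg (\<lambda>z. norm (poly f z) ^ (2 * k)) = cavg (\<lambda>z. (norm (poly (f ^ k) (of_real 1 * z)))\<^sup>2)"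
    by (simp add: norm_power power_mult mult.commute)
  also have "\<dots> = (\<Sum>i\<le>M. (norm (coeff (f ^ k) i))\<^sup>2)"
    unfolding cavg_norm_poly_squared[OF M(1)] by simp
  also have "\<dots> \<le> (\<Sum>i\<le>M. multichoose k i * coeff (h ^ k) i)"
    by (intro sum_mono norm_coeff_power_le h)
  also have "\<dots> \<le> (\<Sum>i\<le>M. coeff (\<gamma> ^ k) i)"
    by (intro sum_mono multichoose_times_coeff_power_le k \<gamma>) (simp add: h)
  also have "\<dots> = poly \<gamma> 1 ^ k"
    using poly_extend[OF M(2), of 1] by simp
  also have "poly \<gamma> 1 = (\<Sum>i\<le>N. multichoose k i * (norm (coeff f i))\<^sup>2)"
    by (simp add: \<gamma>_def poly_sum poly_monom)
  finally show ?thesis .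
qed

text \<open>The same Cauchy-Schwarz bound with the weight divided out. This is Carleman's inequality
  for a function \<open>g ^ k\<close> with a polynomial \<open>k\<close>-th root: the square of
  \<open>norm g\<close> is the power \<open>2 / k\<close> of its modulus.\<close>

lemma sum_coeff_power_div_multichoose_le:
  fixes g :: "complex poly"
  assumes k: "k > 0" and deg: "degree (g ^ k) \<le> M"
  shows "(\<Sum>i\<le>M. (norm (coeff (g ^ k) i))\<^sup>2 / multichoose k i) \<le> cavg (\<lambda>z. (norm (poly g z))\<^sup>2) ^ k"
proof -
  define h where "h = map_poly (\<lambda>c. (norm c)\<^sup>2) g"
  have h: "coeff h i = (norm (coeff g i))\<^sup>2" for i
    by (simp add: h_def coeff_map_poly)
  define L where "L = max M (degree (h ^ k))"
  have h_nonneg: "0 \<le> coeff (h ^ k) i" for i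
    by (rule coeff_power_nonneg) (simp add: h)
  have "(\<Sum>i\<le>M. (norm (coeff (g ^ k) i))\<^sup>2 / multichoose k i) \<le> (\<Sum>i\<le>M. coeff (h ^ k) i)"
    using norm_coeff_power_le[of h g, OF h] multichoose_pos[OF k]
    by (intro sum_mono) (simp add: divide_le_eq mult.commute)
  also have "\<dots> \<le> (\<Sum>i\<le>L. coeff (h ^ k) i)"
    by (intro sum_mono2) (auto simp: L_def h_nonneg)
  also have "\<dots> = poly h 1 ^ k"
    using poly_extend[of "h ^ k" L 1] by (simp add: L_def)
  also have "poly h 1 = (\<Sum>i\<le>degree g. (norm (coeff g i))\<^sup>2)"
    using poly_extend[of h "degree g" 1] by (simp add: h) (simp add: h_def map_poly_degree_leq)
  also have "\<dots> = cavg (\<lambda>z. (norm (poly g z))\<^sup>2)"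
    using cavg_norm_poly_squared[of g "degree g" 1] by simp
  finally show ?thesis .
qed

text \<open>The weights \<open>1 / multichoose k i\<close> are moments of a positive measure on \<open>[0, 1]\<close>.\<close>
lemma sum_div_multichoose_nonneg:
  fixes c :: "nat \<Rightarrow> real"
  assumes k: "k > 0" and nonneg: "\<And>x. 0 \<le> x \<Longrightarrow> x \<le> 1 \<Longrightarrow> 0 \<le> (\<Sum>i\<le>N. c i * x ^ i)"
  shows "0 \<le> (\<Sum>i\<le>N. c i / multichoose k i)"
\<comment> \<open>For \<open>k = 1\<close> the measure is the point mass at 1. For
  \<open>k \<ge> 2\<close> it has the Beta density proportional to
  \<open>(1 - t) ^ (k - 2)\<close>.\<close>
proof (cases "k = 1")
  case True
  then show ?thesis
    using nonneg[of 1] by (simp add: multichoose_def)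
next
  case False
  define l where "l = k - 2"
  have l: "k = Suc (Suc l)"
    using k False by (simp add: l_def)
  have moment: "((\<lambda>t. t ^ i * (1 - t) ^ l) has_integral 1 / (real (Suc l) * multichoose k i)) {0..1}" for i
  proof -
    have "((\<lambda>t. t powr ((1 + real i) - 1) * (1 - t) powr ((1 + real l) - 1)) has_integral
        Beta (1 + real i) (1 + real l)) {0..1}"
      by (rule has_integral_Beta_real) auto
    moreover have "t ^ i * (1 - t) ^ l = t powr ((1 + real i) - 1) * (1 - t) powr ((1 + real l) - 1)"
      if "t \<in> {0..1} - {0, 1}" for t
      using that by (auto simp: powr_realpow)
    ultimately have "((\<lambda>t. t ^ i * (1 - t) ^ l) has_integral Beta (1 + real i) (1 + real l)) {0..1}"
      by (intro has_integral_spike_finite[of "{0, 1}" "{0..1}" "\<lambda>t. t ^ i * (1 - t) ^ l"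
            "\<lambda>t. t powr ((1 + real i) - 1) * (1 - t) powr ((1 + real l) - 1)"]) simp_all
    moreover have "Beta (1 + real i) (1 + real l) = fact i * fact l / fact (Suc (i + l))"
    proof -
      have "(1 + real i) + (1 + real l) = 1 + real (Suc (i + l))"
        by simp
      then show ?thesis
        by (simp only: Beta_def Gamma_fact)
    qed
    moreover have "real (multichoose k i) = fact (Suc (i + l)) / (fact i * fact (Suc l))"
    proof -
      have "multichoose k i = Suc (i + l) choose i"
        by (simp add: multichoose_def l)
      then show ?thesis
        using binomial_fact[of i "Suc (i + l)", where ?'a = real] by (simp del: fact_Suc)
    qed
    moreover have "fact i * fact l / F = 1 / (real (Suc l) * (F / (fact i * fact (Suc l))))" for F :: real
      by simp
    ultimately show ?thesis
      by metis
  qed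
  have "((\<lambda>t. \<Sum>i\<le>N. c i * (t ^ i * (1 - t) ^ l)) has_integral
      (\<Sum>i\<le>N. c i * (1 / (real (Suc l) * multichoose k i)))) {0..1}"
    by (intro has_integral_sum has_integral_mult_right moment) auto
  then have "0 \<le> (\<Sum>i\<le>N. c i * (1 / (real (Suc l) * multichoose k i)))"
  proof (rule has_integral_nonneg)
    fix t :: real assume t: "t \<in> {0..1}"
    have "(\<Sum>i\<le>N. c i * (t ^ i * (1 - t) ^ l)) = (\<Sum>i\<le>N. c i * t ^ i) * (1 - t) ^ l"
      by (simp add: sum_distrib_right mult.assoc)
    then show "0 \<le> (\<Sum>i\<le>N. c i * (t ^ i * (1 - t) ^ l))"
      using nonneg[of t] t by simp
  qed
  also have "\<dots> = (\<Sum>i\<le>N. c i / multichoose k i) / real (Suc l)"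
    by (simp add: sum_divide_distrib mult.commute)
  finally show ?thesis
    by (simp add: zero_le_divide_iff)
qed

text \<open>The weights are moments in the squared radius \<open>x\<close>, so each side is an
  average of mean squares over circles of radius \<open>sqrt x\<close>, where pointwise domination
  can be used.\<close>

lemma weighted_coeff_sum_mono:
  fixes f g :: "complex poly"
  assumes k: "k > 0" and deg: "degree f \<le> N" "degree g \<le> N" and "0 \<le> C"
    and le: "\<And>z. z \<in> cball 0 1 \<Longrightarrow> norm (poly f z) \<le> C * norm (poly g z)"
  shows "(\<Sum>i\<le>N. (norm (coeff f i))\<^sup>2 / multichoose k i) \<le> C\<^sup>2 * (\<Sum>i\<le>N. (norm (coeff g i))\<^sup>2 / multichoose k i)"
proof -
  have "0 \<le> (\<Sum>i\<le>N. (C\<^sup>2 * (norm (coeff g i))\<^sup>2 - (norm (coeff f i))\<^sup>2) / multichoose k i)"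
  proof (rule sum_div_multichoose_nonneg[OF k])
    fix x :: real assume x: "0 \<le> x" "x \<le> 1"
    have "cavg (\<lambda>z. (norm (poly f (of_real (sqrt x) * z)))\<^sup>2) \<le> cavg (\<lambda>z. C\<^sup>2 * (norm (poly g (of_real (sqrt x) * z)))\<^sup>2)"
    proof (rule cavg_mono)
      fix z assume "z \<in> circle"
      then have "norm (poly f (of_real (sqrt x) * z)) \<le> C * norm (poly g (of_real (sqrt x) * z))"
        using x by (intro le) (auto simp: norm_mult)
      then show "(norm (poly f (of_real (sqrt x) * z)))\<^sup>2 \<le> C\<^sup>2 * (norm (poly g (of_real (sqrt x) * z)))\<^sup>2"
        unfolding power_mult_distrib[symmetric] by (intro power_mono) auto
    qed (intro continuous_intros)+
    then have "(\<Sum>i\<le>N. x ^ i * (norm (coeff f i))\<^sup>2) \<le> C\<^sup>2 * (\<Sum>i\<le>N. x ^ i * (norm (coeff g i))\<^sup>2)"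
      using x by (simp add: cavg_cmult cavg_norm_poly_squared[OF deg(1)] cavg_norm_poly_squared[OF deg(2)] power_mult)
    then show "0 \<le> (\<Sum>i\<le>N. (C\<^sup>2 * (norm (coeff g i))\<^sup>2 - (norm (coeff f i))\<^sup>2) * x ^ i)"
      by (simp add: algebra_simps sum_subtractf sum_distrib_left)
  qed
  then show ?thesis
    by (simp add: diff_divide_distrib sum_subtractf sum_distrib_left)
qed

text \<open>The majorant is an exponential, whereas the estimate for powers concerns polynomials. On
  the compact disc the exponential is bounded away from 0, so a small Taylor remainder is small in
  relative terms too.\<close>

lemma exp_poly_approximation:
  fixes q :: "complex poly"
  assumes c: "c > 1"
  obtains g where "\<And>z. z \<in> cball 0 1 \<Longrightarrow> norm (exp (poly q z)) \<le> c * norm (poly g z)"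
    "\<And>z. z \<in> cball 0 1 \<Longrightarrow> norm (poly g z) \<le> c * norm (exp (poly q z))"
proof -
  have "bounded (poly q ` cball 0 1)"
    by (intro compact_imp_bounded compact_continuous_image continuous_intros) auto
  then obtain B where B: "\<And>z. z \<in> cball 0 1 \<Longrightarrow> norm (poly q z) \<le> B"
    unfolding bounded_iff by blast
  have B0: "B \<ge> 0"
    using order_trans[OF norm_ge_zero B[of 0]] by simp
  \<comment> \<open>Makes \<open>1 - \<eta>\<close> equal to \<open>1 / c\<close> for one ratio and
    \<open>1 + \<eta> \<le> c\<close> for the other.\<close>
  define \<eta> where "\<eta> = 1 - 1 / c"
  have \<eta>: "\<eta> > 0" "1 + \<eta> \<le> c" "(1 - \<eta>) * c = 1"
  proof -
    have "0 \<le> (c - 1)\<^sup>2 / c"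
      using c by simp
    also have "\<dots> = c - (1 + \<eta>)"
      using c by (simp add: \<eta>_def power2_eq_square field_simps)
    finally show "1 + \<eta> \<le> c" by simp
  qed (use c in \<open>auto simp: \<eta>_def\<close>)
  have "(\<lambda>n. exp B * (B * (B ^ n / fact n))) \<longlonglongrightarrow> exp B * (B * 0)"
    using summable_LIMSEQ_zero[OF summable_exp[of B]]
    by (intro tendsto_intros) (simp add: field_simps)
  then have "\<forall>\<^sub>F n in sequentially. exp B * (B * (B ^ n / fact n)) < \<eta> * exp (- B)"
    using \<eta>(1) by (intro order_tendstoD) auto
  then obtain n where n: "exp B * (B * (B ^ n / fact n)) < \<eta> * exp (- B)"
    by (auto simp: eventually_sequentially)
  define g where "g = (\<Sum>i\<le>n. smult (1 / fact i) (q ^ i))"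
  have diff: "norm (exp (poly q z) - poly g z) \<le> \<eta> * norm (exp (poly q z))" if z: "z \<in> cball 0 1" for z
  proof -
    have "norm (exp (poly q z) - poly g z) \<le> exp \<bar>Re (poly q z)\<bar> * norm (poly q z) ^ Suc n / fact n"
      using Taylor_exp[of "poly q z" n] by (simp add: g_def poly_sum)
    also have "\<dots> \<le> exp B * B ^ Suc n / fact n"
      using B[OF z] B0 abs_Re_le_cmod[of "poly q z"]
      by (intro divide_right_mono mult_mono power_mono) auto
    also have "\<dots> \<le> \<eta> * exp (- B)"
      using n by simp
    also have "\<dots> \<le> \<eta> * norm (exp (poly q z))"
      using \<eta>(1) B[OF z] abs_Re_le_cmod[of "poly q z"] by (intro mult_left_mono) auto
    finally show ?thesis .
  qed
  show ?thesis
  proof (rule that[of g])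
    fix z :: complex assume z: "z \<in> cball 0 1"
    have "(1 - \<eta>) * norm (exp (poly q z)) \<le> norm (poly g z)"
      using diff[OF z] norm_triangle_ineq2[of "exp (poly q z)" "poly g z"] by (simp add: algebra_simps)
    then have "c * ((1 - \<eta>) * norm (exp (poly q z))) \<le> c * norm (poly g z)"
      using c by (intro mult_left_mono) auto
    also have "c * ((1 - \<eta>) * norm (exp (poly q z))) = ((1 - \<eta>) * c) * norm (exp (poly q z))"
      by (simp only: mult_ac)
    finally show "norm (exp (poly q z)) \<le> c * norm (poly g z)"
      unfolding \<eta>(3) by simp
    have "norm (poly g z) \<le> (1 + \<eta>) * norm (exp (poly q z))"
      using diff[OF z] norm_triangle_ineq3[of "exp (poly q z)" "poly g z"] by (simp add: algebra_simps)
    also have "\<dots> \<le> c * norm (exp (poly q z))"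
      using \<eta>(2) by (intro mult_right_mono) auto
    finally show "norm (poly g z) \<le> c * norm (exp (poly q z))" .
  qed
qed

text \<open>Zeros may prevent \<open>f\<close> from having a holomorphic \<open>k\<close>-th root.
  Its majorant has the root \<open>exp (q / 2)\<close>, which is replaced by a polynomial
  \<open>g\<close> at the cost of a factor near 1; the weighted sum for \<open>f\<close> is then
  compared with the one for \<open>g ^ k\<close>.\<close>

lemma carleman_inequality:
  fixes f :: "complex poly"
  assumes k: "k > 0" and deg: "degree f \<le> N"
  shows "(\<Sum>i\<le>N. (norm (coeff f i))\<^sup>2 / multichoose k i) \<le> cavg (\<lambda>z. norm (poly f z) powr (2 / k)) ^ k"
proof -
  let ?X = "\<Sum>i\<le>N. (norm (coeff f i))\<^sup>2 / multichoose k i"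
  let ?Y = "cavg (\<lambda>z. norm (poly f z) powr (2 / k))"
  have contf: "continuous_on circle (\<lambda>z. norm (poly f z) powr (2 / k))"
    using k by (intro continuous_on_norm_powr continuous_intros) auto
  have Y: "?Y \<ge> 0"
    by (intro cavg_nonneg contf) auto
  have "?X \<le> ?Y powr (real k)"
  proof (rule outer_majorant_limit)
    fix e :: real assume e: "0 < e"
    obtain q where q: "\<And>z. z \<in> cball 0 1 \<Longrightarrow> norm (poly f z) powr (2 / k) \<le> exp (Re (poly q z))"
      "cavg (\<lambda>z. exp (Re (poly q z))) \<le> (?Y + e / 2) * exp (e / 2)"
      using poly_outer_majorant[of "2 / k" "e / 2" f] k e by auto
    \<comment> \<open>The squared factor \<open>c\<close> is lost twice, once for each side of the
      approximation. Together \<open>c ^ 4 = exp (e / 2)\<close> and the factor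
      \<open>exp (e / 2)\<close> of the majorant make \<open>exp e\<close>.\<close>
    define c where "c = exp (e / 8)"
    have c: "c > 1"
      using e by (simp add: c_def)
    define Q where "Q = smult (1 / 2) q"
    obtain g where g: "\<And>z. z \<in> cball 0 1 \<Longrightarrow> norm (exp (poly Q z)) \<le> c * norm (poly g z)"
      "\<And>z. z \<in> cball 0 1 \<Longrightarrow> norm (poly g z) \<le> c * norm (exp (poly Q z))"
      using exp_poly_approximation[OF c] by blast
    define M where "M = max N (degree (g ^ k))"
    have "norm (poly f z) \<le> c ^ k * norm (poly (g ^ k) z)" if z: "z \<in> cball 0 1" for z
    proof -
      have "(norm (poly f z) powr (2 / k)) powr (k / 2) \<le> exp (Re (poly q z)) powr (k / 2)"
        by (intro powr_mono2 q(1) z) auto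
      then have "norm (poly f z) \<le> exp (Re (poly q z)) powr (k / 2)"
        using k by (simp add: powr_powr)
      also have "\<dots> = norm (exp (poly Q z)) ^ k"
        by (simp add: Q_def norm_exp_eq_Re powr_def exp_of_nat_mult[symmetric])
      also have "\<dots> \<le> (c * norm (poly g z)) ^ k"
        by (intro power_mono g(1) z) auto
      finally show ?thesis
        by (simp add: power_mult_distrib norm_power)
    qed
    then have *: "(\<Sum>i\<le>M. (norm (coeff f i))\<^sup>2 / multichoose k i) \<le>
        (c ^ k)\<^sup>2 * (\<Sum>i\<le>M. (norm (coeff (g ^ k) i))\<^sup>2 / multichoose k i)"
      using c deg by (intro weighted_coeff_sum_mono k) (auto simp: M_def)
    have "?X \<le> (\<Sum>i\<le>M. (norm (coeff f i))\<^sup>2 / multichoose k i)"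
      by (intro sum_mono2) (auto simp: M_def)
    also note *
    also have "(c ^ k)\<^sup>2 * (\<Sum>i\<le>M. (norm (coeff (g ^ k) i))\<^sup>2 / multichoose k i) \<le>
        (c ^ k)\<^sup>2 * cavg (\<lambda>z. (norm (poly g z))\<^sup>2) ^ k"
      by (intro mult_left_mono sum_coeff_power_div_multichoose_le k) (auto simp: M_def)
    also have "\<dots> = (c\<^sup>2 * cavg (\<lambda>z. (norm (poly g z))\<^sup>2)) ^ k"
      by (simp add: power_mult_distrib flip: power_mult) (simp add: mult.commute)
    also have "\<dots> \<le> ((?Y + e) * exp e) ^ k"
    proof (intro power_mono)
      have "cavg (\<lambda>z. (norm (poly g z))\<^sup>2) \<le> cavg (\<lambda>z. c\<^sup>2 * exp (Re (poly q z)))"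
      proof (rule cavg_mono)
        fix z assume "z \<in> circle"
        then have "(norm (poly g z))\<^sup>2 \<le> (c * norm (exp (poly Q z)))\<^sup>2"
          by (intro power_mono g(2)) auto
        then show "(norm (poly g z))\<^sup>2 \<le> c\<^sup>2 * exp (Re (poly q z))"
          by (simp add: power_mult_distrib Q_def norm_exp_eq_Re exp_double[symmetric])
      qed (intro continuous_intros)+
      also have "\<dots> \<le> c\<^sup>2 * ((?Y + e / 2) * exp (e / 2))"
        unfolding cavg_cmult by (intro mult_left_mono q) auto
      finally have "c\<^sup>2 * cavg (\<lambda>z. (norm (poly g z))\<^sup>2) \<le> c\<^sup>2 * (c\<^sup>2 * ((?Y + e / 2) * exp (e / 2)))"
        by (intro mult_left_mono) auto
      also have "\<dots> = (?Y + e / 2) * (c ^ 4 * exp (e / 2))"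
        by (simp add: power4_eq_xxxx power2_eq_square)
      also have "c ^ 4 * exp (e / 2) = exp e"
        by (simp add: c_def exp_of_nat_mult[symmetric] exp_add[symmetric])
      also have "(?Y + e / 2) * exp e \<le> (?Y + e) * exp e"
        using e by (intro mult_right_mono) auto
      finally show "c\<^sup>2 * cavg (\<lambda>z. (norm (poly g z))\<^sup>2) \<le> (?Y + e) * exp e" .
    qed (intro mult_nonneg_nonneg cavg_nonneg continuous_intros; simp)
    also have "\<dots> = ((?Y + e) * exp e) powr (real k)"
      using Y e by (simp add: powr_realpow add_nonneg_pos)
    finally show "?X \<le> ((?Y + e) * exp e) powr (real k)" .
  qed (use Y k in auto)
  also have "\<dots> = ?Y ^ k"
    using Y k by (simp add: powr_realpow')
  finally show ?thesis .
qed

text \<open>The value of \<open>Phi \<alpha>\<close> at the \<open>j\<close>-th power of any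
  prime.\<close>

definition prime_weight :: "real \<Rightarrow> nat \<Rightarrow> real" where
  "prime_weight \<alpha> j = multichoose (nat \<lfloor>\<alpha>\<rfloor>) j * (\<alpha> / of_int \<lfloor>\<alpha>\<rfloor>) ^ j"

lemma prime_weight_pos: "1 \<le> \<alpha> \<Longrightarrow> 0 < prime_weight \<alpha> j"
  unfolding prime_weight_def
  by (intro mult_pos_pos zero_less_power divide_pos_pos) (auto simp: multichoose_pos)

lemma coefficient_inequality_lower:
  fixes f :: "complex poly"
  assumes q: "0 < q" "q \<le> 2" and deg: "degree f \<le> N"
  shows "(\<Sum>i\<le>N. (norm (coeff f i))\<^sup>2 / prime_weight (2 / q) i) \<le> cavg (\<lambda>z. norm (poly f z) powr q) powr (2 / q)"
proof -
  define \<alpha> where "\<alpha> = 2 / q"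
  define k where "k = nat \<lfloor>\<alpha>\<rfloor>"
  have \<alpha>: "\<alpha> \<ge> 1"
    using q by (simp add: \<alpha>_def)
  have k: "k > 0" "real k \<le> \<alpha>" "of_int \<lfloor>\<alpha>\<rfloor> = real k"
    using \<alpha> by (auto simp: k_def)
  \<comment> \<open>Then \<open>q * s = 2 / k\<close> is the exponent in Carleman's inequality, and
    \<open>r\<close> is the dilation allowed from \<open>q\<close> to \<open>q * s\<close>. The same
    \<open>r\<close> turns the weight \<open>multichoose k i\<close> into
    \<open>prime_weight \<alpha> i\<close>.\<close>
  define s where "s = \<alpha> / k"
  define r where "r = sqrt (1 / s)"
  have s: "s \<ge> 1"
    using k by (simp add: s_def)
  have r: "0 < r" "r\<^sup>2 * s = 1" "r\<^sup>2 = 1 / s"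
    using s by (auto simp: r_def)
  define g where "g = pcompose f [:0, of_real r:]"
  have g: "poly g z = poly f (of_real r * z)" "coeff g i = of_real r ^ i * coeff f i" for z i
    by (simp_all add: g_def poly_pcompose coeff_pcompose_linear mult.commute)
  have deg_g: "degree g \<le> N"
    using deg by (simp add: g_def degree_pcompose)
  have cont: "continuous_on T (\<lambda>z. norm (poly p z) powr x)" if "x > 0" for T x and p :: "complex poly"
    by (rule continuous_on_norm_powr[OF that]) (intro continuous_intros)
  have "(norm (coeff f i))\<^sup>2 / prime_weight \<alpha> i = (norm (coeff g i))\<^sup>2 / multichoose k i" for i
  proof -
    have "(norm (coeff g i))\<^sup>2 = (r\<^sup>2) ^ i * (norm (coeff f i))\<^sup>2"
      using r(1) by (simp add: g norm_mult norm_power power_mult_distrib power_mult[symmetric] mult.commute)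
    then show ?thesis
      unfolding r(3) prime_weight_def k(3) k_def[symmetric] s_def
      using k(1) \<alpha> by (simp add: power_divide mult_ac)
  qed
  then have "(\<Sum>i\<le>N. (norm (coeff f i))\<^sup>2 / prime_weight \<alpha> i) = (\<Sum>i\<le>N. (norm (coeff g i))\<^sup>2 / multichoose k i)"
    by simp
  also have "\<dots> \<le> cavg (\<lambda>z. norm (poly g z) powr (2 / k)) ^ k"
    by (rule carleman_inequality[OF k(1) deg_g])
  also have "2 / real k = q * s"
    using q by (simp add: s_def \<alpha>_def)
  also have "cavg (\<lambda>z. norm (poly g z) powr (q * s)) ^ k \<le> (cavg (\<lambda>z. norm (poly f z) powr q) powr s) ^ k"
  proof (rule power_mono)
    show "cavg (\<lambda>z. norm (poly g z) powr (q * s)) \<le> cavg (\<lambda>z. norm (poly f z) powr q) powr s"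
      unfolding g by (rule cavg_powr_dilation_le[OF q(1) s r(1,2)])
    show "0 \<le> cavg (\<lambda>z. norm (poly g z) powr (q * s))"
      using q s by (intro cavg_nonneg cont) auto
  qed
  also have "\<dots> = (cavg (\<lambda>z. norm (poly f z) powr q) powr s) powr k"
    using k(1) by (simp add: powr_realpow')
  also have "\<dots> = cavg (\<lambda>z. norm (poly f z) powr q) powr \<alpha>"
    using k(1) by (simp add: powr_powr s_def)
  finally show ?thesis
    by (simp add: \<alpha>_def)
qed

text \<open>The dilation is used the other way round: \<open>f\<close> is the dilate of
  \<open>g\<close>, whose coefficients are enlarged by powers of \<open>1 / r\<close>. Weissler's
  theorem leads from exponent \<open>2 * k\<close> for \<open>g\<close> to
  \<open>q = 2 * k * s\<close> for \<open>f\<close>, and the even exponent is accessible through the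
  coefficients of \<open>g ^ k\<close>.\<close>

lemma coefficient_inequality_upper:
  fixes f :: "complex poly"
  assumes q: "2 \<le> q" and deg: "degree f \<le> N"
  shows "cavg (\<lambda>z. norm (poly f z) powr q) \<le> (\<Sum>i\<le>N. (norm (coeff f i))\<^sup>2 * prime_weight (q / 2) i) powr (q / 2)"
proof -
  define \<alpha> where "\<alpha> = q / 2"
  define k where "k = nat \<lfloor>\<alpha>\<rfloor>"
  have \<alpha>: "\<alpha> \<ge> 1"
    using q by (simp add: \<alpha>_def)
  have k: "k > 0" "real k \<le> \<alpha>" "of_int \<lfloor>\<alpha>\<rfloor> = real k"
    using \<alpha> by (auto simp: k_def)
  define s where "s = \<alpha> / k"
  define r where "r = sqrt (1 / s)"
  have s: "s \<ge> 1"
    using k by (simp add: s_def)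
  have r: "0 < r" "r\<^sup>2 * s = 1" "r\<^sup>2 = 1 / s"
    using s by (auto simp: r_def)
  define g where "g = pcompose f [:0, of_real (1 / r):]"
  have g: "poly g (of_real r * z) = poly f z" "coeff g i = of_real (1 / r) ^ i * coeff f i" for z i
    using r(1) by (simp_all add: g_def poly_pcompose coeff_pcompose_linear)
  have deg_g: "degree g \<le> N"
    using deg by (simp add: g_def degree_pcompose)
  have "(norm (coeff f i))\<^sup>2 * prime_weight \<alpha> i = multichoose k i * (norm (coeff g i))\<^sup>2" for i
  proof -
    have "(norm (coeff g i))\<^sup>2 = (1 / r\<^sup>2) ^ i * (norm (coeff f i))\<^sup>2"
      unfolding g norm_mult norm_power power_mult_distrib power_mult[symmetric]
      using r(1) by (simp add: mult.commute norm_divide power_divide power_mult[symmetric])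
    then show ?thesis
      unfolding r(3) prime_weight_def k(3) k_def[symmetric] s_def
      by simp
  qed
  then have sum: "(\<Sum>i\<le>N. (norm (coeff f i))\<^sup>2 * prime_weight \<alpha> i) = (\<Sum>i\<le>N. multichoose k i * (norm (coeff g i))\<^sup>2)"
    by simp
  have "cavg (\<lambda>z. norm (poly f z) powr q) = cavg (\<lambda>z. norm (poly g (of_real r * z)) powr ((2 * real k) * s))"
    using k(1) by (simp add: g s_def \<alpha>_def)
  also have "\<dots> \<le> cavg (\<lambda>z. norm (poly g z) powr (2 * real k)) powr s"
    by (rule cavg_powr_dilation_le) (use k s r in auto)
  also have "cavg (\<lambda>z. norm (poly g z) powr (2 * real k)) = cavg (\<lambda>z. norm (poly g z) ^ (2 * k))"
    using k(1) powr_realpow'[of _ "2 * k"] by simp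
  also have "\<dots> powr s \<le> ((\<Sum>i\<le>N. multichoose k i * (norm (coeff g i))\<^sup>2) ^ k) powr s"
    using s by (intro powr_mono2 cavg_norm_poly_even_power_le[OF k(1) deg_g] cavg_nonneg continuous_intros) auto
  also have "\<dots> = ((\<Sum>i\<le>N. multichoose k i * (norm (coeff g i))\<^sup>2) powr k) powr s"
    using k(1) by (simp add: powr_realpow' sum_nonneg)
  also have "\<dots> = (\<Sum>i\<le>N. (norm (coeff f i))\<^sup>2 * prime_weight \<alpha> i) powr \<alpha>"
    using k(1) by (simp add: powr_powr s_def sum)
  finally show ?thesis
    by (simp add: \<alpha>_def)
qed

section \<open>Mean values over the imaginary axis\<close>

definition tavg :: "real \<Rightarrow> (real \<Rightarrow> 'a::euclidean_space) \<Rightarrow> 'a" where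
  "tavg T g = (1 / T) *\<^sub>R integral {0..T} g"

text \<open>A relation instead of a \<open>Lim\<close>, so that each statement includes the
  existence of the mean.\<close>

definition has_mean :: "(real \<Rightarrow> 'a::euclidean_space) \<Rightarrow> 'a \<Rightarrow> bool" where
  "has_mean g L \<longleftrightarrow> ((\<lambda>T. tavg T g) \<longlongrightarrow> L) at_top"

lemma continuous_imp_integrable_0:
  fixes g :: "real \<Rightarrow> 'a::euclidean_space"
  assumes "continuous_on UNIV g"
  shows "g integrable_on {0..T}"
  by (intro integrable_continuous_real continuous_on_subset[OF assms]) auto

lemma tavg_const: "T > 0 \<Longrightarrow> tavg T (\<lambda>t. c) = c"
  by (simp add: tavg_def)

lemma tavg_add:
  assumes "continuous_on UNIV f" "continuous_on UNIV g"
  shows "tavg T (\<lambda>t. f t + g t) = tavg T f + tavg T g"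
  by (simp add: tavg_def integral_add continuous_imp_integrable_0 assms scaleR_add_right)

lemma tavg_diff:
  assumes "continuous_on UNIV f" "continuous_on UNIV g"
  shows "tavg T (\<lambda>t. f t - g t) = tavg T f - tavg T g"
  by (simp add: tavg_def integral_diff continuous_imp_integrable_0 assms scaleR_diff_right)

lemma tavg_sum:
  assumes "finite A" "\<And>i. i \<in> A \<Longrightarrow> continuous_on UNIV (f i)"
  shows "tavg T (\<lambda>t. \<Sum>i\<in>A. f i t) = (\<Sum>i\<in>A. tavg T (f i))"
  by (simp add: tavg_def integral_sum continuous_imp_integrable_0 assms scaleR_sum_right)

lemma tavg_cmult:
  fixes f :: "real \<Rightarrow> real"
  shows "tavg T (\<lambda>t. c * f t) = c * tavg T f"
  by (simp add: tavg_def)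

lemma tavg_mono:
  fixes f g :: "real \<Rightarrow> real"
  assumes "continuous_on UNIV f" "continuous_on UNIV g" "\<And>t. t \<in> {0..T} \<Longrightarrow> f t \<le> g t" "T > 0"
  shows "tavg T f \<le> tavg T g"
  unfolding tavg_def using assms
  by (simp, intro divide_right_mono integral_le continuous_imp_integrable_0) auto

lemma tavg_nonneg:
  fixes f :: "real \<Rightarrow> real"
  assumes "continuous_on UNIV f" "\<And>t. 0 \<le> f t" "T > 0"
  shows "0 \<le> tavg T f"
  using tavg_mono[of "\<lambda>_. 0" f T] assms by (simp add: tavg_const)

lemma abs_tavg_diff_le:
  fixes f g :: "real \<Rightarrow> real"
  assumes "continuous_on UNIV f" "continuous_on UNIV g" "\<And>t. \<bar>f t - g t\<bar> \<le> e" "T > 0"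
  shows "\<bar>tavg T f - tavg T g\<bar> \<le> e"
proof -
  have "tavg T f \<le> tavg T (\<lambda>t. g t + e)" "tavg T g \<le> tavg T (\<lambda>t. f t + e)"
    using assms(3) by (intro tavg_mono continuous_intros assms; smt (verit))+
  then show ?thesis
    using assms by (simp add: tavg_add tavg_const)
qed

lemma has_mean_const: "has_mean (\<lambda>t. c) c"
  unfolding has_mean_def
  by (rule tendsto_eventually) (auto intro!: eventually_mono[OF eventually_gt_at_top[of 0]] tavg_const)

lemma has_mean_add:
  assumes "continuous_on UNIV f" "continuous_on UNIV g" "has_mean f L" "has_mean g M"
  shows "has_mean (\<lambda>t. f t + g t) (L + M)"
  using assms unfolding has_mean_def by (simp add: tavg_add tendsto_add)

lemma has_mean_diff:
  assumes "continuous_on UNIV f" "continuous_on UNIV g" "has_mean f L" "has_mean g M"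
  shows "has_mean (\<lambda>t. f t - g t) (L - M)"
  using assms unfolding has_mean_def by (simp add: tavg_diff tendsto_diff)

lemma has_mean_bounded_linear:
  assumes "bounded_linear h" "continuous_on UNIV g" "has_mean g L"
  shows "has_mean (\<lambda>t. h (g t)) (h L)"
proof -
  interpret bounded_linear h by fact
  have "tavg T (\<lambda>t. h (g t)) = h (tavg T g)" for T
    unfolding tavg_def scaleR
    using integral_linear[OF continuous_imp_integrable_0[OF assms(2)] assms(1)] by (simp add: o_def)
  then show ?thesis
    using tendsto[of "\<lambda>T. tavg T g"] assms(3) by (simp add: has_mean_def)
qed

lemma has_mean_cis:
  assumes "\<mu> \<noteq> 0"
  shows "has_mean (\<lambda>t. c * cis (\<mu> * t)) 0"
proof -
  have bound: "norm (tavg T (\<lambda>t. cis (\<mu> * t))) \<le> (2 / \<bar>\<mu>\<bar>) / T" if T: "T > 0" for T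
  proof -
    have "((\<lambda>t. cis (\<mu> * t)) has_integral cis (\<mu> * T) / (\<i> * \<mu>) - cis (\<mu> * 0) / (\<i> * \<mu>)) {0..T}"
    proof (rule fundamental_theorem_of_calculus)
      fix x :: real
      have "((\<lambda>x. exp (\<i> * (of_real \<mu> * x)) / (\<i> * \<mu>)) has_vector_derivative
          exp (\<i> * (of_real \<mu> * of_real x)) * (\<i> * \<mu>) / (\<i> * \<mu>)) (at x within {0..T})"
        using assms
        by (auto intro!: derivative_eq_intros has_vector_derivative_real_field simp: field_simps)
      then show "((\<lambda>x. cis (\<mu> * x) / (\<i> * \<mu>)) has_vector_derivative cis (\<mu> * x)) (at x within {0..T})"
        using assms by (simp add: cis_conv_exp)
    qed (use T in simp)
    then have "tavg T (\<lambda>t. cis (\<mu> * t)) = (1 / T) *\<^sub>R ((cis (\<mu> * T) - 1) / (\<i> * \<mu>))"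
      unfolding tavg_def by (simp add: integral_unique diff_divide_distrib)
    also have "norm \<dots> = norm (cis (\<mu> * T) - 1) / \<bar>\<mu>\<bar> / T"
      using T by (simp add: norm_divide norm_mult)
    also have "\<dots> \<le> 2 / \<bar>\<mu>\<bar> / T"
      using T norm_triangle_ineq4[of "cis (\<mu> * T)" 1] by (intro divide_right_mono) auto
    finally show ?thesis .
  qed
  have "((\<lambda>T. tavg T (\<lambda>t. cis (\<mu> * t))) \<longlongrightarrow> 0) at_top"
  proof (rule Lim_null_comparison)
    show "\<forall>\<^sub>F T in at_top. norm (tavg T (\<lambda>t. cis (\<mu> * t))) \<le> (2 / \<bar>\<mu>\<bar>) / T"
      by (rule eventually_mono[OF eventually_gt_at_top[of 0]]) (rule bound)
    show "((\<lambda>T. (2 / \<bar>\<mu>\<bar>) / T) \<longlongrightarrow> 0) at_top"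
      by (intro tendsto_divide_0[OF tendsto_const] filterlim_at_top_imp_at_infinity filterlim_ident)
  qed
  then have "has_mean (\<lambda>t. cis (\<mu> * t)) 0"
    by (simp add: has_mean_def)
  from has_mean_bounded_linear[OF bounded_linear_mult_right[of c] _ this] show ?thesis
    by (simp add: continuous_intros)
qed

lemma has_mean_zero_approx:
  fixes f :: "real \<Rightarrow> real"
  assumes f: "continuous_on UNIV f"
    and approx: "\<And>e. e > 0 \<Longrightarrow> \<exists>g. continuous_on UNIV g \<and> has_mean g 0 \<and> (\<forall>t. \<bar>f t - g t\<bar> \<le> e)"
  shows "has_mean f 0"
  unfolding has_mean_def
proof (rule tendstoI)
  fix e :: real assume "e > 0"
  then obtain g where g: "continuous_on UNIV g" "has_mean g 0" "\<And>t. \<bar>f t - g t\<bar> \<le> e / 2"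
    using approx[of "e / 2"] by auto
  have "\<forall>\<^sub>F T in at_top. dist (tavg T g) 0 < e / 2"
    using g(2) \<open>e > 0\<close> unfolding has_mean_def by (intro tendstoD) auto
  then show "\<forall>\<^sub>F T in at_top. dist (tavg T f) 0 < e"
    using eventually_gt_at_top[of 0]
  proof eventually_elim
    case (elim T)
    then show ?case
      using abs_tavg_diff_le[OF f g(1,3), of T] unfolding dist_real_def by linarith
  qed
qed

text \<open>A uniform error bounds the error of every time average, so the means of the approximants
  form a Cauchy sequence.\<close>

lemma has_mean_approx:
  fixes f :: "real \<Rightarrow> real"
  assumes f: "continuous_on UNIV f"
    and approx: "\<And>e. e > 0 \<Longrightarrow> \<exists>g L. continuous_on UNIV g \<and> has_mean g L \<and> (\<forall>t. \<bar>f t - g t\<bar> \<le> e)"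
  shows "\<exists>L. has_mean f L"
proof -
  have "\<forall>n. \<exists>g L. continuous_on UNIV g \<and> has_mean g L \<and> (\<forall>t. \<bar>f t - g t\<bar> \<le> 1 / Suc n)"
    by (intro allI approx) simp
  then obtain g L where g: "\<And>n. continuous_on UNIV (g n)" "\<And>n. has_mean (g n) (L n)"
    "\<And>n t. \<bar>f t - g n t\<bar> \<le> 1 / Suc n"
    by metis
  have dist: "\<bar>L m - L n\<bar> \<le> 1 / Suc m + 1 / Suc n" for m n
  proof (rule tendsto_upperbound)
    show "((\<lambda>T. \<bar>tavg T (g m) - tavg T (g n)\<bar>) \<longlongrightarrow> \<bar>L m - L n\<bar>) at_top"
      using g(2) unfolding has_mean_def by (intro tendsto_intros)
    have "\<bar>g m t - g n t\<bar> \<le> 1 / Suc m + 1 / Suc n" for t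
      using g(3)[of t m] g(3)[of t n] by linarith
    then show "\<forall>\<^sub>F T in at_top. \<bar>tavg T (g m) - tavg T (g n)\<bar> \<le> 1 / Suc m + 1 / Suc n"
      by (intro eventually_mono[OF eventually_gt_at_top[of 0]] abs_tavg_diff_le g)
  qed simp
  have "Cauchy L"
  proof (rule CauchyI)
    fix e :: real assume "e > 0"
    then obtain M where M: "1 / Suc M < e / 2"
      using reals_Archimedean[of "e / 2"] by (auto simp: inverse_eq_divide)
    have small: "1 / Suc n < e / 2" if "n \<ge> M" for n
    proof -
      have "1 / Suc n \<le> 1 / Suc M"
        using that by (intro divide_left_mono) auto
      with M show ?thesis by linarith
    qed
    show "\<exists>M. \<forall>m\<ge>M. \<forall>n\<ge>M. norm (L m - L n) < e"
    proof (intro exI[of _ M] allI impI)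
      fix m n assume "m \<ge> M" "n \<ge> M"
      then show "norm (L m - L n) < e"
        using dist[of m n] small[of m] small[of n] by simp
    qed
  qed
  then obtain K where K: "L \<longlonglongrightarrow> K"
    using Cauchy_convergent convergent_def by blast
  have dist_K: "\<bar>L n - K\<bar> \<le> 1 / Suc n" for n
  proof (rule tendsto_le)
    show "(\<lambda>m. \<bar>L n - L m\<bar>) \<longlonglongrightarrow> \<bar>L n - K\<bar>"
      by (intro tendsto_intros K)
    have "(\<lambda>m. 1 / Suc n + 1 / Suc m) \<longlonglongrightarrow> 1 / Suc n + 0"
      by (intro tendsto_intros LIMSEQ_Suc[OF lim_1_over_n])
    then show "(\<lambda>m. 1 / Suc n + 1 / Suc m) \<longlonglongrightarrow> 1 / Suc n"
      by simp
    show "\<forall>\<^sub>F m in sequentially. \<bar>L n - L m\<bar> \<le> 1 / Suc n + 1 / Suc m"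
      using dist by simp
  qed simp
  have "has_mean (\<lambda>t. f t - K) 0"
  proof (rule has_mean_zero_approx)
    fix e :: real assume "e > 0"
    then obtain n where n: "1 / Suc n < e / 2"
      using reals_Archimedean[of "e / 2"] by (auto simp: inverse_eq_divide)
    have "has_mean (\<lambda>t. g n t - L n) (L n - L n)"
      by (intro has_mean_diff has_mean_const g continuous_intros)
    moreover have "\<bar>(f t - K) - (g n t - L n)\<bar> \<le> e" for t
      using g(3)[of t n] dist_K[of n] n by linarith
    ultimately show "\<exists>h. continuous_on UNIV h \<and> has_mean h 0 \<and> (\<forall>t. \<bar>f t - K - h t\<bar> \<le> e)"
      by (intro exI[of _ "\<lambda>t. g n t - L n"]) (auto intro!: continuous_intros g)
  qed (intro continuous_intros f)
  then have "has_mean (\<lambda>t. (f t - K) + K) (0 + K)"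
    by (intro has_mean_add has_mean_const continuous_intros f)
  then show ?thesis by auto
qed

section \<open>Trigonometric polynomials with one prime as an independent variable\<close>

lemma continuous_on_cavg:
  fixes F :: "real \<Rightarrow> complex \<Rightarrow> 'a::euclidean_space"
  assumes "continuous_on (UNIV \<times> circle) (\<lambda>(t, z). F t z)"
  shows "continuous_on UNIV (\<lambda>t. cavg (F t))"
proof -
  have "continuous_on (UNIV \<times> cbox 0 (2 * pi)) (\<lambda>(t, x). F t (cis x))"
  proof -
    have "continuous_on (UNIV \<times> cbox 0 (2 * pi)) (\<lambda>(t::real, x). (t, cis x))"
      unfolding split_beta by (intro continuous_intros)
    from continuous_on_compose2[OF assms this] show ?thesis
      by (force simp: split_beta)
  qed
  from integral_continuous_on_param[OF this] show ?thesis
    unfolding cavg_def by (auto intro!: continuous_intros)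
qed

text \<open>
  Trigonometric polynomials in \<open>t\<close> and \<open>z\<close>, where \<open>z\<close> stands for \<open>p powr (- \<i> * t)\<close>. No frequency
  in \<open>t\<close> involves \<open>ln p\<close>, so that by unique factorization the two variables are independent.
\<close>
inductive split_trig_poly :: "nat \<Rightarrow> (real \<Rightarrow> complex \<Rightarrow> complex) \<Rightarrow> bool" for p where
  monomial: "\<not> p dvd x \<Longrightarrow> \<not> p dvd y \<Longrightarrow>
    split_trig_poly p (\<lambda>t z. c * cis (t * (ln (real x) - ln (real y))) * (z ^ m * cnj z ^ n))"
| add: "split_trig_poly p Y \<Longrightarrow> split_trig_poly p Z \<Longrightarrow> split_trig_poly p (\<lambda>t z. Y t z + Z t z)"

lemma split_trig_poly_const:
  assumes "prime p"
  shows "split_trig_poly p (\<lambda>t z. c)"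
  using split_trig_poly.monomial[of p 1 1 c 0 0] assms by (auto simp: prime_nat_iff)

lemma split_trig_poly_sum:
  assumes "prime p" "\<And>i. i \<in> A \<Longrightarrow> split_trig_poly p (Y i)"
  shows "split_trig_poly p (\<lambda>t z. \<Sum>i\<in>A. Y i t z)"
  using assms(2)
proof (induction A rule: infinite_finite_induct)
  case (insert i A)
  then have "split_trig_poly p (\<lambda>t z. Y i t z + (\<Sum>i\<in>A. Y i t z))"
    by (intro split_trig_poly.add) auto
  then show ?case
    using insert.hyps by simp
qed (simp_all add: split_trig_poly_const[OF assms(1)])

lemma split_trig_poly_mult_monomial:
  assumes p: "prime p" and Z: "split_trig_poly p Z" and xy: "\<not> p dvd x" "\<not> p dvd y"
  shows "split_trig_poly p (\<lambda>t z. (c * cis (t * (ln (real x) - ln (real y))) * (z ^ m * cnj z ^ n)) * Z t z)"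
  using Z
proof induction
  case (monomial x' y' c' m' n')
  have pos: "x > 0" "y > 0" "x' > 0" "y' > 0"
    using xy monomial by (auto intro!: gr0I)
  have dvd: "\<not> p dvd x * x'" "\<not> p dvd y * y'"
    using p xy monomial by (auto simp: prime_dvd_mult_iff)
  have "(c * cis (t * (ln (real x) - ln (real y))) * (z ^ m * cnj z ^ n)) *
      (c' * cis (t * (ln (real x') - ln (real y'))) * (z ^ m' * cnj z ^ n')) =
      (c * c') * cis (t * (ln (real (x * x')) - ln (real (y * y')))) * (z ^ (m + m') * cnj z ^ (n + n'))" for t z
  proof -
    have "cis (t * (ln (real (x * x')) - ln (real (y * y')))) =
        cis (t * (ln (real x) - ln (real y))) * cis (t * (ln (real x') - ln (real y')))"
      using pos by (simp add: ln_mult cis_mult algebra_simps)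
    then show ?thesis
      by (simp only: power_add mult_ac)
  qed
  then show ?case
    using split_trig_poly.monomial[OF dvd, of "c * c'" "m + m'" "n + n'"] by (simp only:)
next
  case (add Y Z)
  from split_trig_poly.add[OF add.IH] show ?case
    by (simp only: distrib_left)
qed

lemma split_trig_poly_mult:
  assumes p: "prime p" and "split_trig_poly p Y" and Z: "split_trig_poly p Z"
  shows "split_trig_poly p (\<lambda>t z. Y t z * Z t z)"
  using assms(2)
proof induction
  case (monomial x y c m n)
  then show ?case
    by (intro split_trig_poly_mult_monomial p Z)
next
  case (add Y Y')
  from split_trig_poly.add[OF add.IH] show ?case
    by (simp only: distrib_right)
qed

lemma split_trig_poly_cnj:
  assumes "split_trig_poly p Y"
  shows "split_trig_poly p (\<lambda>t z. cnj (Y t z))"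
  using assms
proof induction
  case (monomial x y c m n)
  have "cnj (c * cis (t * (ln (real x) - ln (real y))) * (z ^ m * cnj z ^ n)) =
      cnj c * cis (t * (ln (real y) - ln (real x))) * (z ^ n * cnj z ^ m)" for t z
    by (simp add: cis_cnj algebra_simps)
  then show ?case
    using split_trig_poly.monomial[OF monomial(2,1), of "cnj c" n m] by (simp only:)
next
  case (add Y Z)
  from split_trig_poly.add[OF add.IH] show ?case
    by simp
qed

lemma split_trig_poly_real_polynomial_function:
  assumes p: "prime p" and P: "real_polynomial_function (P :: real \<Rightarrow> real)"
    and Y: "split_trig_poly p (\<lambda>t z. of_real (y t z))"
  shows "split_trig_poly p (\<lambda>t z. of_real (P (y t z)))"
  using P
proof induction
  case (linear f)
  then interpret bounded_linear f .
  have lin: "f x = f 1 * x" for x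
    using scaleR[of x 1] by simp
  have "split_trig_poly p (\<lambda>t z. of_real (f 1) * of_real (y t z))"
    by (intro split_trig_poly_mult split_trig_poly_const p Y)
  then show ?case
    by (subst lin) simp
qed (simp_all add: split_trig_poly_const split_trig_poly.add split_trig_poly_mult p)

lemma split_trig_poly_continuous:
  assumes "split_trig_poly p Y"
  shows "continuous_on S (\<lambda>(t, z). Y t z)"
  using assms by induction (auto simp: split_beta intro!: continuous_intros)

lemma split_trig_poly_continuous':
  assumes "split_trig_poly p Y" "continuous_on S f" "continuous_on S g"
  shows "continuous_on S (\<lambda>x. Y (f x) (g x))"
  using continuous_on_compose2[OF split_trig_poly_continuous[OF assms(1), of UNIV], of S "\<lambda>x. (f x, g x)"] assms
  by (auto intro!: continuous_intros)

lemma split_trig_poly_bounded: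
  assumes "split_trig_poly p Y"
  shows "\<exists>B\<ge>0. \<forall>t. \<forall>z\<in>circle. norm (Y t z) \<le> B"
  using assms
proof induction
  case (monomial x y c m n)
  then show ?case
    by (intro exI[of _ "norm c"]) (auto simp: norm_mult norm_power)
next
  case (add Y Z)
  then obtain A B where "A \<ge> 0" "B \<ge> 0" "\<And>t z. z \<in> circle \<Longrightarrow> norm (Y t z) \<le> A" "\<And>t z. z \<in> circle \<Longrightarrow> norm (Z t z) \<le> B"
    by metis
  then show ?case
    by (intro exI[of _ "A + B"]) (auto intro!: norm_triangle_le add_mono)
qed

text \<open>For a monomial with \<open>m = n\<close>, substitution and circle average agree at every
  \<open>t\<close>. Otherwise the average is 0, and the mean is 0 as well because the frequency
  after substitution is nonzero.\<close>

lemma split_trig_poly_means: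
  assumes p: "prime p" and "split_trig_poly p Y"
  shows "(\<exists>L. has_mean (\<lambda>t. Y t (cis (- (t * ln p)))) L) \<and>
    has_mean (\<lambda>t. Y t (cis (- (t * ln p))) - cavg (Y t)) 0"
  using assms(2)
proof induction
  case (monomial x y c m n)
  have pos: "x > 0" "y > 0" "p > 0"
    using monomial p by (auto intro!: gr0I)
  define \<mu> where "\<mu> = ln (real x) - ln (real y) - (real m - real n) * ln (real p)"
  have eq: "c * cis (t * (ln (real x) - ln (real y))) *
      (cis (- (t * ln p)) ^ m * cnj (cis (- (t * ln p))) ^ n) = c * cis (\<mu> * t)" for t
  proof -
    have "cis (- (t * ln p)) ^ m * cnj (cis (- (t * ln p))) ^ n =
        cis (real m * - (t * ln p)) * cis (real n * (t * ln p))"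
      by (simp add: cis_cnj Complex.DeMoivre)
    then show ?thesis
      by (simp add: cis_mult mult.assoc \<mu>_def algebra_simps)
  qed
  have cavg: "cavg (\<lambda>z. c * cis (t * (ln (real x) - ln (real y))) * (z ^ m * cnj z ^ n)) =
      (if m = n then c * cis (t * (ln (real x) - ln (real y))) else 0)" for t
    by (simp add: cavg_cmult cavg_monomials)
  \<comment> \<open>A zero frequency would mean \<open>x * p ^ n = y * p ^ m\<close> with
    \<open>p\<close> dividing neither \<open>x\<close> nor \<open>y\<close>; comparing
    multiplicities of \<open>p\<close> excludes this.\<close>
  have "\<mu> \<noteq> 0" if "m \<noteq> n"
  proof
    assume "\<mu> = 0"
    then have "ln (real x) + real n * ln (real p) = ln (real y) + real m * ln (real p)"
      by (simp add: \<mu>_def algebra_simps)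
    then have "ln (real (x * p ^ n)) = ln (real (y * p ^ m))"
      using pos by (simp add: ln_mult ln_realpow)
    then have "real (x * p ^ n) = real (y * p ^ m)"
      using pos by (subst (asm) ln_inj_iff) auto
    then have "x * p ^ n = y * p ^ m"
      by (simp only: of_nat_eq_iff)
    then have "multiplicity p (x * p ^ n) = multiplicity p (y * p ^ m)"
      by simp
    then show False
      using that p pos monomial
      by (simp add: prime_elem_multiplicity_mult_distrib not_dvd_imp_multiplicity_0 multiplicity_same_power)
  qed
  then have "has_mean (\<lambda>t. c * cis (\<mu> * t)) 0" if "m \<noteq> n"
    using has_mean_cis that by blast
  moreover have "\<exists>L. has_mean (\<lambda>t. c * cis (\<mu> * t)) L"
    using has_mean_cis[of \<mu> c] has_mean_const[of c] by (cases "\<mu> = 0") auto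
  moreover have "c * cis (\<mu> * t) = c * cis (t * (ln (real x) - ln (real y)))" if "m = n" for t
    using that by (simp add: \<mu>_def mult.commute)
  ultimately show ?case
    unfolding eq cavg using has_mean_const[of 0] by (cases "m = n") (simp_all only: if_True if_False diff_self diff_zero simp_thms)
next
  case (add Y Z)
  let ?z = "\<lambda>t. cis (- (t * ln p))"
  have cont: "continuous_on UNIV (\<lambda>t. V t (?z t))" "continuous_on UNIV (\<lambda>t. cavg (V t))"
    "continuous_on circle (V t)" if "split_trig_poly p V" for V t
    using that
    by (auto intro!: split_trig_poly_continuous'[OF that] continuous_on_cavg continuous_intros split_trig_poly_continuous)
  obtain L M where LM: "has_mean (\<lambda>t. Y t (?z t)) L" "has_mean (\<lambda>t. Z t (?z t)) M"
    using add.IH by blast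
  have "has_mean (\<lambda>t. Y t (?z t) + Z t (?z t)) (L + M)"
    by (intro has_mean_add LM cont add.hyps)
  moreover have "has_mean (\<lambda>t. (Y t (?z t) - cavg (Y t)) + (Z t (?z t) - cavg (Z t))) (0 + 0)"
    using add.IH by (intro has_mean_add continuous_intros cont add.hyps) auto
  moreover have "(Y t (?z t) - cavg (Y t)) + (Z t (?z t) - cavg (Z t)) =
      Y t (?z t) + Z t (?z t) - cavg (\<lambda>z. Y t z + Z t z)" for t
    by (simp add: cavg_add cont add.hyps)
  ultimately show ?case by auto
qed

text \<open>The square of \<open>norm F\<close> is \<open>F * cnj F\<close> and stays in the class.
  So does a polynomial in it, chosen close to \<open>x powr (q / 2)\<close> on its bounded
  range.\<close>

lemma power_mean_approximation:
  assumes p: "prime p" and F: "split_trig_poly p F" and q: "0 < q" and e: "0 < e"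
  obtains y where "split_trig_poly p (\<lambda>t z. of_real (y t z))"
    "\<And>t z. z \<in> circle \<Longrightarrow> \<bar>norm (F t z) powr q - y t z\<bar> \<le> e"
proof -
  obtain B where B: "B \<ge> 0" "\<And>t z. z \<in> circle \<Longrightarrow> norm (F t z) \<le> B"
    using split_trig_poly_bounded[OF F] by blast
  obtain P where P: "real_polynomial_function P" "\<And>x. x \<in> {0..B\<^sup>2} \<Longrightarrow> \<bar>x powr (q / 2) - P x\<bar> < e"
  proof (rule Stone_Weierstrass_real_polynomial_function[of "{0..B\<^sup>2}" "\<lambda>x. x powr (q / 2)" e])
    show "continuous_on {0..B\<^sup>2} (\<lambda>x. x powr (q / 2))"
      by (intro continuous_on_powr' continuous_on_id continuous_on_const) (use q in auto)
  qed (use e that in auto)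
  have "split_trig_poly p (\<lambda>t z. of_real ((norm (F t z))\<^sup>2))"
    unfolding complex_norm_square by (intro split_trig_poly_mult split_trig_poly_cnj p F)
  then have "split_trig_poly p (\<lambda>t z. of_real (P ((norm (F t z))\<^sup>2)))"
    by (rule split_trig_poly_real_polynomial_function[OF p P(1)])
  moreover have "\<bar>norm (F t z) powr q - P ((norm (F t z))\<^sup>2)\<bar> \<le> e" if "z \<in> circle" for t z
  proof -
    have "(norm (F t z))\<^sup>2 powr (q / 2) = norm (F t z) powr q"
      by (simp add: powr_powr flip: powr_numeral)
    moreover have "(norm (F t z))\<^sup>2 \<in> {0..B\<^sup>2}"
      using B(2)[OF that] by (auto intro!: power_mono)
    ultimately show ?thesis
      using P(2)[of "(norm (F t z))\<^sup>2"] by simp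
  qed
  ultimately show ?thesis
    by (rule that)
qed

lemma power_mean_exists:
  assumes p: "prime p" and F: "split_trig_poly p F" and q: "0 < q"
  shows "\<exists>L. has_mean (\<lambda>t. norm (F t (cis (- (t * ln p)))) powr q) L"
proof (rule has_mean_approx)
  let ?z = "\<lambda>t. cis (- (t * ln p))"
  show "continuous_on UNIV (\<lambda>t. norm (F t (?z t)) powr q)"
    by (intro continuous_on_powr' continuous_intros split_trig_poly_continuous'[OF F]) (use q in auto)
  fix e :: real assume "e > 0"
  then obtain y where y: "split_trig_poly p (\<lambda>t z. of_real (y t z))"
    "\<And>t z. z \<in> circle \<Longrightarrow> \<bar>norm (F t z) powr q - y t z\<bar> \<le> e"
    using power_mean_approximation[OF p F q] by blast
  obtain L where L: "has_mean (\<lambda>t. complex_of_real (y t (?z t))) L"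
    using split_trig_poly_means[OF p y(1)] by blast
  have cont: "continuous_on UNIV (\<lambda>t. complex_of_real (y t (?z t)))"
    by (rule split_trig_poly_continuous'[OF y(1)]) (intro continuous_intros)+
  have "continuous_on UNIV (\<lambda>t. Re (of_real (y t (?z t))))"
    by (intro continuous_on_Re cont)
  moreover have "has_mean (\<lambda>t. Re (of_real (y t (?z t)))) (Re L)"
    by (rule has_mean_bounded_linear[OF bounded_linear_Re cont L])
  ultimately show "\<exists>g L. continuous_on UNIV g \<and> has_mean g L \<and> (\<forall>t. \<bar>norm (F t (?z t)) powr q - g t\<bar> \<le> e)"
    using y(2) by (intro exI[of _ "\<lambda>t. y t (?z t)"] exI[of _ "Re L"]) simp
qed

text \<open>Bohr's correspondence for a single prime. In the form of a difference with mean 0 it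
  needs no integral over the remaining variables.\<close>

lemma power_mean_iterated:
  assumes p: "prime p" and F: "split_trig_poly p F" and q: "0 < q"
  shows "has_mean (\<lambda>t. norm (F t (cis (- (t * ln p)))) powr q - cavg (\<lambda>z. norm (F t z) powr q)) 0"
proof (rule has_mean_zero_approx)
  let ?z = "\<lambda>t. cis (- (t * ln p))"
  have contq: "continuous_on S (\<lambda>x. norm (F (f x) (g x)) powr q)"
    if "continuous_on S f" "continuous_on S g" for S and f :: "'z::topological_space \<Rightarrow> real" and g
    by (intro continuous_on_powr' continuous_intros split_trig_poly_continuous'[OF F] that) (use q in auto)
  show "continuous_on UNIV (\<lambda>t. norm (F t (?z t)) powr q - cavg (\<lambda>z. norm (F t z) powr q))"
    by (intro continuous_on_diff contq continuous_on_cavg) (auto simp: split_beta intro!: continuous_intros contq)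
  fix e :: real assume "e > 0"
  then obtain y where y: "split_trig_poly p (\<lambda>t z. of_real (y t z))"
    "\<And>t z. z \<in> circle \<Longrightarrow> \<bar>norm (F t z) powr q - y t z\<bar> \<le> e / 2"
    using power_mean_approximation[OF p F q, of "e / 2"] by auto
  have conty: "continuous_on S (\<lambda>x. y (f x) (g x))"
    if "continuous_on S f" "continuous_on S g" for S and f :: "'z::topological_space \<Rightarrow> real" and g
    using continuous_on_Re[OF split_trig_poly_continuous'[OF y(1) that]] by simp
  have cavg_y: "cavg (\<lambda>z. complex_of_real (y t z)) = of_real (cavg (y t))" for t
    by (rule cavg_of_real) (intro conty continuous_intros)
  have m: "has_mean (\<lambda>t. complex_of_real (y t (?z t)) - cavg (\<lambda>z. complex_of_real (y t z))) 0"
    using split_trig_poly_means[OF p y(1)] by blast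
  have cont_cy: "continuous_on UNIV (\<lambda>t. cavg (y t))"
    by (rule continuous_on_cavg) (auto simp: split_beta intro!: conty continuous_intros)
  have cont: "continuous_on UNIV (\<lambda>t. y t (?z t) - cavg (y t))"
    by (intro continuous_on_diff conty cont_cy continuous_intros)
  have "continuous_on UNIV (\<lambda>t. complex_of_real (y t (?z t)) - cavg (\<lambda>z. complex_of_real (y t z)))"
    unfolding cavg_y of_real_diff[symmetric] by (intro continuous_on_of_real cont)
  from has_mean_bounded_linear[OF bounded_linear_Re this m]
  have "has_mean (\<lambda>t. y t (?z t) - cavg (y t)) 0"
    unfolding cavg_y by simp
  moreover have "\<bar>norm (F t (?z t)) powr q - cavg (\<lambda>z. norm (F t z) powr q) - (y t (?z t) - cavg (y t))\<bar> \<le> e" for t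
  proof -
    have "\<bar>cavg (\<lambda>z. norm (F t z) powr q - y t z)\<bar> \<le> e / 2"
    proof -
      have "continuous_on circle (\<lambda>z. norm (F t z) powr q - y t z)"
        by (intro continuous_on_diff conty contq continuous_on_const continuous_on_id)
      from norm_cavg_le[OF this, of "e / 2"] y(2) show ?thesis
        by simp
    qed
    also have "cavg (\<lambda>z. norm (F t z) powr q - y t z) = cavg (\<lambda>z. norm (F t z) powr q) - cavg (y t)"
      by (rule cavg_diff) (intro conty contq continuous_intros)+
    finally have "\<bar>cavg (\<lambda>z. norm (F t z) powr q) - cavg (y t)\<bar> \<le> e / 2" .
    moreover have "\<bar>norm (F t (?z t)) powr q - y t (?z t)\<bar> \<le> e / 2"
      by (rule y(2)) simp
    ultimately show ?thesis
      by linarith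
  qed
  ultimately show "\<exists>g. continuous_on UNIV g \<and> has_mean g 0 \<and>
      (\<forall>t. \<bar>norm (F t (?z t)) powr q - cavg (\<lambda>z. norm (F t z) powr q) - g t\<bar> \<le> e)"
    using cont by blast
qed

section \<open>Minkowski's inequality\<close>

text \<open>Bernoulli's inequality at \<open>y i / m\<close> is the tangent line bound for the power
  at the mean \<open>m\<close>, and the linear terms average out. Bernoulli's inequality itself is
  Young's inequality with second factor 1.\<close>

lemma jensen_powr:
  fixes w y :: "'i \<Rightarrow> real"
  assumes "finite I" "\<And>i. i \<in> I \<Longrightarrow> 0 \<le> w i" "sum w I = 1" "\<And>i. i \<in> I \<Longrightarrow> 0 \<le> y i" and P: "1 \<le> P"
  shows "(\<Sum>i\<in>I. w i * y i) powr P \<le> (\<Sum>i\<in>I. w i * y i powr P)"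
proof -
  define m where "m = (\<Sum>i\<in>I. w i * y i)"
  have m: "m \<ge> 0"
    unfolding m_def using assms by (intro sum_nonneg) auto
  have bernoulli: "1 + P * (x - 1) \<le> x powr P" if x: "x \<ge> 0" for x :: real
  proof (cases "P = 1")
    case False
    then have P1: "P > 1"
      using P by simp
    have "x * 1 \<le> x powr P / P + 1 powr (P / (P - 1)) / (P / (P - 1))"
      using P1 x by (intro Youngs_inequality) (auto simp: field_simps)
    then have "P * (x * 1) \<le> P * (x powr P / P + 1 powr (P / (P - 1)) / (P / (P - 1)))"
      using P1 by (intro mult_left_mono) auto
    also have "\<dots> = x powr P + (P - 1)"
      using P1 by (simp add: distrib_left)
    finally show ?thesis
      by (simp add: algebra_simps)
  qed (use x in auto)
  show ?thesis
  proof (cases "m = 0")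
    case True
    have "0 \<le> (\<Sum>i\<in>I. w i * y i powr P)"
      using assms by (intro sum_nonneg) auto
    with True show ?thesis
      by (simp add: m_def)
  next
    case False
    with m have m: "m > 0" by simp
    have "m powr P = m powr P * (\<Sum>i\<in>I. w i * (1 + P * (y i / m - 1)))"
    proof -
      have "(\<Sum>i\<in>I. w i * (1 + P * (y i / m - 1))) = (\<Sum>i\<in>I. (1 - P) * w i + (P / m) * (w i * y i))"
        by (intro sum.cong refl) (simp add: algebra_simps)
      also have "\<dots> = (1 - P) * sum w I + (P / m) * m"
        by (simp only: sum.distrib sum_distrib_left m_def)
      also have "\<dots> = 1"
        using m assms(3) by simp
      finally show ?thesis by simp
    qed
    also have "\<dots> \<le> m powr P * (\<Sum>i\<in>I. w i * (y i / m) powr P)"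
      using assms m by (intro mult_left_mono sum_mono bernoulli) auto
    also have "\<dots> = (\<Sum>i\<in>I. w i * y i powr P)"
      unfolding sum_distrib_left using assms(4) m
      by (intro sum.cong refl) (simp add: powr_divide)
    finally show ?thesis
      by (simp add: m_def)
  qed
qed

lemma jensen_powr_concave:
  fixes w y :: "'i \<Rightarrow> real"
  assumes "finite I" "\<And>i. i \<in> I \<Longrightarrow> 0 \<le> w i" "sum w I = 1" "\<And>i. i \<in> I \<Longrightarrow> 0 \<le> y i"
    and P: "0 < P" "P \<le> 1"
  shows "(\<Sum>i\<in>I. w i * y i powr P) \<le> (\<Sum>i\<in>I. w i * y i) powr P"
proof -
  have nonneg: "0 \<le> (\<Sum>i\<in>I. w i * y i powr P)"
    using assms by (intro sum_nonneg) auto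
  have "(\<Sum>i\<in>I. w i * y i powr P) powr (1 / P) \<le> (\<Sum>i\<in>I. w i * (y i powr P) powr (1 / P))"
    by (rule jensen_powr) (use assms in auto)
  also have "\<dots> = (\<Sum>i\<in>I. w i * y i)"
    using P assms(4) by (intro sum.cong refl) (simp add: powr_powr)
  finally have "((\<Sum>i\<in>I. w i * y i powr P) powr (1 / P)) powr P \<le> (\<Sum>i\<in>I. w i * y i) powr P"
    using P by (intro powr_mono2) auto
  then show ?thesis
    using P nonneg by (simp add: powr_powr)
qed

context
  fixes J :: "'j set" and g :: "'j \<Rightarrow> real \<Rightarrow> real" and P T :: real
  assumes J: "finite J" and cont: "\<And>j. continuous_on UNIV (g j)" and nonneg: "\<And>j t. 0 \<le> g j t"
    and P: "0 < P" and T: "0 < T"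
begin

private definition "a j = tavg T (\<lambda>t. g j t powr P) powr (1 / P)"

text \<open>Only functions of positive norm can be normalized. The others vanish on
  \<open>{0..T}\<close>, which the upper bound uses; for the lower bound they are simply dropped by
  monotonicity.\<close>

private definition "I = {j \<in> J. a j > 0}"

private definition "A = (\<Sum>j\<in>J. a j)"

private lemma cont_powr: "continuous_on UNIV (\<lambda>t. g j t powr P)"
  by (intro continuous_on_powr' cont continuous_on_const) (use nonneg P in auto)

private lemma cont_sum_powr: "continuous_on UNIV (\<lambda>t. (\<Sum>j\<in>K. g j t) powr P)"
  by (intro continuous_on_powr' continuous_on_sum cont continuous_on_const)
     (use nonneg P in \<open>auto intro: sum_nonneg\<close>)

private lemma a_nonneg: "0 \<le> a j"
  by (simp add: a_def)

private lemma a_powr: "a j powr P = tavg T (\<lambda>t. g j t powr P)"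
  using P tavg_nonneg[OF cont_powr _ T, of j] by (simp add: a_def powr_powr)

private lemma finite_I: "finite I"
  using J by (simp add: I_def)

private lemma A_eq: "A = (\<Sum>j\<in>I. a j)"
  unfolding A_def I_def using a_nonneg J
  by (intro sum.mono_neutral_right) (auto simp: less_le)

text \<open>The sum is \<open>A\<close> times a convex combination of functions whose
  \<open>P\<close>-th powers have average 1. Pointwise Jensen then gives Minkowski in either
  direction, as the average of the combined powers is exactly \<open>A powr P\<close>.\<close>

private lemma weights:
  assumes "A > 0"
  shows "(\<Sum>j\<in>I. a j / A) = 1" "(\<Sum>j\<in>I. g j t) = A * (\<Sum>j\<in>I. a j / A * (g j t / a j))"
    "tavg T (\<lambda>t. A powr P * (\<Sum>j\<in>I. a j / A * (g j t / a j) powr P)) = A powr P"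
proof -
  show 1: "(\<Sum>j\<in>I. a j / A) = 1"
    using assms by (simp add: A_eq flip: sum_divide_distrib)
  show "(\<Sum>j\<in>I. g j t) = A * (\<Sum>j\<in>I. a j / A * (g j t / a j))"
    unfolding sum_distrib_left using assms by (intro sum.cong refl) (simp add: I_def)
  have "tavg T (\<lambda>t. (g j t / a j) powr P) = 1" if "j \<in> I" for j
  proof -
    have pos: "a j > 0"
      using that by (simp add: I_def)
    have "tavg T (\<lambda>t. (g j t / a j) powr P) = tavg T (\<lambda>t. (1 / a j powr P) * g j t powr P)"
      using pos nonneg by (simp add: powr_divide)
    also have "\<dots> = 1"
      unfolding tavg_cmult a_powr[symmetric] using pos by simp
    finally show ?thesis .
  qed
  then have "(\<Sum>j\<in>I. a j / A * tavg T (\<lambda>t. (g j t / a j) powr P)) = 1"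
    using 1 by simp
  moreover have "continuous_on UNIV (\<lambda>t. a j / A * (g j t / a j) powr P)" if "j \<in> I" for j
    by (intro continuous_on_mult continuous_on_powr' continuous_on_divide cont continuous_on_const)
       (use that nonneg P in \<open>auto simp: I_def\<close>)
  ultimately show "tavg T (\<lambda>t. A powr P * (\<Sum>j\<in>I. a j / A * (g j t / a j) powr P)) = A powr P"
    unfolding tavg_cmult by (subst tavg_sum) (simp_all only: finite_I tavg_cmult mult_1_right)
qed

private lemma cont_weights: "continuous_on UNIV (\<lambda>t. A powr P * (\<Sum>j\<in>I. a j / A * (g j t / a j) powr P))"
  by (intro continuous_on_mult continuous_on_sum continuous_on_powr' continuous_on_divide cont continuous_on_const)
     (use nonneg P in \<open>auto simp: I_def\<close>)

lemma minkowski_tavg_upper: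
  assumes P1: "1 \<le> P"
  shows "tavg T (\<lambda>t. (\<Sum>j\<in>J. g j t) powr P) \<le> (\<Sum>j\<in>J. tavg T (\<lambda>t. g j t powr P) powr (1 / P)) powr P"
proof -
  have zero: "g j t = 0" if "j \<in> J - I" "t \<in> {0..T}" for j t
  proof -
    have "a j = 0"
      using that a_nonneg[of j] by (auto simp: I_def)
    then have "tavg T (\<lambda>t. g j t powr P) = 0"
      using P a_powr[of j] by simp
    then have "integral {0..T} (\<lambda>t. g j t powr P) = 0"
      using T by (simp add: tavg_def)
    moreover have "continuous_on {0..T} (\<lambda>t. g j t powr P)"
      by (rule continuous_on_subset[OF cont_powr]) auto
    ultimately have "\<forall>t\<in>{0..T}. g j t powr P = 0"
      using integral_eq_0_iff[of 0 T "\<lambda>t. g j t powr P"] T by simp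
    then show ?thesis
      using that by simp
  qed
  have sum_I: "(\<Sum>j\<in>J. g j t) = (\<Sum>j\<in>I. g j t)" if "t \<in> {0..T}" for t
    using J zero[OF _ that] by (intro sum.mono_neutral_right) (auto simp: I_def)
  have "tavg T (\<lambda>t. (\<Sum>j\<in>J. g j t) powr P) \<le> A powr P"
  proof (cases "A > 0")
    case True
    have "tavg T (\<lambda>t. (\<Sum>j\<in>J. g j t) powr P) \<le>
        tavg T (\<lambda>t. A powr P * (\<Sum>j\<in>I. a j / A * (g j t / a j) powr P))"
    proof (rule tavg_mono[OF cont_sum_powr cont_weights _ T])
      fix t assume t: "t \<in> {0..T}"
      have "(\<Sum>j\<in>J. g j t) powr P = A powr P * (\<Sum>j\<in>I. a j / A * (g j t / a j)) powr P"
        unfolding sum_I[OF t] weights(2)[OF True] using True nonneg a_nonneg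
        by (intro powr_mult)
      also have "\<dots> \<le> A powr P * (\<Sum>j\<in>I. a j / A * (g j t / a j) powr P)"
        using True nonneg a_nonneg weights(1)[OF True]
        by (intro mult_left_mono jensen_powr finite_I P1) auto
      finally show "(\<Sum>j\<in>J. g j t) powr P \<le> A powr P * (\<Sum>j\<in>I. a j / A * (g j t / a j) powr P)" .
    qed
    then show ?thesis
      unfolding weights(3)[OF True] .
  next
    case False
    have "A \<ge> 0"
      unfolding A_def by (intro sum_nonneg a_nonneg)
    with False have "A = 0" by simp
    then have "I = {}"
      using finite_I a_nonneg unfolding A_eq by (subst (asm) sum_nonneg_eq_0_iff) (auto simp: I_def)
    then have "tavg T (\<lambda>t. (\<Sum>j\<in>J. g j t) powr P) \<le> tavg T (\<lambda>t. 0)"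
      using sum_I by (intro tavg_mono cont_sum_powr T continuous_on_const) auto
    then show ?thesis
      using T by (simp add: tavg_const \<open>A = 0\<close>)
  qed
  then show ?thesis
    by (simp add: A_def a_def)
qed

lemma minkowski_tavg_lower:
  assumes P1: "P \<le> 1"
  shows "(\<Sum>j\<in>J. tavg T (\<lambda>t. g j t powr P) powr (1 / P)) powr P \<le> tavg T (\<lambda>t. (\<Sum>j\<in>J. g j t) powr P)"
proof -
  have "A powr P \<le> tavg T (\<lambda>t. (\<Sum>j\<in>J. g j t) powr P)"
  proof (cases "A > 0")
    case True
    have "tavg T (\<lambda>t. A powr P * (\<Sum>j\<in>I. a j / A * (g j t / a j) powr P)) \<le>
        tavg T (\<lambda>t. (\<Sum>j\<in>J. g j t) powr P)"
    proof (rule tavg_mono[OF cont_weights cont_sum_powr _ T])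
      fix t assume t: "t \<in> {0..T}"
      have "A powr P * (\<Sum>j\<in>I. a j / A * (g j t / a j) powr P) \<le> A powr P * (\<Sum>j\<in>I. a j / A * (g j t / a j)) powr P"
        using True nonneg a_nonneg weights(1)[OF True]
        by (intro mult_left_mono jensen_powr_concave finite_I P P1) auto
      also have "\<dots> = (\<Sum>j\<in>I. g j t) powr P"
        unfolding weights(2)[OF True] using True nonneg a_nonneg
        by (intro powr_mult[symmetric])
      also have "\<dots> \<le> (\<Sum>j\<in>J. g j t) powr P"
        using P J nonneg by (intro powr_mono2 sum_mono2 sum_nonneg) (auto simp: I_def)
      finally show "A powr P * (\<Sum>j\<in>I. a j / A * (g j t / a j) powr P) \<le> (\<Sum>j\<in>J. g j t) powr P" .
    qed
    then show ?thesis
      unfolding weights(3)[OF True] .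
  next
    case False
    have "A \<ge> 0"
      unfolding A_def by (intro sum_nonneg a_nonneg)
    with False have "A = 0" by simp
    moreover have "0 \<le> tavg T (\<lambda>t. (\<Sum>j\<in>J. g j t) powr P)"
      by (rule tavg_nonneg[OF cont_sum_powr _ T]) simp
    ultimately show ?thesis
      by simp
  qed
  then show ?thesis
    by (simp add: A_def a_def)
qed

end

section \<open>Interchange of mixed norms in the limit of long averages\<close>

lemma has_mean_nonneg:
  fixes f :: "real \<Rightarrow> real"
  assumes "continuous_on UNIV f" "\<And>t. 0 \<le> f t" "has_mean f L"
  shows "0 \<le> L"
  using assms(3) unfolding has_mean_def
  by (rule tendsto_lowerbound)
     (auto intro!: eventually_mono[OF eventually_gt_at_top[of 0]] tavg_nonneg assms)

context
  fixes J :: "'j set" and b :: "'j \<Rightarrow> real \<Rightarrow> complex" and v L :: "'j \<Rightarrow> real" and q M :: real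
    and h :: "real \<Rightarrow> real"
  assumes J: "finite J" and b: "\<And>j. continuous_on UNIV (b j)" and v: "\<And>j. 0 \<le> v j"
    and q: "0 < q" and L: "\<And>j. has_mean (\<lambda>t. norm (b j t) powr q) (L j)"
    and h: "continuous_on UNIV h" "\<And>t. 0 \<le> h t" "has_mean h M"
begin

private lemma cont_b: "continuous_on UNIV (\<lambda>t. v j * (norm (b j t))\<^sup>2)"
  by (intro continuous_intros b)

private lemma cont_sum_b: "continuous_on UNIV (\<lambda>t. (\<Sum>j\<in>J. v j * (norm (b j t))\<^sup>2) powr (q / 2))"
  by (intro continuous_on_powr' continuous_on_sum cont_b continuous_on_const)
     (use v q in \<open>auto intro: sum_nonneg\<close>)

private lemma cont_norm_b: "continuous_on UNIV (\<lambda>t. norm (b j t) powr q)"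
  by (rule continuous_on_norm_powr) (use b q in auto)

private lemma M_nonneg: "0 \<le> M"
  by (rule has_mean_nonneg[OF h])

private lemma tavg_b:
  assumes "T > 0"
  shows "tavg T (\<lambda>t. (v j * (norm (b j t))\<^sup>2) powr (q / 2)) powr (1 / (q / 2)) =
    v j * tavg T (\<lambda>t. norm (b j t) powr q) powr (2 / q)"
proof -
  have "(v j * (norm (b j t))\<^sup>2) powr (q / 2) = v j powr (q / 2) * norm (b j t) powr q" for t
  proof -
    have "((norm (b j t))\<^sup>2) powr (q / 2) = norm (b j t) powr q"
      by (simp add: powr_powr flip: powr_numeral)
    then show ?thesis
      using v by (simp add: powr_mult)
  qed
  then have "tavg T (\<lambda>t. (v j * (norm (b j t))\<^sup>2) powr (q / 2)) = v j powr (q / 2) * tavg T (\<lambda>t. norm (b j t) powr q)"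
    by (simp add: tavg_cmult)
  moreover have "0 \<le> tavg T (\<lambda>t. norm (b j t) powr q)"
    by (rule tavg_nonneg[OF cont_norm_b _ assms]) simp
  ultimately show ?thesis
    using q v by (simp add: powr_mult powr_powr)
qed

private lemma tendsto_mixed:
  "((\<lambda>T. (\<Sum>j\<in>J. v j * tavg T (\<lambda>t. norm (b j t) powr q) powr (2 / q)) powr (q / 2)) \<longlongrightarrow>
    (\<Sum>j\<in>J. v j * L j powr (2 / q)) powr (q / 2)) at_top"
proof -
  have ev: "\<forall>\<^sub>F T in at_top. 0 \<le> tavg T (\<lambda>t. norm (b j t) powr q)" for j
    by (rule eventually_mono[OF eventually_gt_at_top[of 0]]) (rule tavg_nonneg[OF cont_norm_b], auto)
  show ?thesis
    by (intro tendsto_powr' tendsto_sum tendsto_mult tendsto_const L[unfolded has_mean_def])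
       (use q ev v in \<open>auto intro!: sum_nonneg always_eventually\<close>)
qed

text \<open>Minkowski with exponent \<open>q / 2 \<le> 1\<close> for the functions
  \<open>v j * (norm (b j t))\<^sup>2\<close>, at finite \<open>T\<close> first because a mean is
  only a limit of integrals. It bounds the weighted square sum of the norms of the
  \<open>b j\<close> by the norm of their square function, which \<open>h\<close> dominates.\<close>

lemma mean_minkowski_lower:
  assumes q2: "q \<le> 2" and le: "\<And>t. (\<Sum>j\<in>J. v j * (norm (b j t))\<^sup>2) powr (q / 2) \<le> h t"
  shows "(\<Sum>j\<in>J. v j * L j powr (2 / q)) \<le> M powr (2 / q)"
proof -
  have "(\<Sum>j\<in>J. v j * L j powr (2 / q)) powr (q / 2) \<le> M"
  proof (rule tendsto_le[OF _ _ tendsto_mixed])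
    show "((\<lambda>T. tavg T h) \<longlongrightarrow> M) at_top"
      using h(3) by (simp add: has_mean_def)
    show "\<forall>\<^sub>F T in at_top. (\<Sum>j\<in>J. v j * tavg T (\<lambda>t. norm (b j t) powr q) powr (2 / q)) powr (q / 2) \<le> tavg T h"
    proof (rule eventually_mono[OF eventually_gt_at_top[of 0]])
      fix T :: real assume T: "0 < T"
      have "(\<Sum>j\<in>J. v j * tavg T (\<lambda>t. norm (b j t) powr q) powr (2 / q)) powr (q / 2) \<le>
          tavg T (\<lambda>t. (\<Sum>j\<in>J. v j * (norm (b j t))\<^sup>2) powr (q / 2))"
        unfolding tavg_b[OF T, symmetric]
        by (rule minkowski_tavg_lower) (use J cont_b v q q2 T in auto)
      also have "\<dots> \<le> tavg T h"
        by (rule tavg_mono[OF cont_sum_b h(1) le T])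
      finally show "(\<Sum>j\<in>J. v j * tavg T (\<lambda>t. norm (b j t) powr q) powr (2 / q)) powr (q / 2) \<le> tavg T h" .
    qed
  qed simp
  then have "((\<Sum>j\<in>J. v j * L j powr (2 / q)) powr (q / 2)) powr (2 / q) \<le> M powr (2 / q)"
    using q by (intro powr_mono2) auto
  then show ?thesis
    using q v by (simp add: powr_powr sum_nonneg)
qed

lemma mean_minkowski_upper:
  assumes q2: "2 \<le> q" and le: "\<And>t. h t \<le> (\<Sum>j\<in>J. v j * (norm (b j t))\<^sup>2) powr (q / 2)"
  shows "M powr (2 / q) \<le> (\<Sum>j\<in>J. v j * L j powr (2 / q))"
proof -
  have "M \<le> (\<Sum>j\<in>J. v j * L j powr (2 / q)) powr (q / 2)"
  proof (rule tendsto_le[OF _ tendsto_mixed])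
    show "((\<lambda>T. tavg T h) \<longlongrightarrow> M) at_top"
      using h(3) by (simp add: has_mean_def)
    show "\<forall>\<^sub>F T in at_top. tavg T h \<le> (\<Sum>j\<in>J. v j * tavg T (\<lambda>t. norm (b j t) powr q) powr (2 / q)) powr (q / 2)"
    proof (rule eventually_mono[OF eventually_gt_at_top[of 0]])
      fix T :: real assume T: "0 < T"
      have "tavg T h \<le> tavg T (\<lambda>t. (\<Sum>j\<in>J. v j * (norm (b j t))\<^sup>2) powr (q / 2))"
        by (rule tavg_mono[OF h(1) cont_sum_b le T])
      also have "\<dots> \<le> (\<Sum>j\<in>J. v j * tavg T (\<lambda>t. norm (b j t) powr q) powr (2 / q)) powr (q / 2)"
        unfolding tavg_b[OF T, symmetric]
        by (rule minkowski_tavg_upper) (use J cont_b v q q2 T in auto)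
      finally show "tavg T h \<le> (\<Sum>j\<in>J. v j * tavg T (\<lambda>t. norm (b j t) powr q) powr (2 / q)) powr (q / 2)" .
    qed
  qed simp
  then have "M powr (2 / q) \<le> ((\<Sum>j\<in>J. v j * L j powr (2 / q)) powr (q / 2)) powr (2 / q)"
    using q M_nonneg by (intro powr_mono2) auto
  then show ?thesis
    using q v by (simp add: powr_powr sum_nonneg)
qed

end

section \<open>The arithmetic weights\<close>

definition factor_lists :: "nat \<Rightarrow> nat \<Rightarrow> nat list set" where
  "factor_lists k n = {xs. length xs = k \<and> (\<forall>x\<in>set xs. x > 0) \<and> prod_list xs = n}"

lemma divisor_fun_eq_card: "divisor_fun k n = card (factor_lists k n)"
  by (simp add: divisor_fun_def factor_lists_def)

lemma factor_lists_Suc: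
  assumes "n > 0"
  shows "factor_lists (Suc k) n = (\<Union>d\<in>{d. d dvd n}. (#) d ` factor_lists k (n div d))"
proof (intro equalityI subsetI)
  fix xs assume xs: "xs \<in> factor_lists (Suc k) n"
  then obtain d ys where dys: "xs = d # ys"
    by (cases xs) (auto simp: factor_lists_def)
  with xs have "d dvd n" "ys \<in> factor_lists k (n div d)"
    by (auto simp: factor_lists_def)
  with dys show "xs \<in> (\<Union>d\<in>{d. d dvd n}. (#) d ` factor_lists k (n div d))"
    by blast
next
  fix xs assume "xs \<in> (\<Union>d\<in>{d. d dvd n}. (#) d ` factor_lists k (n div d))"
  then show "xs \<in> factor_lists (Suc k) n"
    using assms by (auto simp: factor_lists_def dvd_pos_nat)
qed

lemma finite_factor_lists: "n > 0 \<Longrightarrow> finite (factor_lists k n)"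
proof (induction k arbitrary: n)
  case 0
  have "factor_lists 0 n \<subseteq> {[]}"
    by (auto simp: factor_lists_def)
  then show ?case
    by (rule finite_subset) simp
next
  case (Suc k)
  have "n div d > 0" if "d dvd n" for d
    using that Suc.prems by (auto elim!: dvdE)
  then show ?case
    unfolding factor_lists_Suc[OF Suc.prems]
    using Suc.prems by (intro finite_UN_I finite_imageI Suc.IH) auto
qed

lemma divisor_fun_0: "divisor_fun 0 n = of_bool (n = 1)"
proof -
  have "{xs :: nat list. length xs = 0 \<and> (\<forall>x\<in>set xs. x > 0) \<and> prod_list xs = n} = (if n = 1 then {[]} else {})"
    by auto
  then show ?thesis
    by (simp add: divisor_fun_def)
qed

lemma divisor_fun_Suc:
  assumes "n > 0"
  shows "divisor_fun (Suc k) n = (\<Sum>d | d dvd n. divisor_fun k (n div d))"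
proof -
  have pos: "n div d > 0" if "d dvd n" for d
    using that assms by (auto elim!: dvdE)
  have "divisor_fun (Suc k) n = (\<Sum>d | d dvd n. card ((#) d ` factor_lists k (n div d)))"
    unfolding divisor_fun_eq_card factor_lists_Suc[OF assms]
    using assms pos by (intro card_UN_disjoint) (auto intro!: finite_imageI finite_factor_lists)
  then show ?thesis
    by (simp add: divisor_fun_eq_card card_image)
qed

lemma divisor_fun_1: "divisor_fun k 1 = 1"
  by (induction k) (simp_all add: divisor_fun_0 divisor_fun_Suc)

lemma bij_betw_divisors_prime_power_mult:
  fixes p m j :: nat
  assumes p: "prime p" and m: "\<not> p dvd m" "m > 0"
  shows "bij_betw (\<lambda>(i, d). p ^ i * d) ({..j} \<times> {d. d dvd m}) {d. d dvd p ^ j * m}"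
proof (rule bij_betw_imageI)
  show "inj_on (\<lambda>(i, d). p ^ i * d) ({..j} \<times> {d. d dvd m})"
  proof (rule inj_onI, clarify)
    fix i d i' d' assume dvd: "d dvd m" "d' dvd m" and eq: "p ^ i * d = p ^ i' * d'"
    have nd: "\<not> p dvd d" "\<not> p dvd d'" "d > 0" "d' > 0"
      using m dvd dvd_trans dvd_pos_nat by blast+
    have "multiplicity p (p ^ i * d) = multiplicity p (p ^ i' * d')"
      using eq by simp
    then have "i = i'"
      using nd p by (simp add: prime_elem_multiplicity_mult_distrib not_dvd_imp_multiplicity_0)
    with eq p show "i = i' \<and> d = d'"
      by (simp add: prime_gt_0_nat)
  qed
  show "(\<lambda>(i, d). p ^ i * d) ` ({..j} \<times> {d. d dvd m}) = {d. d dvd p ^ j * m}"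
  proof (intro equalityI subsetI)
    fix D assume "D \<in> {d. d dvd p ^ j * m}"
    then obtain b c where bc: "D = b * c" "b dvd p ^ j" "c dvd m"
      using division_decomp[of D "p ^ j" m] by auto
    then obtain i where "i \<le> j" "b = p ^ i"
      using divides_primepow_nat[OF p] by blast
    with bc show "D \<in> (\<lambda>(i, d). p ^ i * d) ` ({..j} \<times> {d. d dvd m})"
      by (auto intro!: image_eqI[of _ _ "(i, c)"])
  qed (auto intro!: mult_dvd_mono le_imp_power_dvd)
qed

text \<open>The divisors of \<open>p ^ j * m\<close> are the products \<open>p ^ i * d\<close> with
  \<open>i \<le> j\<close> and \<open>d\<close> dividing \<open>m\<close>, so the recursion in
  \<open>k\<close> factors, and its \<open>p\<close>-part is the recursion of
  \<open>multichoose\<close>.\<close>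

lemma divisor_fun_prime_power_mult:
  assumes p: "prime p" and m: "\<not> p dvd m" "m > 0"
  shows "divisor_fun k (p ^ j * m) = multichoose k j * divisor_fun k m"
  using m
proof (induction k arbitrary: j m)
  case 0
  have "p ^ j * m = 1 \<longleftrightarrow> j = 0 \<and> m = 1"
    using p by (auto simp: prime_nat_iff)
  then show ?case
    by (auto simp: divisor_fun_0 multichoose_0_left)
next
  case (Suc k)
  have pp: "p > 0"
    using p by (rule prime_gt_0_nat)
  have "divisor_fun (Suc k) (p ^ j * m) = (\<Sum>d | d dvd p ^ j * m. divisor_fun k (p ^ j * m div d))"
    using Suc.prems pp by (intro divisor_fun_Suc) simp
  also have "\<dots> = (\<Sum>(i, d)\<in>{..j} \<times> {d. d dvd m}. divisor_fun k (p ^ j * m div (p ^ i * d)))"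
    by (subst sum.reindex_bij_betw[OF bij_betw_divisors_prime_power_mult[OF p Suc.prems], symmetric])
       (simp add: split_beta)
  also have "\<dots> = (\<Sum>(i, d)\<in>{..j} \<times> {d. d dvd m}. multichoose k (j - i) * divisor_fun k (m div d))"
  proof (intro sum.cong refl, clarify)
    fix i d assume i: "i \<le> j" and d: "d dvd m"
    then obtain e where e: "m = d * e" by blast
    have "p ^ j = p ^ i * p ^ (j - i)"
      using i by (simp flip: power_add)
    then have "p ^ j * m = (p ^ i * d) * (p ^ (j - i) * e)"
      by (simp add: e)
    moreover have "p ^ i * d > 0" "e > 0" "\<not> p dvd e" "m div d = e"
      using e Suc.prems pp by auto
    ultimately show "divisor_fun k (p ^ j * m div (p ^ i * d)) = multichoose k (j - i) * divisor_fun k (m div d)"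
      using Suc.IH[of e "j - i"] by simp
  qed
  also have "\<dots> = (\<Sum>i\<le>j. multichoose k (j - i)) * (\<Sum>d | d dvd m. divisor_fun k (m div d))"
    by (simp add: sum.cartesian_product sum_product)
  also have "(\<Sum>i\<le>j. multichoose k (j - i)) = multichoose (Suc k) j"
    using sum.atLeastAtMost_rev[of "\<lambda>i. multichoose k i" 0 j]
    by (simp add: multichoose_Suc_left atMost_atLeast0)
  also have "(\<Sum>d | d dvd m. divisor_fun k (m div d)) = divisor_fun (Suc k) m"
    using Suc.prems by (simp add: divisor_fun_Suc)
  finally show ?case .
qed

lemma big_omega_prime_power_mult:
  assumes "prime p" "m > 0"
  shows "big_omega (p ^ j * m) = j + big_omega m"
  using assms prime_gt_0_nat[of p]
  by (simp add: big_omega_def prime_factorization_mult prime_factorization_prime_power)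

lemma Phi_prime_power_mult:
  assumes "prime p" "\<not> p dvd m" "m > 0"
  shows "Phi \<alpha> (p ^ j * m) = prime_weight \<alpha> j * Phi \<alpha> m"
  using assms
  by (simp add: Phi_def prime_weight_def divisor_fun_prime_power_mult big_omega_prime_power_mult power_add)

lemma Phi_1: "Phi \<alpha> 1 = 1"
  using divisor_fun_1 by (simp add: Phi_def big_omega_def)

section \<open>Splitting off one prime\<close>

text \<open>The index set is arbitrary because the cofactors of a fixed power of \<open>p\<close> in
  an initial segment do not form an initial segment.\<close>

definition dseries :: "nat set \<Rightarrow> (nat \<Rightarrow> complex) \<Rightarrow> real \<Rightarrow> complex" where
  "dseries A a t = (\<Sum>n\<in>A. a n * cis (- (t * ln n)))"

lemma continuous_on_dseries: "continuous_on S (dseries A a)"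
  unfolding dseries_def by (intro continuous_intros)

definition prime_slice :: "nat \<Rightarrow> nat set \<Rightarrow> nat \<Rightarrow> nat set" where
  "prime_slice p A j = {m. \<not> p dvd m \<and> p ^ j * m \<in> A}"

lemma finite_prime_slice:
  assumes "finite A" "prime p"
  shows "finite (prime_slice p A j)"
proof (rule finite_subset)
  show "prime_slice p A j \<subseteq> (\<lambda>n. n div p ^ j) ` A"
  proof
    fix m assume "m \<in> prime_slice p A j"
    moreover have "m = p ^ j * m div p ^ j"
      using assms by (simp add: prime_gt_0_nat)
    ultimately show "m \<in> (\<lambda>n. n div p ^ j) ` A"
      unfolding prime_slice_def by blast
  qed
qed (use assms in simp)

text \<open>The bound \<open>\<Sum>A\<close> on the exponents is crude but depends on
  \<open>A\<close> alone: \<open>j < p ^ j \<le> n \<le> \<Sum>A\<close>.\<close>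

lemma sum_prime_slice:
  assumes A: "finite A" "\<And>n. n \<in> A \<Longrightarrow> n > 0" and p: "prime p"
  shows "(\<Sum>n\<in>A. G n) = (\<Sum>j\<le>\<Sum>A. \<Sum>m\<in>prime_slice p A j. G (p ^ j * m))"
proof -
  have "bij_betw (\<lambda>(j, m). p ^ j * m) (SIGMA j:{..\<Sum>A}. prime_slice p A j) A"
  proof (rule bij_betw_imageI)
    show "inj_on (\<lambda>(j, m). p ^ j * m) (SIGMA j:{..\<Sum>A}. prime_slice p A j)"
    proof (rule inj_onI, clarify)
      fix i d i' d' assume sl: "d \<in> prime_slice p A i" "d' \<in> prime_slice p A i'"
        and eq: "p ^ i * d = p ^ i' * d'"
      have nd: "\<not> p dvd d" "\<not> p dvd d'" "d > 0" "d' > 0"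
        using sl A(2) unfolding prime_slice_def by fastforce+
      have "multiplicity p (p ^ i * d) = multiplicity p (p ^ i' * d')"
        using eq by simp
      then have "i = i'"
        using nd p by (simp add: prime_elem_multiplicity_mult_distrib not_dvd_imp_multiplicity_0)
      with eq p show "i = i' \<and> d = d'"
        by (simp add: prime_gt_0_nat)
    qed
    show "(\<lambda>(j, m). p ^ j * m) ` (SIGMA j:{..\<Sum>A}. prime_slice p A j) = A"
    proof (intro equalityI subsetI)
      fix n assume n: "n \<in> A"
      define j where "j = multiplicity p n"
      obtain m where m: "n = p ^ j * m" "\<not> p dvd m"
        using multiplicity_decompose'[of n p] A(2)[OF n] p unfolding j_def by (metis not_prime_unit not_gr_zero)
      have "j < p ^ j"
        by (intro power_gt_expt prime_gt_Suc_0_nat p)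
      also have "p ^ j \<le> n"
        using m A(2)[OF n] by (cases m) auto
      also have "n \<le> \<Sum>A"
        using A n by (intro member_le_sum) auto
      finally have "(j, m) \<in> (SIGMA j:{..\<Sum>A}. prime_slice p A j)"
        using m n by (auto simp: prime_slice_def)
      with m show "n \<in> (\<lambda>(j, m). p ^ j * m) ` (SIGMA j:{..\<Sum>A}. prime_slice p A j)"
        by force
    qed (auto simp: prime_slice_def)
  qed
  from sum.reindex_bij_betw[OF this, of G, symmetric] show ?thesis
    using A p by (simp add: split_beta sum.Sigma finite_prime_slice)
qed

text \<open>Grouping by the power of \<open>p\<close> gives a polynomial in \<open>z\<close>. Its
  coefficients have frequencies \<open>ln m\<close> with \<open>p\<close> not dividing
  \<open>m\<close>, as \<open>split_trig_poly\<close> demands.\<close>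

lemma dseries_split:
  fixes p :: nat and A :: "nat set" and a :: "nat \<Rightarrow> complex"
  assumes A: "finite A" "\<And>n. n \<in> A \<Longrightarrow> n > 0" and p: "prime p"
  defines "b \<equiv> \<lambda>j. dseries (prime_slice p A j) (\<lambda>m. a (p ^ j * m))"
  defines "F \<equiv> \<lambda>t z. \<Sum>j\<le>\<Sum>A. b j t * z ^ j"
  shows "split_trig_poly p F" "dseries A a t = F t (cis (- (t * ln p)))"
proof -
  have "split_trig_poly p (\<lambda>t z. \<Sum>j\<le>\<Sum>A. \<Sum>m\<in>prime_slice p A j. a (p ^ j * m) * cis (- (t * ln m)) * z ^ j)"
  proof (intro split_trig_poly_sum[OF p])
    fix j m assume "m \<in> prime_slice p A j"
    then show "split_trig_poly p (\<lambda>t z. a (p ^ j * m) * cis (- (t * ln m)) * z ^ j)"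
      using split_trig_poly.monomial[of p 1 m "a (p ^ j * m)" j 0] p
      by (simp add: prime_slice_def prime_nat_iff)
  qed
  then show "split_trig_poly p F"
    by (simp add: F_def b_def dseries_def sum_distrib_right)
  have "dseries A a t = (\<Sum>j\<le>\<Sum>A. \<Sum>m\<in>prime_slice p A j. a (p ^ j * m) * cis (- (t * ln (p ^ j * m))))"
    unfolding dseries_def by (rule sum_prime_slice[OF A p])
  also have "\<dots> = (\<Sum>j\<le>\<Sum>A. \<Sum>m\<in>prime_slice p A j. a (p ^ j * m) * cis (- (t * ln m)) * cis (- (t * ln p)) ^ j)"
  proof (intro sum.cong refl)
    fix j m assume "m \<in> prime_slice p A j"
    then have "p ^ j * m > 0"
      using A(2) unfolding prime_slice_def by blast
    then have "ln (real (p ^ j * m)) = real j * ln (real p) + ln (real m)"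
      by (simp add: ln_mult ln_realpow)
    then have "cis (- (t * ln (real (p ^ j * m)))) = cis (- (t * ln m)) * cis (- (t * ln p)) ^ j"
      by (simp add: cis_mult Complex.DeMoivre algebra_simps)
    then show "a (p ^ j * m) * cis (- (t * ln (p ^ j * m))) = a (p ^ j * m) * cis (- (t * ln m)) * cis (- (t * ln p)) ^ j"
      by simp
  qed
  also have "\<dots> = F t (cis (- (t * ln p)))"
    by (simp add: F_def b_def dseries_def sum_distrib_right)
  finally show "dseries A a t = F t (cis (- (t * ln p)))" .
qed

lemma dseries_mean_exists:
  assumes A: "finite A" "\<And>n. n \<in> A \<Longrightarrow> n > 0" and q: "0 < q"
  shows "\<exists>L. has_mean (\<lambda>t. norm (dseries A a t) powr q) L"
proof -
  define F where "F = (\<lambda>t z. \<Sum>j\<le>\<Sum>A. dseries (prime_slice 2 A j) (\<lambda>m. a (2 ^ j * m)) t * z ^ j)"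
  have "split_trig_poly 2 F" "dseries A a t = F t (cis (- (t * ln (real 2))))" for t
    unfolding F_def by (rule dseries_split[OF A two_is_prime_nat]; assumption)+
  then show ?thesis
    using power_mean_exists[OF two_is_prime_nat _ q, of F] by simp
qed

lemma poly_sum_monom:
  fixes c :: "nat \<Rightarrow> 'a::comm_ring_1"
  shows "poly (\<Sum>j\<le>N. monom (c j) j) z = (\<Sum>j\<le>N. c j * z ^ j)"
  "coeff (\<Sum>j\<le>N. monom (c j) j) i = (if i \<le> N then c i else 0)"
  "degree (\<Sum>j\<le>N. monom (c j) j) \<le> N"
proof -
  show "coeff (\<Sum>j\<le>N. monom (c j) j) i = (if i \<le> N then c i else 0)" for i
    by (simp add: coeff_sum sum.delta)
  then show "degree (\<Sum>j\<le>N. monom (c j) j) \<le> N"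
    by (intro degree_le) simp
  show "poly (\<Sum>j\<le>N. monom (c j) j) z = (\<Sum>j\<le>N. c j * z ^ j)"
    unfolding poly_sum poly_monom ..
qed

lemma prime_factors_slice_subset:
  assumes "\<And>n. n \<in> A \<Longrightarrow> n > 0 \<and> prime_factors n \<subseteq> insert p S" and "m \<in> prime_slice p A j"
  shows "m > 0 \<and> prime_factors m \<subseteq> S"
proof -
  have m: "\<not> p dvd m" "p ^ j * m \<in> A"
    using assms(2) by (auto simp: prime_slice_def)
  then have pos: "p ^ j * m > 0" and sub: "prime_factors (p ^ j * m) \<subseteq> insert p S"
    using assms(1) by blast+
  have "prime_factors m \<subseteq> prime_factors (p ^ j * m)"
    using pos by (intro dvd_prime_factors) auto
  then have "prime_factors m \<subseteq> S"
    using sub m(1) by (auto simp: in_prime_factors_iff)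
  with pos show ?thesis by simp
qed

text \<open>Averaging over the variable of \<open>p\<close> changes the integrand by a function of
  mean 0, so \<open>L\<close> is retained. What remains at each \<open>t\<close> is a one-variable
  norm, to which the coefficient inequalities apply.\<close>

lemma iterated_mean_dseries:
  fixes p :: nat and A :: "nat set" and a :: "nat \<Rightarrow> complex" and q :: real
  assumes A: "finite A" "\<And>n. n \<in> A \<Longrightarrow> n > 0" and p: "prime p" and q: "0 < q"
    and L: "has_mean (\<lambda>t. norm (dseries A a t) powr q) L"
  defines "b \<equiv> \<lambda>j. dseries (prime_slice p A j) (\<lambda>m. a (p ^ j * m))"
  defines "P \<equiv> \<lambda>t. \<Sum>j\<le>\<Sum>A. monom (b j t) j"
  shows "continuous_on UNIV (\<lambda>t. cavg (\<lambda>z. norm (poly (P t) z) powr q))"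
    "has_mean (\<lambda>t. cavg (\<lambda>z. norm (poly (P t) z) powr q)) L"
    "0 \<le> cavg (\<lambda>z. norm (poly (P t) z) powr q)"
proof -
  define F where "F = (\<lambda>t z. \<Sum>j\<le>\<Sum>A. b j t * z ^ j)"
  have P: "poly (P t) z = F t z" for t z
    by (simp add: P_def F_def poly_sum_monom)
  have F: "split_trig_poly p F" "\<And>t. dseries A a t = F t (cis (- (t * ln p)))"
    using dseries_split[OF A p, of a] by (simp_all add: F_def b_def)
  show cont: "continuous_on UNIV (\<lambda>t. cavg (\<lambda>z. norm (poly (P t) z) powr q))"
    unfolding P
    by (rule continuous_on_cavg, unfold split_beta, rule continuous_on_norm_powr[OF q],
        rule split_trig_poly_continuous'[OF F(1)]) (intro continuous_intros)+
  have "has_mean (\<lambda>t. norm (dseries A a t) powr q - (norm (F t (cis (- (t * ln p)))) powr q -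
      cavg (\<lambda>z. norm (F t z) powr q))) (L - 0)"
  proof (rule has_mean_diff)
    show "continuous_on UNIV (\<lambda>t. norm (dseries A a t) powr q)"
      by (rule continuous_on_norm_powr[OF q continuous_on_dseries])
    then show "continuous_on UNIV (\<lambda>t. norm (F t (cis (- (t * ln p)))) powr q - cavg (\<lambda>z. norm (F t z) powr q))"
      using cont unfolding F(2) P by (rule continuous_on_diff)
  qed (use L power_mean_iterated[OF p F(1) q] in auto)
  then show "has_mean (\<lambda>t. cavg (\<lambda>z. norm (poly (P t) z) powr q)) L"
    unfolding P by (simp add: F(2))
  show "0 \<le> cavg (\<lambda>z. norm (poly (P t) z) powr q)"
    by (rule cavg_nonneg, rule continuous_on_norm_powr[OF q]) (auto intro!: continuous_intros)
qed

lemma dseries_units: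
  assumes A: "\<And>n. n \<in> A \<Longrightarrow> n > 0 \<and> prime_factors n \<subseteq> {}"
    and L: "has_mean (\<lambda>t. norm (dseries A a t) powr q) L"
  shows "A = {} \<and> L = 0 \<or> A = {1} \<and> L = norm (a 1) powr q"
proof -
  have "n = 1" if "n \<in> A" for n
    using A[OF that] by (auto simp: prime_factorization_empty_iff)
  then have cases: "A = {} \<or> A = {1}"
    by blast
  have unique: "L = c" if "\<And>t. norm (dseries A a t) powr q = c" for c
    using L has_mean_const[of c] unfolding that has_mean_def by (intro tendsto_unique) auto
  from cases show ?thesis
  proof
    assume "A = {}"
    then show ?thesis
      using unique[of 0] by (simp add: dseries_def)
  next
    assume "A = {1}"
    then show ?thesis
      using unique[of "norm (a 1) powr q"] by (simp add: dseries_def)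
  qed
qed

text \<open>Induction over the primes, with support and coefficients left general so that the
  hypothesis covers every slice. The coefficient inequality is used at each \<open>t\<close>,
  Minkowski takes the sum over powers of \<open>p\<close> out of the mean, and the weights combine
  since \<open>Phi\<close> is multiplicative.\<close>

lemma dseries_lower:
  assumes q: "0 < q" "q \<le> 2" and S: "finite S" "\<And>p. p \<in> S \<Longrightarrow> prime p"
    and A: "finite A" "\<And>n. n \<in> A \<Longrightarrow> n > 0 \<and> prime_factors n \<subseteq> S"
    and L: "has_mean (\<lambda>t. norm (dseries A a t) powr q) L"
  shows "(\<Sum>n\<in>A. (norm (a n))\<^sup>2 / Phi (2 / q) n) \<le> L powr (2 / q)"
  using S A L
proof (induction S arbitrary: A a L rule: finite_induct)
  case empty
  from dseries_units[OF empty(3,4)] show ?case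
    using q by (auto simp: Phi_1[simplified] powr_powr)
next
  case (insert p S)
  have p: "prime p"
    using insert.prems by simp
  have pos: "\<And>n. n \<in> A \<Longrightarrow> n > 0"
    using insert.prems by blast
  define b where "b = (\<lambda>j. dseries (prime_slice p A j) (\<lambda>m. a (p ^ j * m)))"
  define w where "w = prime_weight (2 / q)"
  have w: "w j > 0" for j
    unfolding w_def using q by (intro prime_weight_pos) (simp add: field_simps)
  have slice: "finite (prime_slice p A j)" "\<And>m. m \<in> prime_slice p A j \<Longrightarrow> m > 0 \<and> prime_factors m \<subseteq> S" for j
    using finite_prime_slice[OF insert.prems(2) p] prime_factors_slice_subset[OF insert.prems(3)] by blast+
  have "\<forall>j. \<exists>M. has_mean (\<lambda>t. norm (b j t) powr q) M"
    unfolding b_def using slice q by (intro allI dseries_mean_exists) auto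
  then obtain M where M: "\<And>j. has_mean (\<lambda>t. norm (b j t) powr q) (M j)"
    by metis
  let ?h = "\<lambda>t. cavg (\<lambda>z. norm (poly (\<Sum>j\<le>\<Sum>A. monom (b j t) j) z) powr q)"
  have h: "continuous_on UNIV ?h" "has_mean ?h L" "0 \<le> ?h t" for t
    unfolding b_def by (rule iterated_mean_dseries[OF insert.prems(2) pos p q(1) insert.prems(4)]; assumption)+
  have "(\<Sum>n\<in>A. (norm (a n))\<^sup>2 / Phi (2 / q) n) =
      (\<Sum>j\<le>\<Sum>A. \<Sum>m\<in>prime_slice p A j. (norm (a (p ^ j * m)))\<^sup>2 / Phi (2 / q) (p ^ j * m))"
    by (rule sum_prime_slice[OF insert.prems(2) pos p])
  also have "\<dots> = (\<Sum>j\<le>\<Sum>A. 1 / w j * (\<Sum>m\<in>prime_slice p A j. (norm (a (p ^ j * m)))\<^sup>2 / Phi (2 / q) m))"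
    unfolding sum_distrib_left
    by (intro sum.cong refl, subst Phi_prime_power_mult[OF p]) (use slice in \<open>auto simp: prime_slice_def w_def\<close>)
  also have "\<dots> \<le> (\<Sum>j\<le>\<Sum>A. 1 / w j * M j powr (2 / q))"
  proof (intro sum_mono mult_left_mono)
    fix j
    show "(\<Sum>m\<in>prime_slice p A j. (norm (a (p ^ j * m)))\<^sup>2 / Phi (2 / q) m) \<le> M j powr (2 / q)"
      using M[of j] slice insert.prems(1) unfolding b_def by (intro insert.IH) auto
  qed (use w in \<open>simp add: less_imp_le\<close>)
  also have "\<dots> \<le> L powr (2 / q)"
  proof (rule mean_minkowski_lower[where b = b and h = ?h])
    fix t
    have "(\<Sum>j\<le>\<Sum>A. 1 / w j * (norm (b j t))\<^sup>2) \<le> ?h t powr (2 / q)"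
      using coefficient_inequality_lower[OF q poly_sum_monom(3), of "\<lambda>j. b j t" "\<Sum>A"]
      by (simp add: poly_sum_monom(2) w_def)
    then have "(\<Sum>j\<le>\<Sum>A. 1 / w j * (norm (b j t))\<^sup>2) powr (q / 2) \<le> (?h t powr (2 / q)) powr (q / 2)"
      using q w by (intro powr_mono2 sum_nonneg) (auto simp: less_imp_le)
    then show "(\<Sum>j\<le>\<Sum>A. 1 / w j * (norm (b j t))\<^sup>2) powr (q / 2) \<le> ?h t"
      using q h(3)[of t] by (simp add: powr_powr)
  next
    show "continuous_on UNIV (b j)" for j
      unfolding b_def by (rule continuous_on_dseries)
  qed (use q w M h in \<open>auto simp: less_imp_le\<close>)
  finally show ?case .
qed

lemma dseries_upper:
  assumes q: "2 \<le> q" and S: "finite S" "\<And>p. p \<in> S \<Longrightarrow> prime p"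
    and A: "finite A" "\<And>n. n \<in> A \<Longrightarrow> n > 0 \<and> prime_factors n \<subseteq> S"
    and L: "has_mean (\<lambda>t. norm (dseries A a t) powr q) L"
  shows "L powr (2 / q) \<le> (\<Sum>n\<in>A. (norm (a n))\<^sup>2 * Phi (q / 2) n)"
  using S A L
proof (induction S arbitrary: A a L rule: finite_induct)
  case empty
  from dseries_units[OF empty(3,4)] show ?case
    using q by (auto simp: Phi_1[simplified] powr_powr)
next
  case (insert p S)
  have q0: "q > 0"
    using q by simp
  have p: "prime p"
    using insert.prems by simp
  have pos: "\<And>n. n \<in> A \<Longrightarrow> n > 0"
    using insert.prems by blast
  define b where "b = (\<lambda>j. dseries (prime_slice p A j) (\<lambda>m. a (p ^ j * m)))"
  define w where "w = prime_weight (q / 2)"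
  have w: "w j > 0" for j
    unfolding w_def using q by (intro prime_weight_pos) simp
  have slice: "finite (prime_slice p A j)" "\<And>m. m \<in> prime_slice p A j \<Longrightarrow> m > 0 \<and> prime_factors m \<subseteq> S" for j
    using finite_prime_slice[OF insert.prems(2) p] prime_factors_slice_subset[OF insert.prems(3)] by blast+
  have "\<forall>j. \<exists>M. has_mean (\<lambda>t. norm (b j t) powr q) M"
    unfolding b_def using slice q0 by (intro allI dseries_mean_exists) auto
  then obtain M where M: "\<And>j. has_mean (\<lambda>t. norm (b j t) powr q) (M j)"
    by metis
  let ?h = "\<lambda>t. cavg (\<lambda>z. norm (poly (\<Sum>j\<le>\<Sum>A. monom (b j t) j) z) powr q)"
  have h: "continuous_on UNIV ?h" "has_mean ?h L" "0 \<le> ?h t" for t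
    unfolding b_def by (rule iterated_mean_dseries[OF insert.prems(2) pos p q0 insert.prems(4)]; assumption)+
  have "L powr (2 / q) \<le> (\<Sum>j\<le>\<Sum>A. w j * M j powr (2 / q))"
  proof (rule mean_minkowski_upper[where b = b and h = ?h])
    show "?h t \<le> (\<Sum>j\<le>\<Sum>A. w j * (norm (b j t))\<^sup>2) powr (q / 2)" for t
      using coefficient_inequality_upper[OF q poly_sum_monom(3), of "\<lambda>j. b j t" "\<Sum>A"]
      by (simp add: poly_sum_monom(2) w_def mult.commute)
    show "continuous_on UNIV (b j)" for j
      unfolding b_def by (rule continuous_on_dseries)
  qed (use q q0 w M h in \<open>auto simp: less_imp_le\<close>)
  also have "\<dots> \<le> (\<Sum>j\<le>\<Sum>A. w j * (\<Sum>m\<in>prime_slice p A j. (norm (a (p ^ j * m)))\<^sup>2 * Phi (q / 2) m))"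
  proof (intro sum_mono mult_left_mono)
    fix j
    show "M j powr (2 / q) \<le> (\<Sum>m\<in>prime_slice p A j. (norm (a (p ^ j * m)))\<^sup>2 * Phi (q / 2) m)"
      using M[of j] slice insert.prems(1) unfolding b_def by (intro insert.IH) auto
  qed (use w in \<open>simp add: less_imp_le\<close>)
  also have "\<dots> = (\<Sum>j\<le>\<Sum>A. \<Sum>m\<in>prime_slice p A j. (norm (a (p ^ j * m)))\<^sup>2 * Phi (q / 2) (p ^ j * m))"
    unfolding sum_distrib_left
    by (intro sum.cong refl, subst Phi_prime_power_mult[OF p]) (use slice in \<open>auto simp: prime_slice_def w_def\<close>)
  also have "\<dots> = (\<Sum>n\<in>A. (norm (a n))\<^sup>2 * Phi (q / 2) n)"
    by (rule sum_prime_slice[OF insert.prems(2) pos p, symmetric])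
  finally show ?case .
qed

section \<open>Return to the Besicovitch norm\<close>

lemma dirichlet_poly_eq_dseries: "dirichlet_poly N a (\<i> * of_real t) = dseries {1..N} a t"
  unfolding dirichlet_poly_def dseries_def
  by (intro sum.cong refl) (simp add: powr_def Ln_of_nat cis_conv_exp mult_ac)

text \<open>\<open>Lim\<close> is informative only once a limit is known to exist; the mean supplied
  by \<open>dseries_mean_exists\<close> is that limit.\<close>

lemma besicovitch_norm_mean:
  assumes "q > 0"
  obtains L where "has_mean (\<lambda>t. norm (dseries {1..N} a t) powr q) L" "0 \<le> L"
    "besicovitch_norm q (dirichlet_poly N a) = L powr (1 / q)"
proof -
  obtain L where L: "has_mean (\<lambda>t. norm (dseries {1..N} a t) powr q) L"
    using dseries_mean_exists[of "{1..N}" q a] assms by auto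
  have "0 \<le> L"
    by (rule has_mean_nonneg[OF continuous_on_norm_powr[OF assms continuous_on_dseries] _ L]) simp
  moreover have "Lim at_top (\<lambda>T. 1 / T * integral {0..T} (\<lambda>t. norm (dseries {1..N} a t) powr q)) = L"
    using L unfolding has_mean_def tavg_def by (intro tendsto_Lim) simp_all
  ultimately show ?thesis
    using L by (intro that[of L]) (simp_all add: besicovitch_norm_def dirichlet_poly_eq_dseries)
qed

theorem theorem5:
  fixes N :: nat and a :: "nat \<Rightarrow> complex"
  assumes "N > 0"
  shows "(\<forall>q::real. 0 < q \<and> q \<le> 2 \<longrightarrow>
            sqrt (\<Sum>n=1..N. (norm (a n))\<^sup>2 / Phi (2 / q) n)
              \<le> besicovitch_norm q (dirichlet_poly N a)) \<and>
         (\<forall>q::real. q \<ge> 2 \<longrightarrow>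
            besicovitch_norm q (dirichlet_poly N a)
              \<le> sqrt (\<Sum>n=1..N. (norm (a n))\<^sup>2 * Phi (q / 2) n))"
proof (intro conjI allI impI)
  define S where "S = {p::nat. prime p \<and> p \<le> N}"
  have S: "finite S" "\<And>p. p \<in> S \<Longrightarrow> prime p"
    by (auto simp: S_def)
  have A: "n > 0 \<and> prime_factors n \<subseteq> S" if "n \<in> {1..N}" for n
    using that by (auto simp: S_def in_prime_factors_iff intro: order_trans[OF dvd_imp_le])
  have root: "sqrt (L powr (2 / q)) = L powr (1 / q)" if "0 \<le> L" for L q :: real
    by (simp add: powr_powr flip: powr_half_sqrt)
  show "sqrt (\<Sum>n=1..N. (norm (a n))\<^sup>2 / Phi (2 / q) n) \<le> besicovitch_norm q (dirichlet_poly N a)"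
    if q: "0 < q \<and> q \<le> 2" for q
  proof -
    obtain L where L: "has_mean (\<lambda>t. norm (dseries {1..N} a t) powr q) L" "0 \<le> L"
      "besicovitch_norm q (dirichlet_poly N a) = L powr (1 / q)"
      using besicovitch_norm_mean q by blast
    have "(\<Sum>n=1..N. (norm (a n))\<^sup>2 / Phi (2 / q) n) \<le> L powr (2 / q)"
      by (rule dseries_lower[OF _ _ S _ A L(1)]) (use q in auto)
    then show ?thesis
      unfolding L(3) root[OF L(2), symmetric] by (rule real_sqrt_le_mono)
  qed
  show "besicovitch_norm q (dirichlet_poly N a) \<le> sqrt (\<Sum>n=1..N. (norm (a n))\<^sup>2 * Phi (q / 2) n)"
    if q: "2 \<le> q" for q
  proof -
    obtain L where L: "has_mean (\<lambda>t. norm (dseries {1..N} a t) powr q) L" "0 \<le> L"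
      "besicovitch_norm q (dirichlet_poly N a) = L powr (1 / q)"
      using besicovitch_norm_mean[of q] q by (metis less_le_trans zero_less_numeral)
    have "L powr (2 / q) \<le> (\<Sum>n=1..N. (norm (a n))\<^sup>2 * Phi (q / 2) n)"
      by (rule dseries_upper[OF q S _ A L(1)]) auto
    then show ?thesis
      unfolding L(3) root[OF L(2), symmetric] by (rule real_sqrt_le_mono)
  qed
qed

end
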